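(* Consider representations $\rho:\Gamma\to\mathrm{GL}_3(\mathbb{C})$ that are reducible but indecomposable, possess a two-dimensional subrepresentation $\rho_0$ (so that there is an exact sequence $0\to\rho_0\to\rho\to\rho_1\to0$ with $\rho_1$ a character), and are such that $\rho(T)$ is diagonalizable. Up to equivalence: (i) There are exactly 6 such $\rho$ with $\rho_0$ a direct sum of two characters of $\Gamma$. They are represented by $\rho(T)=\mathrm{diag}(\lambda_1,\lambda_2,\lambda_3)$ with $\lambda_j=e(x_j/6)$, $\rho(S)=\begin{pmatrix}-\sigma&0&1\\0&-\sigma&1\\0&0&\sigma\end{pmatrix}$, $\sigma=\lambda_3^3$, where $(x_1,x_2,x_3)$ is one of $(1,5,0),(2,0,1),(3,1,2),(4,2,3),(5,3,4),(0,4,5)$. (ii) There are exactly 18 such $\rho$ with $\rho_0$ reducible but indecomposable. They are represented by $\rho(T)=\mathrm{diag}(\lambda_1,\lambda_2,\lambda_3)$ with $\lambda_j=e(x_j/6)$ and either (a) $\rho(S)=\begin{pmatrix}-\sigma&1&1\\0&\sigma&0\\0&0&\sigma\end{pmatrix}$ with $\sigma=\lambda_2^3$ and $(x_1,x_2,x_3)$ one of $(1,2,0),(5,4,0),(2,3,1),(0,5,1),(3,4,2),(4,5,3)$; or (b) $\rho(S)=\begin{pmatrix}\sigma&-2\sigma&1\\0&-\sigma&1\\0&0&\sigma\end{pmatrix}$ with $\sigma=\lambda_1^3$ and $(x_1,x_2,x_3)$ one of $(5,0,1),(1,0,5),(0,1,2),(2,1,0),(1,2,3),(3,2,1),(2,3,4),(4,3,2),(3,4,5),(5,4,3),(4,5,0),(0,5,4)$.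 (iii) For every irreducible two-dimensional representation $\rho_0$ of $\Gamma$ such that the ratio of the two eigenvalues of $\rho_0(T)$ is different from $-1$, there are exactly 2 such $\rho$ whose two-dimensional subrepresentation is equivalent to $\rho_0$ (and there are infinitely many such choices of $\rho_0$).
   Context: $\Gamma=\mathrm{PSL}_2(\mathbb{Z})$, and $S,T$ denote the images in $\Gamma$ of $\begin{pmatrix}0&-1\\1&0\end{pmatrix}$ and $\begin{pmatrix}1&1\\0&1\end{pmatrix}$; a matrix representation of $\Gamma$ is determined by matrices $\rho(S),\rho(T)$ with $\rho(S)^2=\rho(ST)^3=1$. For $r\in\mathbb{R}$, $e(r)=e^{2\pi i r}$. A character of $\Gamma$ is a one-dimensional representation; every character has order dividing 6. Equivalence of representations means conjugacy by an element of $\mathrm{GL}_3(\mathbb{C})$.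
   Formalization: In (iii) the two eigenvalues of ρ₀(T) are also required to be distinct; for an irreducible ρ₀ with a double eigenvalue (e.g. ρ₀(S)=iS, ρ₀(T)=iT) ρ₀(T) is not diagonalizable and no such ρ exists. *)

theory Defs
  imports "HOL-Analysis.Analysis" "HOL-Algebra.Coset"
begin

section \<open>The modular group\<close>

definition SL2Z :: "(int^2^2) monoid" where
  "SL2Z = \<lparr>carrier = {A. det A = 1}, mult = (**), one = mat 1\<rparr>"

definition PSL2Z :: "(int^2^2) set monoid" where
  "PSL2Z = SL2Z Mod {mat 1, - mat 1}"

definition proj :: "int^2^2 \<Rightarrow> (int^2^2) set" where
  "proj A = {mat 1, - mat 1} #>\<^bsub>SL2Z\<^esub> A"

definition elt_S :: "(int^2^2) set" where
  "elt_S = proj (vector [vector [0, -1], vector [1, 0]])"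

definition elt_T :: "(int^2^2) set" where
  "elt_T = proj (vector [vector [1, 1], vector [0, 1]])"

lemma group_SL2Z: "group SL2Z"
proof (rule groupI)
  fix A assume "A \<in> carrier SL2Z"
  then have d: "A$1$1 * A$2$2 - A$1$2 * A$2$1 = 1"
    by (simp add: SL2Z_def det_2)
  let ?B = "vector [vector [A$2$2, - A$1$2], vector [- A$2$1, A$1$1]] :: int^2^2"
  have "det ?B = 1" using d by (simp add: det_2 mult.commute)
  moreover have "?B ** A = mat 1"
    using d by (simp add: vec_eq_iff forall_2 matrix_matrix_mult_def sum_2 mat_def mult.commute)
  ultimately show "\<exists>B\<in>carrier SL2Z. B \<otimes>\<^bsub>SL2Z\<^esub> A = \<one>\<^bsub>SL2Z\<^esub>"
    unfolding SL2Z_def by auto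
qed (auto simp: SL2Z_def det_mul matrix_mul_assoc)

lemma normal_center_SL2Z: "{mat 1, - mat 1} \<lhd> SL2Z"
proof -
  interpret group SL2Z by (rule group_SL2Z)
  have neg: "(- mat 1 :: int^2^2) ** A = - A" "A ** (- mat 1) = - A" for A :: "int^2^2"
    by (simp_all add: vec_eq_iff forall_2 matrix_matrix_mult_def sum_2 mat_def)
  have c: "- mat 1 \<in> carrier SL2Z"
    by (simp add: SL2Z_def det_2 mat_def)
  have i: "inv\<^bsub>SL2Z\<^esub> (- mat 1) = - mat 1"
    by (rule inv_equality) (use c in \<open>simp_all add: SL2Z_def neg\<close>)
  have o: "\<one>\<^bsub>SL2Z\<^esub> = mat 1" by (simp add: SL2Z_def)
  have "subgroup {mat 1, - mat 1} SL2Z"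
  proof (rule subgroupI)
    show "{mat 1, - mat 1} \<subseteq> carrier SL2Z" using c one_closed unfolding o by simp
    show "inv\<^bsub>SL2Z\<^esub> a \<in> {mat 1, - mat 1}" if "a \<in> {mat 1, - mat 1}" for a
      using that i inv_one unfolding o by auto
    show "a \<otimes>\<^bsub>SL2Z\<^esub> b \<in> {mat 1, - mat 1}"
      if "a \<in> {mat 1, - mat 1}" "b \<in> {mat 1, - mat 1}" for a b
      using that by (auto simp: SL2Z_def neg)
  qed simp
  then show ?thesis
    by (rule normalI) (auto simp: r_coset_def l_coset_def SL2Z_def neg)
qed

lemma group_PSL2Z: "group PSL2Z"
  unfolding PSL2Z_def by (rule normal.factorgroup_is_group[OF normal_center_SL2Z])

section \<open>Matrix representations\<close>

definition GL :: "(complex^'n^'n) monoid" where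
  "GL = \<lparr>carrier = {A. invertible A}, mult = (**), one = mat 1\<rparr>"

type_synonym 'n mrep = "(int^2^2) set \<Rightarrow> complex^'n^'n"

definition is_rep :: "'n::finite mrep \<Rightarrow> bool" where
  "is_rep \<rho> \<longleftrightarrow> \<rho> \<in> hom PSL2Z GL"

definition is_character :: "((int^2^2) set \<Rightarrow> complex) \<Rightarrow> bool" where
  "is_character \<eta> \<longleftrightarrow> \<eta> \<in> hom PSL2Z \<lparr>carrier = {z. z \<noteq> 0}, mult = (*), one = 1\<rparr>"

text \<open>Values of a representation outside the carrier of the group are irrelevant, so
  equivalence only looks at the carrier; in particular counting classes of
  \<open>rep_equiv\<close> is not affected by these junk values.\<close>

definition equivalent :: "'n::finite mrep \<Rightarrow> 'n mrep \<Rightarrow> bool" where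
  "equivalent \<rho> \<rho>' \<longleftrightarrow>
     (\<exists>P :: complex^'n^'n. invertible P \<and> (\<forall>g\<in>carrier PSL2Z. \<rho>' g = P ** \<rho> g ** matrix_inv P))"

definition rep_equiv :: "('n::finite mrep \<times> 'n mrep) set" where
  "rep_equiv = {(\<rho>, \<rho>'). is_rep \<rho> \<and> is_rep \<rho>' \<and> equivalent \<rho> \<rho>'}"

definition invariant_subspace :: "'n::finite mrep \<Rightarrow> (complex^'n) set \<Rightarrow> bool" where
  "invariant_subspace \<rho> W \<longleftrightarrow>
     vec.subspace W \<and> (\<forall>g\<in>carrier PSL2Z. \<forall>w\<in>W. \<rho> g *v w \<in> W)"

definition reducible :: "'n::finite mrep \<Rightarrow> bool" where
  "reducible \<rho> \<longleftrightarrow> (\<exists>W. invariant_subspace \<rho> W \<and> W \<noteq> {0} \<and> W \<noteq> UNIV)"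

abbreviation irreducible_rep :: "'n::finite mrep \<Rightarrow> bool" where
  "irreducible_rep \<rho> \<equiv> \<not> reducible \<rho>"

definition decomposable :: "'n::finite mrep \<Rightarrow> bool" where
  "decomposable \<rho> \<longleftrightarrow>
     (\<exists>U V. invariant_subspace \<rho> U \<and> invariant_subspace \<rho> V \<and> U \<noteq> {0} \<and> V \<noteq> {0} \<and>
            U \<inter> V = {0} \<and> {u + v |u v. u \<in> U \<and> v \<in> V} = UNIV)"

abbreviation indecomposable :: "'n::finite mrep \<Rightarrow> bool" where
  "indecomposable \<rho> \<equiv> \<not> decomposable \<rho>"

text \<open>\<open>\<rho>0\<close> is, up to equivalence, a subrepresentation of \<open>\<rho>\<close>: the columns of the matrix
  \<open>J\<close> are a basis of an invariant subspace in which \<open>\<rho>\<close> acts through the matrices of \<open>\<rho>0\<close>.\<close>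

definition subrep :: "'m::finite mrep \<Rightarrow> 'n::finite mrep \<Rightarrow> bool" where
  "subrep \<rho>0 \<rho> \<longleftrightarrow>
     (\<exists>J :: complex^'m^'n. inj ((*v) J) \<and> (\<forall>g\<in>carrier PSL2Z. \<rho> g ** J = J ** \<rho>0 g))"

definition diag2 :: "complex \<Rightarrow> complex \<Rightarrow> complex^2^2" where
  "diag2 a b = vector [vector [a, 0], vector [0, b]]"

definition diag3 :: "complex \<Rightarrow> complex \<Rightarrow> complex \<Rightarrow> complex^3^3" where
  "diag3 a b c = vector [vector [a, 0, 0], vector [0, b, 0], vector [0, 0, c]]"

definition sum_of_two_characters :: "2 mrep \<Rightarrow> bool" where
  "sum_of_two_characters \<rho>0 \<longleftrightarrow>
     (\<exists>\<eta> \<theta>. is_character \<eta> \<and> is_character \<theta> \<and> equivalent \<rho>0 (\<lambda>g. diag2 (\<eta> g) (\<theta> g)))"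

definition diagonalizable :: "complex^'n^'n \<Rightarrow> bool" where
  "diagonalizable A \<longleftrightarrow>
     (\<exists>P D :: complex^'n^'n. invertible P \<and> (\<forall>i j. i \<noteq> j \<longrightarrow> D$i$j = 0) \<and> A = P ** D ** matrix_inv P)"

definition eigenvalues :: "complex^'n^'n \<Rightarrow> complex set" where
  "eigenvalues A = {l. \<exists>v. v \<noteq> 0 \<and> A *v v = l *s v}"

section \<open>The representations to be classified\<close>

definition ext_reps :: "(2 mrep \<Rightarrow> bool) \<Rightarrow> 3 mrep set" where
  "ext_reps Q = {\<rho>. is_rep \<rho> \<and> reducible \<rho> \<and> indecomposable \<rho> \<and> diagonalizable (\<rho> elt_T) \<and>
                    (\<exists>\<rho>0. is_rep \<rho>0 \<and> subrep \<rho>0 \<rho> \<and> Q \<rho>0)}"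

text \<open>The ratio does not depend on the order of the eigenvalues as far as the value \<open>-1\<close> is
  concerned. ``The two eigenvalues'' is read as: there are two, i.e. they are distinct.
  If \<open>\<rho>0\<close> is irreducible and \<open>\<rho>0(T)\<close> has a double eigenvalue, then \<open>\<rho>0(T)\<close>
  is not diagonalizable, and neither is \<open>\<rho>(T)\<close> for any \<open>\<rho>\<close> containing \<open>\<rho>0\<close>.\<close>

definition admissible_irreps :: "2 mrep set" where
  "admissible_irreps = {\<rho>0. is_rep \<rho>0 \<and> irreducible_rep \<rho>0 \<and>
     (\<exists>l1 l2. eigenvalues (\<rho>0 elt_T) = {l1, l2} \<and> l1 \<noteq> l2 \<and> l1 / l2 \<noteq> -1)}"

text \<open>Every pair \<open>(A, B)\<close> in \<open>D\<close> is \<open>(\<rho>(S), \<rho>(T))\<close> for some \<open>\<rho>\<close> in \<open>X\<close>, and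
  every member of \<open>X\<close> is equivalent to the representation given by exactly one
  pair in \<open>D\<close>.\<close>

definition represented_by :: "3 mrep set \<Rightarrow> ((complex^3^3) \<times> (complex^3^3)) set \<Rightarrow> bool" where
  "represented_by X D \<longleftrightarrow>
     (\<forall>(A, B)\<in>D. \<exists>\<rho>\<in>X. \<rho> elt_S = A \<and> \<rho> elt_T = B) \<and>
     (\<forall>\<rho>\<in>X. \<exists>!(A, B). (A, B) \<in> D \<and> (\<exists>\<rho>'\<in>X. \<rho>' elt_S = A \<and> \<rho>' elt_T = B \<and> equivalent \<rho> \<rho>'))"

definition e2pi :: "real \<Rightarrow> complex" where
  "e2pi r = exp (2 * of_real pi * \<i> * of_real r)"

definition ev :: "nat \<Rightarrow> complex" where
  "ev x = e2pi (real x / 6)"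

text \<open>Exponents \<open>(x1, x2, x3)\<close> are mapped to the pair \<open>(\<rho>(S), \<rho>(T))\<close>.\<close>

fun pair_i :: "nat \<times> nat \<times> nat \<Rightarrow> (complex^3^3) \<times> (complex^3^3)" where
  "pair_i (x1, x2, x3) = (let s = ev x3 ^ 3 in
     (vector [vector [-s, 0, 1], vector [0, -s, 1], vector [0, 0, s]],
      diag3 (ev x1) (ev x2) (ev x3)))"

fun pair_iia :: "nat \<times> nat \<times> nat \<Rightarrow> (complex^3^3) \<times> (complex^3^3)" where
  "pair_iia (x1, x2, x3) = (let s = ev x2 ^ 3 in
     (vector [vector [-s, 1, 1], vector [0, s, 0], vector [0, 0, s]],
      diag3 (ev x1) (ev x2) (ev x3)))"

fun pair_iib :: "nat \<times> nat \<times> nat \<Rightarrow> (complex^3^3) \<times> (complex^3^3)" where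
  "pair_iib (x1, x2, x3) = (let s = ev x1 ^ 3 in
     (vector [vector [s, -2 * s, 1], vector [0, -s, 1], vector [0, 0, s]],
      diag3 (ev x1) (ev x2) (ev x3)))"

end

theory Submission
  imports Defs
begin

text \<open>The modular group is presented by \<open>S\<^sup>2 = (ST)\<^sup>3 = 1\<close>, because a positive word in \<open>T\<close> and \<open>TST\<close>
  has nonnegative entries; so representations are pairs of matrices \<open>(A, B)\<close> with
  \<open>A\<^sup>2 = (AB)\<^sup>3 = 1\<close> up to simultaneous conjugation. As \<open>B\<close> is diagonalizable, an extension of the
  plane \<open>(A\<^sub>0, B\<^sub>0)\<close> by a character can be written \<open>A = (A\<^sub>0, v; 0, \<sigma>)\<close>, \<open>B = diag(B\<^sub>0, \<lambda>\<^sub>3)\<close>.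
  The relations force \<open>A\<^sub>0 v = - \<sigma> v\<close> and restrict the eigenvalues of \<open>B\<close>, and indecomposability
  says that enough entries are nonzero to rescale them to the normal form. For irreducible \<open>A\<^sub>0, B\<^sub>0\<close>
  the product \<open>A\<^sub>0 B\<^sub>0\<close> has two of the three cube roots of unity as eigenvalues; a nonsplit
  extension needs \<open>\<sigma> \<lambda>\<^sub>3\<close> to be the third one, which leaves only the sign \<open>\<sigma>\<close> free.\<close>

section \<open>Matrices given by their entries\<close>

text \<open>Since the group is a concrete quotient of integer matrices, the hard half of the
  presentation is the existence of a representation with prescribed \<open>A\<close> and
  \<open>B\<close>: its value must not depend on the word chosen. The sign pattern of the entries
  rules out nontrivial words for the identity. The off-diagonal entries of \<open>(AB)^3\<close>
  are, in the triangular case, products of entries of \<open>A\<close> and \<open>B\<close> with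
  divided differences of \<open>x^3\<close>. A nonzero entry of \<open>A\<close> therefore forces a
  quadratic relation between eigenvalues of \<open>B\<close>; with opposite signs at
  \<open>S\<close> it reads \<open>x^2 - x y + y^2 = 0\<close>, so the exponents differ by one
  modulo 6. Repeated eigenvalues must be excluded before normalising. Once they are distinct, every
  invariant subspace is spanned by axes, and indecomposability says that the nonzero entries of
  \<open>A\<close> connect all indices. The spectrum of \<open>B\<close> does not separate the
  classes: the exponent triples \<open>(1,5,0)\<close>, \<open>(0,5,1)\<close>,
  \<open>(5,0,1)\<close> and \<open>(1,0,5)\<close> all share it. What separates them inside each
  family is the eigenvalue of \<open>B\<close> on the one-dimensional subrepresentations and
  quotients.\<close>

definition mat2 :: "'a \<Rightarrow> 'a \<Rightarrow> 'a \<Rightarrow> 'a \<Rightarrow> 'a^2^2" where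
  "mat2 a b c d = (\<chi> i j. if i = 1 then (if j = 1 then a else b) else (if j = 1 then c else d))"

lemma mat2_nth [simp]:
  "mat2 a b c d $ 1 $ 1 = a" "mat2 a b c d $ 1 $ 2 = b"
  "mat2 a b c d $ 2 $ 1 = c" "mat2 a b c d $ 2 $ 2 = d"
  by (simp_all add: mat2_def)

lemma mat2_eq_iff:
  "M = N \<longleftrightarrow> M$1$1 = N$1$1 \<and> M$1$2 = N$1$2 \<and> M$2$1 = N$2$1 \<and> M$2$2 = N$2$2"
  for M N :: "'a^2^2"
  by (auto simp: vec_eq_iff forall_2)

lemma mat2_cases: obtains a b c d where "M = mat2 a b c d"
  by (metis mat2_eq_iff mat2_nth)

lemma mat2_mult [simp]:
  "mat2 a b c d ** mat2 a' b' c' d' =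
     mat2 (a*a' + b*c') (a*b' + b*d') (c*a' + d*c') (c*b' + d*d')"
  for a :: "'a::semiring_1"
  by (simp add: mat2_eq_iff matrix_matrix_mult_def sum_2)

lemma mat2_one: "(mat 1 :: 'a::semiring_1^2^2) = mat2 1 0 0 1"
  by (simp add: mat2_eq_iff mat_def)

lemma mat2_uminus [simp]: "- mat2 a b c d = mat2 (- a) (- b) (- c) (- d)" for a :: "'a::ring_1"
  by (simp add: mat2_eq_iff)

lemma det_mat2 [simp]: "det (mat2 a b c d) = a * d - b * c"
  by (simp add: det_2)

lemma vector_mat2: "vector [vector [a, b], vector [c, d]] = mat2 a b c d" for a :: "'a::zero"
  by (simp add: mat2_eq_iff)

lemma matrix_uminus_mult:
  fixes A :: "'a::ring_1^'n::finite^'m::finite" and B :: "'a^'k::finite^'n"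
  shows "(- A) ** B = - (A ** B)" and "A ** (- B) = - (A ** B)"
  by (simp_all add: vec_eq_iff matrix_matrix_mult_def sum_negf)

section \<open>The presentation of the modular group\<close>

abbreviation mS :: "int^2^2" where "mS \<equiv> mat2 0 (-1) 1 0"
abbreviation mT :: "int^2^2" where "mT \<equiv> mat2 1 1 0 1"

text \<open>No rule for inverses: \<open>(ST)^3 = -1\<close> in \<open>SL2Z\<close> makes
  \<open>T^-1\<close> a word in \<open>S\<close> and \<open>T\<close> up to sign, and
  \<open>S^-1 = -S\<close>.\<close>

inductive ST_closure :: "int^2^2 \<Rightarrow> bool" where
  one: "ST_closure (mat 1)"
| neg: "ST_closure M \<Longrightarrow> ST_closure (- M)"
| S: "ST_closure M \<Longrightarrow> ST_closure (mS ** M)"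
| T: "ST_closure M \<Longrightarrow> ST_closure (mT ** M)"

lemma ST_closure_T_power:
  "ST_closure (mat2 a b c d) \<Longrightarrow> ST_closure (mat2 (a + k * c) (b + k * d) c d)"
proof (induction k rule: int_induct[of _ 0])
  case (step1 i)
  then show ?case using ST_closure.T[of "mat2 (a + i * c) (b + i * d) c d"]
    by (simp add: distrib_right add.assoc add.left_commute)
next
  case (step2 i)
  let ?M = "mat2 (a + i * c) (b + i * d) c d"
  \<comment> \<open>Since \<open>(ST)^3 = -1\<close>, the prefix \<open>-STSTS\<close> is
    \<open>T^-1\<close>.\<close>
  have "- (mS ** (mT ** (mS ** (mT ** (mS ** ?M))))) = mat2 (a + (i-1) * c) (b + (i-1) * d) c d"
    by (simp add: algebra_simps)
  then show ?case using step2 by (metis ST_closure.intros)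
qed simp

text \<open>Euclid's algorithm on the first column: a power of \<open>T\<close> replaces
  \<open>a\<close> by its remainder modulo \<open>c\<close>, and \<open>S\<close> exchanges the rows
  up to sign, so that the absolute value of \<open>c\<close> drops until the matrix is a power of
  \<open>T\<close> up to sign.\<close>

lemma ST_closure_all: "a * d - b * c = 1 \<Longrightarrow> ST_closure (mat2 a b c d)"
proof (induction "nat \<bar>c\<bar>" arbitrary: a b c d rule: less_induct)
  case less
  show ?case
  proof (cases "c = 0")
    case True
    then have "a = 1 \<and> d = 1 \<or> a = -1 \<and> d = -1"
      using less.prems by (simp add: zmult_eq_1_iff)
    moreover have "ST_closure (mat2 1 x 0 1)" for x
      using ST_closure_T_power[of 1 0 0 1 x] ST_closure.one by (simp add: mat2_one)
    ultimately show ?thesis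
      using True ST_closure.neg[of "mat2 1 (- b) 0 1"] by auto
  next
    case False
    define k where "k = - (a div c)"
    have am: "a + k * c = a mod c" by (simp add: k_def minus_div_mult_eq_mod)
    have "ST_closure (mat2 (- c) (- d) (a + k * c) (b + k * d))"
    proof (rule less.hyps)
      show "nat \<bar>a + k * c\<bar> < nat \<bar>c\<bar>"
        using False abs_mod_less[of c a] by (simp add: am)
      show "- c * (b + k * d) - - d * (a + k * c) = 1"
        using less.prems by (simp add: algebra_simps)
    qed
    from ST_closure.neg[OF ST_closure.S[OF this]]
    have "ST_closure (mat2 (a + k * c) (b + k * d) c d)" by (simp add: add.commute)
    from ST_closure_T_power[OF this, of "-k"] show ?thesis by simp
  qed
qed

lemma ST_closure_iff: "ST_closure M \<longleftrightarrow> det M = 1"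
proof
  show "ST_closure M \<Longrightarrow> det M = 1"
    by (induction rule: ST_closure.induct) (auto simp: det_mul, simp add: det_2)
  show "det M = 1 \<Longrightarrow> ST_closure M"
    by (rule mat2_cases[of M]) (use ST_closure_all in auto)
qed

text \<open>The subgroup of \<open>SL2Z \<times> GL\<close> generated by \<open>(S, s)\<close>, \<open>(T, t)\<close> and \<open>(-1, 1)\<close>. It is the graph
  of a function on \<open>SL2Z\<close> as soon as \<open>s\<close> and \<open>t\<close> satisfy the relations.\<close>

inductive ST_graph :: "complex^'n^'n \<Rightarrow> complex^'n^'n \<Rightarrow> int^2^2 \<Rightarrow> complex^'n^'n \<Rightarrow> bool"
  for s t :: "complex^'n::finite^'n" where
  one: "ST_graph s t (mat 1) (mat 1)"
| neg: "ST_graph s t M g \<Longrightarrow> ST_graph s t (- M) g"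
| S: "ST_graph s t M g \<Longrightarrow> ST_graph s t (mS ** M) (s ** g)"
| T: "ST_graph s t M g \<Longrightarrow> ST_graph s t (mT ** M) (t ** g)"

lemma ST_graph_mult:
  "ST_graph s t M g \<Longrightarrow> ST_graph s t N h \<Longrightarrow> ST_graph s t (M ** N) (g ** h)"
  by (induction rule: ST_graph.induct)
     (auto simp: matrix_uminus_mult matrix_mul_assoc[symmetric] intro: ST_graph.intros)

lemma ST_graph_det: "ST_graph s t M g \<Longrightarrow> det M = 1"
  by (induction rule: ST_graph.induct) (auto simp: det_mul, simp add: det_2)

lemma ST_graph_total: "det M = 1 \<Longrightarrow> \<exists>g. ST_graph s t M g"
  unfolding ST_closure_iff[symmetric]
  by (induction rule: ST_closure.induct) (auto intro: ST_graph.intros)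

text \<open>Normal form: with \<open>U = ST\<close>, every element of the modular group is \<open>U\<^sup>a N\<close> with \<open>N\<close> a positive
  word in \<open>T\<close> and \<open>TST\<close>, possibly followed by \<open>S\<close>.\<close>

inductive positive_word :: "complex^'n^'n \<Rightarrow> complex^'n^'n \<Rightarrow> int^2^2 \<Rightarrow> complex^'n^'n \<Rightarrow> bool"
  for s t :: "complex^'n::finite^'n" where
  one: "positive_word s t (mat 1) (mat 1)"
| S: "positive_word s t mS s"
| T: "positive_word s t M g \<Longrightarrow> positive_word s t (mT ** M) (t ** g)"
| L: "positive_word s t M g \<Longrightarrow> positive_word s t (mT ** (mS ** (mT ** M))) (t ** (s ** (t ** g)))"

text \<open>The disjuncts are the exponents 0, 1, 2 of \<open>U\<close>. Only the integer matrix is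
  taken up to sign; the complex one is exact, since \<open>-1\<close> acts trivially.\<close>

definition normal_form :: "complex^'n^'n \<Rightarrow> complex^'n^'n \<Rightarrow> int^2^2 \<Rightarrow> complex^'n^'n \<Rightarrow> bool" where
  "normal_form s t M g \<longleftrightarrow> (\<exists>N h. positive_word s t N h \<and>
     ((M = N \<or> M = - N) \<and> g = h \<or>
      (M = mS ** (mT ** N) \<or> M = - (mS ** (mT ** N))) \<and> g = s ** (t ** h) \<or>
      (M = mS ** (mT ** (mS ** (mT ** N))) \<or> M = - (mS ** (mT ** (mS ** (mT ** N))))) \<and>
        g = s ** (t ** (s ** (t ** h)))))"

lemma int_relations:
  fixes M :: "int^2^2"
  shows
    "mS ** (mS ** M) = - M"
    "mT ** (mS ** (mT ** (mS ** (mT ** M)))) = mS ** M"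
proof -
  obtain a b c d where "M = mat2 a b c d" by (rule mat2_cases)
  then show "mS ** (mS ** M) = - M" "mT ** (mS ** (mT ** (mS ** (mT ** M)))) = mS ** M"
    by simp_all
qed

text \<open>The rewriting \<open>TSTST = S\<close> is the same as for integer matrices: there
  \<open>S^2\<close> and \<open>(ST)^3\<close> are both \<open>-1\<close>, here both are
  \<open>1\<close>, so only the rule for \<open>S^2\<close> changes its sign.\<close>

lemma matrix_relations:
  fixes s t g :: "complex^'n::finite^'n"
  assumes "s ** s = mat 1" "s ** t ** (s ** t) ** (s ** t) = mat 1"
  shows "s ** (s ** g) = g" "t ** (s ** (t ** (s ** (t ** g)))) = s ** g"
proof -
  show 1: "s ** (s ** g) = g" for g using assms(1) by (simp add: matrix_mul_assoc)
  have "s ** (t ** (s ** (t ** (s ** (t ** g))))) = g"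
    using assms(2) by (simp add: matrix_mul_assoc)
  then show "t ** (s ** (t ** (s ** (t ** g)))) = s ** g"
    using 1[of "t ** (s ** (t ** (s ** (t ** g))))"] by simp
qed

text \<open>Prefixing \<open>S\<close> to a word that starts with \<open>T\<close> or
  \<open>TST\<close> produces \<open>U\<close> or \<open>U^2\<close>; the words \<open>1\<close> and
  \<open>S\<close> become \<open>S\<close> and \<open>-1\<close>, again positive up to sign.\<close>

lemma positive_word_S:
  assumes "s ** s = mat 1" "s ** t ** (s ** t) ** (s ** t) = mat 1"
  shows "positive_word s t N h \<Longrightarrow> normal_form s t (mS ** N) (s ** h)"
proof (induction rule: positive_word.cases)
  case one
  then have "mS ** N = mS" "s ** h = s" by simp_all
  then show ?case unfolding normal_form_def using positive_word.S by blast
next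
  case S
  have "mS ** N = - mat 1" "s ** h = mat 1" using S assms(1) by (simp_all add: mat2_one)
  then show ?case unfolding normal_form_def using positive_word.one by blast
next
  case (T M g)
  then show ?case unfolding normal_form_def by (intro exI[of _ M] exI[of _ g]) simp
next
  case (L M g)
  then show ?case unfolding normal_form_def by (intro exI[of _ M] exI[of _ g]) simp
qed

lemma normal_form_neg: "normal_form s t M g \<Longrightarrow> normal_form s t (- M) g"
  unfolding normal_form_def by (elim exE, intro exI) auto

text \<open>For the exponents 1 and 2 the prefix cancels: up to sign \<open>SU = T\<close> and
  \<open>SU^2 = TST\<close>, and both prolong the positive word.\<close>

lemma normal_form_S:
  assumes st: "s ** s = mat 1" "s ** t ** (s ** t) ** (s ** t) = mat 1"
    and nf: "normal_form s t M g"
  shows "normal_form s t (mS ** M) (s ** g)"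
proof -
  note r = int_relations matrix_relations[OF st] matrix_uminus_mult
  obtain N h where N: "positive_word s t N h" and c:
     "(M = N \<or> M = - N) \<and> g = h \<or>
      (M = mS ** (mT ** N) \<or> M = - (mS ** (mT ** N))) \<and> g = s ** (t ** h) \<or>
      (M = mS ** (mT ** (mS ** (mT ** N))) \<or> M = - (mS ** (mT ** (mS ** (mT ** N))))) \<and>
        g = s ** (t ** (s ** (t ** h)))"
    using nf unfolding normal_form_def by blast
  from c consider "M = N \<or> M = - N" "g = h"
    | "M = mS ** (mT ** N) \<or> M = - (mS ** (mT ** N))" "g = s ** (t ** h)"
    | "M = mS ** (mT ** (mS ** (mT ** N))) \<or> M = - (mS ** (mT ** (mS ** (mT ** N))))"
      "g = s ** (t ** (s ** (t ** h)))" by blast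
  then show ?thesis
  proof cases
    case 1
    then show ?thesis using positive_word_S[OF st N] normal_form_neg[OF positive_word_S[OF st N]]
      by (auto simp: matrix_uminus_mult)
  next
    case 2
    then have "s ** g = t ** h" "mS ** M = mT ** N \<or> mS ** M = - (mT ** N)" by (auto simp: r)
    then show ?thesis unfolding normal_form_def using positive_word.T[OF N] by blast
  next
    case 3
    then have "s ** g = t ** (s ** (t ** h))"
      "mS ** M = mT ** (mS ** (mT ** N)) \<or> mS ** M = - (mT ** (mS ** (mT ** N)))" by (auto simp: r)
    then show ?thesis unfolding normal_form_def using positive_word.L[OF N] by blast
  qed
qed

text \<open>Here \<open>T\<close> and \<open>TU = TST\<close> prolong the positive word, while
  \<open>TU^2 = TSTST\<close> collapses to \<open>S\<close> and leads back to
  \<open>positive_word_S\<close>.\<close>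

lemma normal_form_T:
  assumes st: "s ** s = mat 1" "s ** t ** (s ** t) ** (s ** t) = mat 1"
    and nf: "normal_form s t M g"
  shows "normal_form s t (mT ** M) (t ** g)"
proof -
  note r = int_relations matrix_relations[OF st] matrix_uminus_mult
  obtain N h where N: "positive_word s t N h" and c:
     "(M = N \<or> M = - N) \<and> g = h \<or>
      (M = mS ** (mT ** N) \<or> M = - (mS ** (mT ** N))) \<and> g = s ** (t ** h) \<or>
      (M = mS ** (mT ** (mS ** (mT ** N))) \<or> M = - (mS ** (mT ** (mS ** (mT ** N))))) \<and>
        g = s ** (t ** (s ** (t ** h)))"
    using nf unfolding normal_form_def by blast
  from c consider "M = N \<or> M = - N" "g = h"
    | "M = mS ** (mT ** N) \<or> M = - (mS ** (mT ** N))" "g = s ** (t ** h)"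
    | "M = mS ** (mT ** (mS ** (mT ** N))) \<or> M = - (mS ** (mT ** (mS ** (mT ** N))))"
      "g = s ** (t ** (s ** (t ** h)))" by blast
  then show ?thesis
  proof cases
    case 1
    then have "t ** g = t ** h" "mT ** M = mT ** N \<or> mT ** M = - (mT ** N)" 
      by (auto simp: matrix_uminus_mult)
    then show ?thesis unfolding normal_form_def using positive_word.T[OF N] by blast
  next
    case 2
    then have "t ** g = t ** (s ** (t ** h))"
      "mT ** M = mT ** (mS ** (mT ** N)) \<or> mT ** M = - (mT ** (mS ** (mT ** N)))"
      by (auto simp: matrix_uminus_mult)
    then show ?thesis unfolding normal_form_def using positive_word.L[OF N] by blast
  next
    case 3
    then have "t ** g = s ** h" "mT ** M = mS ** N \<or> mT ** M = - (mS ** N)" by (auto simp: r)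
    then show ?thesis using positive_word_S[OF st N] normal_form_neg[OF positive_word_S[OF st N]]
      by auto
  qed
qed

lemma ST_graph_normal_form:
  assumes st: "s ** s = mat 1" "s ** t ** (s ** t) ** (s ** t) = mat 1"
  shows "ST_graph s t M g \<Longrightarrow> normal_form s t M g"
proof (induction rule: ST_graph.induct)
  case one
  show ?case unfolding normal_form_def using positive_word.one by blast
next
  case neg
  then show ?case by (simp add: normal_form_neg)
next
  case S
  then show ?case by (simp add: normal_form_S[OF st])
next
  case T
  then show ?case by (simp add: normal_form_T[OF st])
qed

text \<open>\<open>T\<close> and \<open>TST\<close> are the two elementary matrices that add one row
  to the other, so the signs within each column persist. A final \<open>S\<close> turns the columns
  \<open>(x, y)\<close> into \<open>(y, -x)\<close>, which is the alternative with a nonpositive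
  second column. The identity has entry sum 2, so the bound 3 records that at least one row addition
  took place.\<close>

lemma positive_word_signs:
  "positive_word s t N h \<Longrightarrow> N = mat2 a b c d \<Longrightarrow> a * d - b * c = 1 \<and> a \<ge> 0 \<and> c \<ge> 0 \<and>
     (b \<ge> 0 \<and> d \<ge> 0 \<and> (h = mat 1 \<or> a + b + c + d \<ge> 3) \<or> b \<le> 0 \<and> d \<le> 0)"
proof (induction arbitrary: a b c d rule: positive_word.induct)
  case (T M g)
  obtain a' b' c' d' where M: "M = mat2 a' b' c' d'" by (rule mat2_cases)
  have e: "a = a' + c'" "b = b' + d'" "c = c'" "d = d'"
    using T.prems by (auto simp: M mat2_eq_iff)
  note IH = T.IH[OF M]
  have "a * d - b * c = 1" using IH by (simp add: e algebra_simps)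
  moreover have "a' \<noteq> 0 \<or> b' \<noteq> 0" "c' \<noteq> 0 \<or> d' \<noteq> 0" using IH by auto
  then have "a \<ge> 0 \<and> c \<ge> 0 \<and>
     (b \<ge> 0 \<and> d \<ge> 0 \<and> a + b + c + d \<ge> 3 \<or> b \<le> 0 \<and> d \<le> 0)"
    using IH unfolding e by (smt (verit))
  ultimately show ?case by blast
next
  case (L M g)
  obtain a' b' c' d' where M: "M = mat2 a' b' c' d'" by (rule mat2_cases)
  have e: "a = a'" "b = b'" "c = a' + c'" "d = b' + d'"
    using L.prems by (auto simp: M mat2_eq_iff)
  note IH = L.IH[OF M]
  have "a * d - b * c = 1" using IH by (simp add: e algebra_simps)
  moreover have "a' \<noteq> 0 \<or> b' \<noteq> 0" "c' \<noteq> 0 \<or> d' \<noteq> 0" using IH by auto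
  then have "a \<ge> 0 \<and> c \<ge> 0 \<and>
     (b \<ge> 0 \<and> d \<ge> 0 \<and> a + b + c + d \<ge> 3 \<or> b \<le> 0 \<and> d \<le> 0)"
    using IH unfolding e by (smt (verit))
  ultimately show ?case by blast
qed (auto simp: mat2_one mat2_eq_iff)

text \<open>If \<open>U N\<close> or \<open>U^2 N\<close> were the identity up to sign,
  \<open>N\<close> would be the inverse of \<open>U\<close> or \<open>U^2\<close> up to sign; each
  of these has a column with entries of opposite signs. So \<open>N\<close> itself is the identity
  up to sign, and its entry sum leaves only the value \<open>mat 1\<close>.\<close>

lemma ST_graph_one:
  assumes st: "s ** s = mat 1" "s ** t ** (s ** t) ** (s ** t) = mat 1"
    and "ST_graph s t (mat 1) g"
  shows "g = mat 1"
proof -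
  obtain N h where N: "positive_word s t N h" and c:
     "(mat 1 = N \<or> mat 1 = - N) \<and> g = h \<or>
      mat 1 = mS ** (mT ** N) \<or> mat 1 = - (mS ** (mT ** N)) \<or>
      mat 1 = mS ** (mT ** (mS ** (mT ** N))) \<or> mat 1 = - (mS ** (mT ** (mS ** (mT ** N))))"
    using ST_graph_normal_form[OF assms] unfolding normal_form_def by blast
  obtain a b c d where M: "N = mat2 a b c d" by (rule mat2_cases)
  note p = positive_word_signs[OF N M]
  have nz: "a \<noteq> 0 \<or> b \<noteq> 0" "c \<noteq> 0 \<or> d \<noteq> 0" "a \<noteq> 0 \<or> c \<noteq> 0" "b \<noteq> 0 \<or> d \<noteq> 0" using p by auto
  from c show ?thesis
    unfolding M mat2_one mat2_mult mat2_uminus mat2_eq_iff mat2_nth using p nz by (smt (verit))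
qed

text \<open>The graph is closed under products, so a value over the inverse matrix is inverse to
  both \<open>g\<close> and \<open>g'\<close>; this reduces the claim to the fibre over the
  identity.\<close>

lemma ST_graph_unique:
  assumes st: "s ** s = mat 1" "s ** t ** (s ** t) ** (s ** t) = mat 1"
    and g: "ST_graph s t M g" and g': "ST_graph s t M g'"
  shows "g = g'"
proof -
  obtain a b c d where M: "M = mat2 a b c d" by (rule mat2_cases)
  define N where "N = mat2 d (- b) (- c) a"
  have d: "a * d - b * c = 1" using ST_graph_det[OF g] by (simp add: M)
  have NM: "N ** M = mat 1" "M ** N = mat 1" "det N = 1"
    using d by (simp_all add: M N_def mat2_one mat2_eq_iff algebra_simps)
  obtain h where h: "ST_graph s t N h" using ST_graph_total[OF NM(3)] by blast
  have "g ** h = mat 1" "h ** g' = mat 1"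
    using ST_graph_mult[OF g h] ST_graph_mult[OF h g'] NM by (auto intro: ST_graph_one[OF st])
  then show ?thesis by (metis matrix_mul_assoc matrix_mul_lid matrix_mul_rid)
qed

section \<open>Representations as pairs of matrices\<close>

lemma proj_eq: "proj M = {M, - M}"
  unfolding proj_def r_coset_def by (simp add: SL2Z_def matrix_uminus_mult insert_commute)

lemma carrier_PSL2Z: "carrier PSL2Z = proj ` {M. det M = 1}"
  unfolding PSL2Z_def FactGroup_def RCOSETS_def by (auto simp: SL2Z_def proj_def)

lemma proj_mult:
  assumes "det M = 1" "det N = 1"
  shows "proj M \<otimes>\<^bsub>PSL2Z\<^esub> proj N = proj (M ** N)"
  using normal.rcos_sum[OF normal_center_SL2Z, of M N] assms
  unfolding PSL2Z_def FactGroup_def proj_def by (simp add: SL2Z_def)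

lemma one_PSL2Z: "\<one>\<^bsub>PSL2Z\<^esub> = proj (mat 1)"
  unfolding PSL2Z_def FactGroup_def proj_eq by simp

lemma elt_S_eq: "elt_S = proj mS" and elt_T_eq: "elt_T = proj mT"
  unfolding elt_S_def elt_T_def vector_mat2 by simp_all

lemma elt_ST_carrier: "elt_S \<in> carrier PSL2Z" "elt_T \<in> carrier PSL2Z"
  unfolding elt_S_eq elt_T_eq carrier_PSL2Z by (auto intro!: imageI)

text \<open>Left multiplication by the two generators reaches the whole group, because
  \<open>T^-1\<close> is itself a word in them.\<close>

lemma PSL2Z_induct [consumes 1, case_names one S T]:
  assumes "g \<in> carrier PSL2Z" "Q \<one>\<^bsub>PSL2Z\<^esub>"
    and "\<And>g. g \<in> carrier PSL2Z \<Longrightarrow> Q g \<Longrightarrow> Q (elt_S \<otimes>\<^bsub>PSL2Z\<^esub> g)"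
    and "\<And>g. g \<in> carrier PSL2Z \<Longrightarrow> Q g \<Longrightarrow> Q (elt_T \<otimes>\<^bsub>PSL2Z\<^esub> g)"
  shows "Q g"
proof -
  have "ST_closure M \<Longrightarrow> Q (proj M)" for M
  proof (induction rule: ST_closure.induct)
    case one
    then show ?case using assms(2) by (simp add: one_PSL2Z)
  next
    case (neg M)
    then show ?case by (simp add: proj_eq insert_commute)
  next
    case (S M)
    then show ?case using assms(3)[of "proj M"] proj_mult[of mS M]
      by (auto simp: ST_closure_iff carrier_PSL2Z elt_S_eq)
  next
    case (T M)
    then show ?case using assms(4)[of "proj M"] proj_mult[of mT M]
      by (auto simp: ST_closure_iff carrier_PSL2Z elt_T_eq)
  qed
  then show ?thesis using assms(1) by (auto simp: carrier_PSL2Z ST_closure_iff)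
qed

lemma rep_mult:
  "is_rep \<rho> \<Longrightarrow> g \<in> carrier PSL2Z \<Longrightarrow> h \<in> carrier PSL2Z \<Longrightarrow> \<rho> (g \<otimes>\<^bsub>PSL2Z\<^esub> h) = \<rho> g ** \<rho> h"
  unfolding is_rep_def hom_def GL_def by auto

lemma rep_invertible: "is_rep \<rho> \<Longrightarrow> g \<in> carrier PSL2Z \<Longrightarrow> invertible (\<rho> g)"
  unfolding is_rep_def hom_def GL_def by auto

text \<open>\<open>hom\<close> only asks for multiplicativity; an invertible idempotent is the
  identity.\<close>

lemma rep_one:
  assumes "is_rep \<rho>"
  shows "\<rho> \<one>\<^bsub>PSL2Z\<^esub> = mat 1"
proof -
  interpret group PSL2Z by (rule group_PSL2Z)
  have "\<rho> \<one>\<^bsub>PSL2Z\<^esub> ** \<rho> \<one>\<^bsub>PSL2Z\<^esub> = \<rho> \<one>\<^bsub>PSL2Z\<^esub>"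
    using rep_mult[OF assms one_closed one_closed] by simp
  moreover obtain B where "B ** \<rho> \<one>\<^bsub>PSL2Z\<^esub> = mat 1"
    using rep_invertible[OF assms one_closed] unfolding invertible_def by blast
  ultimately show ?thesis by (metis matrix_mul_assoc matrix_mul_lid)
qed

section \<open>Pairs of matrices satisfying the defining relations\<close>

definition modular_pair :: "complex^'n::finite^'n \<Rightarrow> complex^'n^'n \<Rightarrow> bool" where
  "modular_pair A B \<longleftrightarrow> A ** A = mat 1 \<and> A ** B ** (A ** B) ** (A ** B) = mat 1"

lemma rep_modular_pair:
  assumes "is_rep \<rho>"
  shows "modular_pair (\<rho> elt_S) (\<rho> elt_T)"
proof -
  interpret group PSL2Z by (rule group_PSL2Z)
  note c = elt_ST_carrier
  have "proj (mS ** mS) = \<one>\<^bsub>PSL2Z\<^esub>"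
    "proj (mS ** mT ** (mS ** mT) ** (mS ** mT)) = \<one>\<^bsub>PSL2Z\<^esub>"
    by (simp_all add: one_PSL2Z proj_eq mat2_one insert_commute)
  then have "elt_S \<otimes>\<^bsub>PSL2Z\<^esub> elt_S = \<one>\<^bsub>PSL2Z\<^esub>"
    "elt_S \<otimes>\<^bsub>PSL2Z\<^esub> elt_T \<otimes>\<^bsub>PSL2Z\<^esub> (elt_S \<otimes>\<^bsub>PSL2Z\<^esub> elt_T) \<otimes>\<^bsub>PSL2Z\<^esub> (elt_S \<otimes>\<^bsub>PSL2Z\<^esub> elt_T) = \<one>\<^bsub>PSL2Z\<^esub>"
    by (simp_all add: elt_S_eq elt_T_eq proj_mult)
  then have "\<rho> (elt_S \<otimes>\<^bsub>PSL2Z\<^esub> elt_S) = mat 1"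
    "\<rho> (elt_S \<otimes>\<^bsub>PSL2Z\<^esub> elt_T \<otimes>\<^bsub>PSL2Z\<^esub> (elt_S \<otimes>\<^bsub>PSL2Z\<^esub> elt_T) \<otimes>\<^bsub>PSL2Z\<^esub> (elt_S \<otimes>\<^bsub>PSL2Z\<^esub> elt_T)) = mat 1"
    using rep_one[OF assms] by metis+
  then show ?thesis unfolding modular_pair_def using c by (simp add: rep_mult[OF assms])
qed

text \<open>The presentation in the form in which it is used. \<open>ST_graph A B\<close> is stable
  under negation of the integer matrix, so it descends to cosets, and its uniqueness makes the
  description \<open>THE x\<close> meaningful.\<close>

lemma modular_pair_rep:
  assumes "modular_pair A B"
  shows "\<exists>\<rho>. is_rep \<rho> \<and> \<rho> elt_S = A \<and> \<rho> elt_T = B"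
proof -
  note r = assms[unfolded modular_pair_def]
  define \<rho> where "\<rho> = (\<lambda>g. THE x. \<exists>M\<in>g. ST_graph A B M x)"
  have \<rho>: "\<rho> (proj M) = x" if x: "ST_graph A B M x" for M x
    unfolding \<rho>_def
  proof (rule the_equality)
    show "\<exists>M\<in>proj M. ST_graph A B M x" using x by (auto simp: proj_eq)
    fix y assume "\<exists>M\<in>proj M. ST_graph A B M y"
    then have "ST_graph A B M y \<or> ST_graph A B (- M) y" by (auto simp: proj_eq)
    then have "ST_graph A B M y" using ST_graph.neg[of A B "- M" y] by auto
    then show "y = x" using ST_graph_unique[of A B M x y] r x by auto
  qed
  have m: "\<rho> (g \<otimes>\<^bsub>PSL2Z\<^esub> h) = \<rho> g ** \<rho> h" if gh: "g \<in> carrier PSL2Z" "h \<in> carrier PSL2Z" for g h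
  proof -
    obtain M N where MN: "g = proj M" "h = proj N" "det M = 1" "det N = 1"
      using gh by (auto simp: carrier_PSL2Z)
    obtain x y where "ST_graph A B M x" "ST_graph A B N y"
      using MN ST_graph_total by metis
    then show ?thesis using ST_graph_mult[of A B M x N y] by (simp add: MN proj_mult \<rho>)
  qed
  have i: "invertible (\<rho> g)" if "g \<in> carrier PSL2Z" for g
  proof -
    interpret group PSL2Z by (rule group_PSL2Z)
    have "\<rho> \<one>\<^bsub>PSL2Z\<^esub> = mat 1" unfolding one_PSL2Z by (rule \<rho>[OF ST_graph.one])
    then have "\<rho> g ** \<rho> (inv\<^bsub>PSL2Z\<^esub> g) = mat 1" "\<rho> (inv\<^bsub>PSL2Z\<^esub> g) ** \<rho> g = mat 1"
      using that by (simp_all flip: m)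
    then show ?thesis unfolding invertible_def by blast
  qed
  have "is_rep \<rho>" using m i unfolding is_rep_def hom_def GL_def by auto
  moreover have "\<rho> elt_S = A" "\<rho> elt_T = B"
    using \<rho>[OF ST_graph.S[OF ST_graph.one[of A B]]] \<rho>[OF ST_graph.T[OF ST_graph.one[of A B]]]
    by (simp_all add: elt_S_eq elt_T_eq)
  ultimately show ?thesis by blast
qed

lemma invertible_matrix_inv:
  assumes "invertible P"
  shows "P ** matrix_inv P = mat 1" "matrix_inv P ** P = mat 1"
proof -
  have "P ** matrix_inv P = mat 1 \<and> matrix_inv P ** P = mat 1"
    using assms unfolding invertible_def matrix_inv_def by (rule someI_ex)
  then show "P ** matrix_inv P = mat 1" "matrix_inv P ** P = mat 1" by auto
qed

lemma conj_matrix_iff: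
  assumes "invertible P"
  shows "A' = P ** A ** matrix_inv P \<longleftrightarrow> P ** A = A' ** P"
proof
  show "P ** A = A' ** P" if "A' = P ** A ** matrix_inv P"
    using invertible_matrix_inv[OF assms] unfolding that by (simp flip: matrix_mul_assoc)
  show "A' = P ** A ** matrix_inv P" if "P ** A = A' ** P"
    using invertible_matrix_inv[OF assms] unfolding that by (simp flip: matrix_mul_assoc)
qed

text \<open>Intertwining can be tested on the generators. \<open>J\<close> may be rectangular, so
  that the lemma serves both equivalences and inclusions of a plane.\<close>

lemma rep_intertwine:
  fixes J :: "complex^'m::finite^'n::finite"
  assumes r: "is_rep \<rho>" "is_rep \<rho>0"
    and S: "\<rho> elt_S ** J = J ** \<rho>0 elt_S" and T: "\<rho> elt_T ** J = J ** \<rho>0 elt_T"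
  shows "g \<in> carrier PSL2Z \<Longrightarrow> \<rho> g ** J = J ** \<rho>0 g"
proof (induction rule: PSL2Z_induct)
  case one
  then show ?case using r by (simp add: rep_one)
next
  case (S g)
  have "\<rho> elt_S ** (\<rho> g ** J) = J ** (\<rho>0 elt_S ** \<rho>0 g)"
    by (simp only: S(2) matrix_mul_assoc assms(3))
  then show ?case using S(1) r elt_ST_carrier by (simp add: rep_mult flip: matrix_mul_assoc)
next
  case (T g)
  have "\<rho> elt_T ** (\<rho> g ** J) = J ** (\<rho>0 elt_T ** \<rho>0 g)"
    by (simp only: T(2) matrix_mul_assoc assms(4))
  then show ?case using T(1) r elt_ST_carrier by (simp add: rep_mult flip: matrix_mul_assoc)
qed

text \<open>Stated with \<open>P ** A = A' ** P\<close> instead of an inverse, so that proofs by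
  explicit base change compare two products.\<close>

definition simconj ::
  "complex^'n::finite^'n \<Rightarrow> complex^'n^'n \<Rightarrow> complex^'n^'n \<Rightarrow> complex^'n^'n \<Rightarrow> bool" where
  "simconj A B A' B' \<longleftrightarrow> (\<exists>P. invertible P \<and> P ** A = A' ** P \<and> P ** B = B' ** P)"

lemma equivalent_iff_simconj:
  assumes "is_rep \<rho>" "is_rep \<rho>'"
  shows "equivalent \<rho> \<rho>' \<longleftrightarrow> simconj (\<rho> elt_S) (\<rho> elt_T) (\<rho>' elt_S) (\<rho>' elt_T)"
proof
  show "simconj (\<rho> elt_S) (\<rho> elt_T) (\<rho>' elt_S) (\<rho>' elt_T)" if "equivalent \<rho> \<rho>'"
    using that elt_ST_carrier unfolding equivalent_def simconj_def by (metis conj_matrix_iff)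
next
  assume "simconj (\<rho> elt_S) (\<rho> elt_T) (\<rho>' elt_S) (\<rho>' elt_T)"
  then obtain P where P: "invertible P" "\<rho>' elt_S ** P = P ** \<rho> elt_S"
    "\<rho>' elt_T ** P = P ** \<rho> elt_T" unfolding simconj_def by metis
  have "\<rho>' g ** P = P ** \<rho> g" if "g \<in> carrier PSL2Z" for g
    by (rule rep_intertwine[OF assms(2,1) P(2,3) that])
  then show "equivalent \<rho> \<rho>'" unfolding equivalent_def using P(1) conj_matrix_iff by metis
qed

lemma simconj_refl: "simconj A B A B"
  unfolding simconj_def by (intro exI[of _ "mat 1"]) (auto simp: invertible_def)

lemma simconj_sym: "simconj A B A' B' \<Longrightarrow> simconj A' B' A B"
proof -
  assume "simconj A B A' B'"
  then obtain P where P: "invertible P" "P ** A = A' ** P" "P ** B = B' ** P"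
    unfolding simconj_def by blast
  note i = invertible_matrix_inv[OF P(1)]
  have "invertible (matrix_inv P)" unfolding invertible_def using i by blast
  moreover have "matrix_inv P ** M' = M ** matrix_inv P" if "P ** M = M' ** P" for M M'
  proof -
    have "matrix_inv P ** M' = matrix_inv P ** (M' ** P) ** matrix_inv P"
      using i by (simp flip: matrix_mul_assoc)
    also have "\<dots> = M ** matrix_inv P" unfolding that[symmetric] using i by (simp add: matrix_mul_assoc)
    finally show ?thesis .
  qed
  ultimately show ?thesis unfolding simconj_def using P by metis
qed

lemma simconj_trans: "simconj A B A' B' \<Longrightarrow> simconj A' B' A'' B'' \<Longrightarrow> simconj A B A'' B''"
proof -
  assume "simconj A B A' B'" "simconj A' B' A'' B''"
  then obtain P Q where P: "invertible P" "P ** A = A' ** P" "P ** B = B' ** P"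
    and Q: "invertible Q" "Q ** A' = A'' ** Q" "Q ** B' = B'' ** Q"
    unfolding simconj_def by blast
  have "(Q ** P) ** M = M'' ** (Q ** P)" if "P ** M = M' ** P" "Q ** M' = M'' ** Q" for M M' M''
    by (metis matrix_mul_assoc that)
  then show ?thesis unfolding simconj_def using P Q invertible_mult by metis
qed

lemma modular_pair_simconj:
  assumes "modular_pair A B" "simconj A B A' B'"
  shows "modular_pair A' B'"
proof -
  obtain P where P: "invertible P" "A' = P ** A ** matrix_inv P" "B' = P ** B ** matrix_inv P"
    using assms(2) unfolding simconj_def by (metis conj_matrix_iff)
  note i = invertible_matrix_inv[OF P(1)]
  have m: "P ** X ** matrix_inv P ** (P ** Y ** matrix_inv P) = P ** (X ** Y) ** matrix_inv P" for X Y
  proof -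
    have "P ** X ** matrix_inv P ** (P ** Y ** matrix_inv P) =
      P ** X ** (matrix_inv P ** P) ** Y ** matrix_inv P" by (simp only: matrix_mul_assoc)
    then show ?thesis using i by (simp add: matrix_mul_assoc)
  qed
  show ?thesis using assms(1) i unfolding modular_pair_def P m by simp
qed

section \<open>Invariant subspaces and decompositions of pairs\<close>

definition invariant_pair :: "complex^'n::finite^'n \<Rightarrow> complex^'n^'n \<Rightarrow> (complex^'n) set \<Rightarrow> bool" where
  "invariant_pair A B W \<longleftrightarrow> vec.subspace W \<and> (\<forall>w\<in>W. A *v w \<in> W \<and> B *v w \<in> W)"

lemma invariant_subspace_iff_pair:
  assumes r: "is_rep \<rho>"
  shows "invariant_subspace \<rho> W \<longleftrightarrow> invariant_pair (\<rho> elt_S) (\<rho> elt_T) W"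
proof
  show "invariant_pair (\<rho> elt_S) (\<rho> elt_T) W" if "invariant_subspace \<rho> W"
    using that elt_ST_carrier unfolding invariant_subspace_def invariant_pair_def by auto
next
  assume W: "invariant_pair (\<rho> elt_S) (\<rho> elt_T) W"
  have "\<forall>w\<in>W. \<rho> g *v w \<in> W" if "g \<in> carrier PSL2Z" for g
    using that
  proof (induction rule: PSL2Z_induct)
    case one
    then show ?case by (simp add: rep_one[OF r])
  qed (use W elt_ST_carrier in \<open>auto simp: invariant_pair_def rep_mult[OF r] simp flip: matrix_vector_mul_assoc\<close>)
  then show "invariant_subspace \<rho> W"
    using W unfolding invariant_subspace_def invariant_pair_def by blast
qed

definition decomposable_pair :: "complex^'n::finite^'n \<Rightarrow> complex^'n^'n \<Rightarrow> bool" where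
  "decomposable_pair A B \<longleftrightarrow>
     (\<exists>U V. invariant_pair A B U \<and> invariant_pair A B V \<and> U \<noteq> {0} \<and> V \<noteq> {0} \<and>
            U \<inter> V = {0} \<and> {u + v |u v. u \<in> U \<and> v \<in> V} = UNIV)"

definition reducible_pair :: "complex^'n::finite^'n \<Rightarrow> complex^'n^'n \<Rightarrow> bool" where
  "reducible_pair A B \<longleftrightarrow> (\<exists>W. invariant_pair A B W \<and> W \<noteq> {0} \<and> W \<noteq> UNIV)"

lemma decomposable_iff_pair: "is_rep \<rho> \<Longrightarrow> decomposable \<rho> \<longleftrightarrow> decomposable_pair (\<rho> elt_S) (\<rho> elt_T)"
  unfolding decomposable_def decomposable_pair_def by (simp add: invariant_subspace_iff_pair)

lemma reducible_iff_pair: "is_rep \<rho> \<Longrightarrow> reducible \<rho> \<longleftrightarrow> reducible_pair (\<rho> elt_S) (\<rho> elt_T)"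
  unfolding reducible_def reducible_pair_def by (simp add: invariant_subspace_iff_pair)

lemma invariant_pair_image:
  assumes P: "P ** A = A' ** P" "P ** B = B' ** P" and W: "invariant_pair A B W"
  shows "invariant_pair A' B' ((*v) P ` W)"
proof -
  have "vec.subspace ((*v) P ` W)"
    using W unfolding invariant_pair_def
    by (intro vec.subspace_image) auto
  moreover have "A' *v (P *v w) = P *v (A *v w)" "B' *v (P *v w) = P *v (B *v w)" for w
    using P by (metis matrix_vector_mul_assoc)+
  ultimately show ?thesis using W unfolding invariant_pair_def by auto
qed

lemma decomposable_pair_simconj:
  assumes "decomposable_pair A B" "simconj A B A' B'"
  shows "decomposable_pair A' B'"
proof -
  obtain U V where UV: "invariant_pair A B U" "invariant_pair A B V" "U \<noteq> {0}" "V \<noteq> {0}"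
    "U \<inter> V = {0}" "{u + v |u v. u \<in> U \<and> v \<in> V} = UNIV"
    using assms(1) unfolding decomposable_pair_def by blast
  obtain P where P: "invertible P" "P ** A = A' ** P" "P ** B = B' ** P"
    using assms(2) unfolding simconj_def by blast
  note i = invertible_matrix_inv[OF P(1)]
  have inj: "x = y" if "P *v x = P *v y" for x y
    using that i by (metis matrix_vector_mul_assoc matrix_vector_mul_lid)
  have surj: "\<exists>x. P *v x = y" for y
    using i by (metis matrix_vector_mul_assoc matrix_vector_mul_lid)
  let ?U = "(*v) P ` U" and ?V = "(*v) P ` V"
  have nz: "(*v) P ` W \<noteq> {0}" if W: "W \<noteq> {0}" "invariant_pair A B W" for W
  proof -
    have "0 \<in> W" using W vec.subspace_0 unfolding invariant_pair_def by blast
    then obtain w where "w \<in> W" "w \<noteq> 0" using W by blast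
    then show ?thesis using inj[of w 0] by auto
  qed
  have "?U \<inter> ?V = {0}"
  proof -
    have "0 \<in> U" "0 \<in> V" using UV(5) by auto
    then have "0 \<in> ?U \<inter> ?V" by (auto intro!: image_eqI[of _ _ 0])
    moreover have "x = 0" if "x \<in> ?U \<inter> ?V" for x
    proof -
      obtain u v where "u \<in> U" "v \<in> V" "x = P *v u" "x = P *v v" using \<open>x \<in> ?U \<inter> ?V\<close> by blast
      then have "u = 0" using inj[of u v] UV(5) by auto
      then show ?thesis using \<open>x = P *v u\<close> by simp
    qed
    ultimately show ?thesis by blast
  qed
  moreover have "{u + v |u v. u \<in> ?U \<and> v \<in> ?V} = UNIV"
  proof -
    have "y \<in> {u + v |u v. u \<in> ?U \<and> v \<in> ?V}" for y
    proof -
      obtain x where x: "P *v x = y" using surj by blast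
      obtain u v where "x = u + v" "u \<in> U" "v \<in> V" using UV(6) by blast
      then show ?thesis using x by (auto simp: matrix_vector_right_distrib)
    qed
    then show ?thesis by blast
  qed
  ultimately show ?thesis
    unfolding decomposable_pair_def using UV
    by (intro exI[of _ ?U] exI[of _ ?V] conjI nz invariant_pair_image[OF P(2,3)]) simp_all
qed

text \<open>The \<open>i\<close>-th axis and the hyperplane \<open>x$i = 0\<close> are complementary
  invariant subspaces; a second index keeps the hyperplane nonzero.\<close>

lemma decomposable_pair_index:
  fixes A B :: "complex^'n::finite^'n"
  assumes ij: "\<And>j. j \<noteq> i \<Longrightarrow> A$i$j = 0 \<and> A$j$i = 0 \<and> B$i$j = 0 \<and> B$j$i = 0" and "\<exists>j. j \<noteq> i"
  shows "decomposable_pair A B"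
proof -
  let ?U = "{x :: complex^'n. \<forall>j. j \<noteq> i \<longrightarrow> x$j = 0}" and ?V = "{x :: complex^'n. x$i = 0}"
  have 1: "(M *v u) $ j = 0"
    if "\<forall>j. j \<noteq> i \<longrightarrow> u$j = 0" "j \<noteq> i" "\<And>j. j \<noteq> i \<Longrightarrow> M$j$i = 0"
    for M :: "complex^'n^'n" and u j
    unfolding matrix_vector_mult_def vec_lambda_beta
    by (rule sum.neutral) (use that in fastforce)
  have 2: "(M *v u) $ i = 0" if "u $ i = 0" "\<And>j. j \<noteq> i \<Longrightarrow> M$i$j = 0"
    for M :: "complex^'n^'n" and u
    unfolding matrix_vector_mult_def vec_lambda_beta
    by (rule sum.neutral) (use that in fastforce)
  have "invariant_pair A B ?U" "invariant_pair A B ?V"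
    using 1 2 ij unfolding invariant_pair_def vec.subspace_def by simp_all
  moreover have "axis i 1 \<in> ?U" "axis i (1::complex) \<noteq> 0" by (auto simp: axis_def vec_eq_iff)
  then have "?U \<noteq> {0}" by blast
  moreover obtain k where "k \<noteq> i" using assms(2) by blast
  then have "axis k 1 \<in> ?V" "axis k (1::complex) \<noteq> 0" by (auto simp: axis_def vec_eq_iff)
  then have "?V \<noteq> {0}" by blast
  moreover have "?U \<inter> ?V = {0}"
    by (intro equalityI subsetI) (simp_all add: vec_eq_iff, metis)
  moreover have "\<exists>u v. x = u + v \<and> u \<in> ?U \<and> v \<in> ?V" for x
    by (intro exI[of _ "axis i (x$i)"] exI[of _ "x - axis i (x$i)"]) (simp add: axis_def)
  then have "{u + v |u v. u \<in> ?U \<and> v \<in> ?V} = UNIV" by blast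
  ultimately show ?thesis unfolding decomposable_pair_def by (intro exI[of _ ?U] exI[of _ ?V]) simp
qed

section \<open>Matrices of size three in block form\<close>

definition mat3 :: "'a::zero \<Rightarrow> 'a \<Rightarrow> 'a \<Rightarrow> 'a \<Rightarrow> 'a \<Rightarrow> 'a \<Rightarrow> 'a \<Rightarrow> 'a \<Rightarrow> 'a \<Rightarrow> 'a^3^3" where
  "mat3 a b c d e f g h i = vector [vector [a, b, c], vector [d, e, f], vector [g, h, i]]"

lemma mat3_nth [simp]:
  "mat3 a b c d e f g h i $ 1 $ 1 = a" "mat3 a b c d e f g h i $ 1 $ 2 = b"
  "mat3 a b c d e f g h i $ 1 $ 3 = c" "mat3 a b c d e f g h i $ 2 $ 1 = d"
  "mat3 a b c d e f g h i $ 2 $ 2 = e" "mat3 a b c d e f g h i $ 2 $ 3 = f"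
  "mat3 a b c d e f g h i $ 3 $ 1 = g" "mat3 a b c d e f g h i $ 3 $ 2 = h"
  "mat3 a b c d e f g h i $ 3 $ 3 = i"
  by (simp_all add: mat3_def)

lemma mat3_eq_iff:
  "M = N \<longleftrightarrow> M$1$1 = N$1$1 \<and> M$1$2 = N$1$2 \<and> M$1$3 = N$1$3 \<and> M$2$1 = N$2$1 \<and> M$2$2 = N$2$2 \<and>
     M$2$3 = N$2$3 \<and> M$3$1 = N$3$1 \<and> M$3$2 = N$3$2 \<and> M$3$3 = N$3$3"
  for M N :: "'a^3^3"
  by (auto simp: vec_eq_iff forall_3)

lemma mat3_mult [simp]:
  "mat3 a b c d e f g h i ** mat3 a' b' c' d' e' f' g' h' i' =
     mat3 (a*a' + b*d' + c*g') (a*b' + b*e' + c*h') (a*c' + b*f' + c*i')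
          (d*a' + e*d' + f*g') (d*b' + e*e' + f*h') (d*c' + e*f' + f*i')
          (g*a' + h*d' + i*g') (g*b' + h*e' + i*h') (g*c' + h*f' + i*i')"
  for a :: "'a::semiring_1"
  by (simp add: mat3_eq_iff matrix_matrix_mult_def sum_3)

lemma mat3_one: "(mat 1 :: 'a::semiring_1^3^3) = mat3 1 0 0 0 1 0 0 0 1"
  by (simp add: mat3_eq_iff mat_def)

lemma diag2_mat2: "diag2 a b = mat2 a 0 0 b"
  unfolding diag2_def vector_mat2 ..

lemma det_mat3: "det (mat3 a b c d e f g h i) = a*e*i + b*f*g + c*d*h - a*f*h - b*d*i - c*e*g"
  for a :: "'a::comm_ring_1"
  by (simp add: det_3)

text \<open>The shape of an extension of a plane by a line: \<open>A\<close> acts on the plane,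
  \<open>s\<close> on the quotient line, and \<open>v\<close> is the value of the cocycle.\<close>

definition blk :: "complex^2^2 \<Rightarrow> complex^2 \<Rightarrow> complex \<Rightarrow> complex^3^3" where
  "blk A v s = mat3 (A$1$1) (A$1$2) (v$1) (A$2$1) (A$2$2) (v$2) 0 0 s"

lemma blk_mult [simp]: "blk A v s ** blk B w r = blk (A ** B) (A *v w + r *s v) (s * r)"
  by (simp add: blk_def mat3_eq_iff matrix_matrix_mult_def matrix_vector_mult_def sum_2 sum_3 mult.commute)

lemma blk_one: "mat 1 = blk (mat 1) 0 1"
  by (simp add: blk_def mat3_one mat_def mat3_eq_iff)

lemma blk_eq_iff [simp]: "blk A v s = blk B w r \<longleftrightarrow> A = B \<and> v = w \<and> s = r"
  by (auto simp: blk_def mat3_eq_iff mat2_eq_iff vec_eq_iff forall_2)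

lemma blk_mat2: "blk (mat2 a b c d) v s = mat3 a b (v$1) c d (v$2) 0 0 s"
  by (simp add: blk_def)

lemma modular_pair_blk_sub: "modular_pair (blk A v s) (blk B w l) \<Longrightarrow> modular_pair A B"
  by (simp add: modular_pair_def blk_one)

section \<open>Invariant planes and the extensions that contain them\<close>

definition sub_pair ::
  "complex^'n::finite^'n \<Rightarrow> complex^'n^'n \<Rightarrow> complex^'m::finite^'m \<Rightarrow> complex^'m^'m \<Rightarrow> bool" where
  "sub_pair A B A0 B0 \<longleftrightarrow>
     (\<exists>J :: complex^'m^'n. inj ((*v) J) \<and> A ** J = J ** A0 \<and> B ** J = J ** B0)"

lemma subrep_iff_sub_pair:
  assumes "is_rep \<rho>0" "is_rep \<rho>"
  shows "subrep \<rho>0 \<rho> \<longleftrightarrow> sub_pair (\<rho> elt_S) (\<rho> elt_T) (\<rho>0 elt_S) (\<rho>0 elt_T)"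
  unfolding subrep_def sub_pair_def
  using rep_intertwine[OF assms(2,1)] elt_ST_carrier by blast

lemma sub_pair_simconj:
  assumes "sub_pair A B A0 B0" "simconj A0 B0 A1 B1"
  shows "sub_pair A B A1 B1"
proof -
  obtain J where J: "inj ((*v) J)" "A ** J = J ** A0" "B ** J = J ** B0"
    using assms(1) unfolding sub_pair_def by blast
  obtain P where P: "invertible P" "P ** A1 = A0 ** P" "P ** B1 = B0 ** P"
    using simconj_sym[OF assms(2)] unfolding simconj_def by blast
  have "inj ((*v) P)"
    using invertible_matrix_inv(2)[OF P(1)]
    by (metis injI matrix_vector_mul_assoc matrix_vector_mul_lid)
  then have "inj ((*v) (J ** P))" using J(1) unfolding inj_def
    by (simp flip: matrix_vector_mul_assoc)
  moreover have "A ** (J ** P) = (J ** P) ** A1" "B ** (J ** P) = (J ** P) ** B1"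
    using J P by (simp_all add: matrix_mul_assoc, simp_all flip: matrix_mul_assoc)
  ultimately show ?thesis unfolding sub_pair_def by blast
qed

text \<open>If all minors vanish, each row of \<open>J\<close> yields the kernel vector
  \<open>(J$i$2, - J$i$1)\<close>, so every row is zero.\<close>

lemma inj_minors:
  fixes J :: "complex^2^3"
  assumes "inj ((*v) J)" and m: "\<And>k i. J$k$1 * J$i$2 = J$k$2 * J$i$1"
  shows False
proof -
  have inj: "x = 0" if "J *v x = 0" for x
    using assms(1) that unfolding inj_def by (metis matrix_vector_mult_0_right)
  have "J $ i $ 1 = 0 \<and> J $ i $ 2 = 0" for i
  proof -
    have "J *v vector [J$i$2, - J$i$1] = 0"
      using m by (simp add: vec_eq_iff matrix_vector_mult_def sum_2)
    from inj[OF this] show ?thesis by (simp add: vec_eq_iff forall_2)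
  qed
  then have "J *v vector [1, 1] = 0" by (simp add: vec_eq_iff matrix_vector_mult_def sum_2)
  from inj[OF this] show False by (simp add: vec_eq_iff forall_2)
qed

lemma diagonalizableE:
  fixes B :: "complex^'n::finite^'n"
  assumes "diagonalizable B"
  obtains Q :: "complex^'n^'n" and d where "invertible Q" "\<And>j. B *v column j Q = d j *s column j Q"
proof -
  obtain Q D :: "complex^'n^'n" where Q: "invertible Q" "\<forall>i j. i \<noteq> j \<longrightarrow> D$i$j = 0" "B = Q ** D ** matrix_inv Q"
    using assms unfolding diagonalizable_def by blast
  have "B ** Q = Q ** D"
    using invertible_matrix_inv[OF Q(1)] unfolding Q(3) by (simp flip: matrix_mul_assoc)
  have "B *v column j Q = D$j$j *s column j Q" for j
  proof -
    have "(B *v column j Q) $ i = (Q ** D) $ i $ j" for i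
      unfolding \<open>B ** Q = Q ** D\<close>[symmetric]
      by (simp add: matrix_vector_mult_def matrix_matrix_mult_def column_def)
    also have "(Q ** D) $ i $ j = (\<Sum>k\<in>UNIV. if k = j then Q$i$j * D$j$j else 0)" for i
      unfolding matrix_matrix_mult_def vec_lambda_beta
      by (intro sum.cong) (use Q(2) in auto)
    finally show ?thesis by (simp add: vec_eq_iff column_def mult.commute)
  qed
  then show ?thesis using Q(1) that[of Q "\<lambda>j. D$j$j"] by blast
qed

text \<open>A diagonalizable matrix has an eigenvector outside the invariant plane; together with a basis
  of that plane it makes both matrices block triangular, the second one block diagonal.\<close>

lemma sub_pair_block:
  fixes A B :: "complex^3^3" and A0 B0 :: "complex^2^2"
  assumes "sub_pair A B A0 B0" "diagonalizable B"
  shows "\<exists>v s l. simconj A B (blk A0 v s) (blk B0 0 l)"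
proof -
  obtain J where J: "inj ((*v) J)" "A ** J = J ** A0" "B ** J = J ** B0"
    using assms(1) unfolding sub_pair_def by blast
  obtain Q :: "complex^3^3" and d where Q: "invertible Q" "\<And>j. B *v column j Q = d j *s column j Q"
    using diagonalizableE[OF assms(2)] by blast
  define ext where "ext = (\<lambda>u :: complex^3.
    mat3 (J$1$1) (J$1$2) (u$1) (J$2$1) (J$2$2) (u$2) (J$3$1) (J$3$2) (u$3))"
  \<comment> \<open>The cross product of the two columns of \<open>J\<close>: the determinant of
    \<open>J\<close> extended by a column \<open>u\<close> is the linear form \<open>n\<close>
    applied to \<open>u\<close>.\<close>
  define n :: "complex^3" where "n = vector [J$2$1 * J$3$2 - J$3$1 * J$2$2,
    J$3$1 * J$1$2 - J$1$1 * J$3$2, J$1$1 * J$2$2 - J$2$1 * J$1$2]"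
  have n: "det (ext u) = n$1 * u$1 + n$2 * u$2 + n$3 * u$3" for u
    by (simp add: ext_def n_def det_mat3 algebra_simps)
  have "\<exists>j. det (ext (column j Q)) \<noteq> 0"
  proof (rule ccontr)
    assume "\<not> ?thesis"
    \<comment> \<open>If no eigenvector left the plane, \<open>n\<close> would annihilate all
      columns of the invertible \<open>Q\<close> and hence vanish, contradicting the rank of
      \<open>J\<close>.\<close>
    then have "n v* Q = 0"
      by (simp add: n vec_eq_iff vector_matrix_mult_def sum_3 column_def mult.commute)
    then have "n v* (Q ** matrix_inv Q) = 0"
      by (simp flip: vector_matrix_mul_assoc)
    then have "n = 0" using invertible_matrix_inv[OF Q(1)] by simp
    then have "n$1 = 0" "n$2 = 0" "n$3 = 0" by simp_all
    then have "J$k$1 * J$i$2 = J$k$2 * J$i$1" for k i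
      using exhaust_3[of k] exhaust_3[of i] unfolding n_def by (auto simp: algebra_simps)
    then show False using inj_minors[OF J(1)] by blast
  qed
  then obtain u l where u: "det (ext u) \<noteq> 0" "B *v u = l *s u" using Q(2) by blast
  define P where "P = ext u"
  have P: "invertible P" using u(1) unfolding P_def by (simp add: invertible_det_nz)
  define w where "w = matrix_inv P *v (A *v u)"
  have w: "A *v u = P *v w"
    unfolding w_def using invertible_matrix_inv[OF P] by (simp add: matrix_vector_mul_assoc matrix_mul_assoc)
  have Mext: "M ** P = P ** blk M0 v s"
    if MJ: "M ** J = J ** M0" and Mu: "M *v u = P *v vector [v$1, v$2, s]"
    for M M0 v s
  proof -
    have "(M ** P) $ i $ 1 = (M ** J) $ i $ 1" "(M ** P) $ i $ 2 = (M ** J) $ i $ 2"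
      "(M ** P) $ i $ 3 = (M *v u) $ i" for i
      by (simp_all add: P_def ext_def matrix_matrix_mult_def matrix_vector_mult_def sum_3)
    moreover have "(P ** blk M0 v s) $ i $ 1 = (J ** M0) $ i $ 1"
      "(P ** blk M0 v s) $ i $ 2 = (J ** M0) $ i $ 2"
      "(P ** blk M0 v s) $ i $ 3 = (P *v vector [v$1, v$2, s]) $ i" for i
      using exhaust_3[of i]
      by (auto simp: P_def ext_def blk_def matrix_matrix_mult_def matrix_vector_mult_def sum_3 sum_2)
    ultimately show ?thesis using MJ Mu by (simp add: vec_eq_iff forall_3)
  qed
  have "A ** P = P ** blk A0 (vector [w$1, w$2]) (w$3)"
  proof (rule Mext[OF J(2)])
    have "vector [(vector [w$1, w$2] :: complex^2) $ 1, (vector [w$1, w$2] :: complex^2) $ 2, w$3] = w"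
      by (simp add: vec_eq_iff forall_3)
    then show "A *v u = P *v vector [(vector [w$1, w$2] :: complex^2) $ 1, (vector [w$1, w$2] :: complex^2) $ 2, w$3]"
      using w by simp
  qed
  moreover have "B ** P = P ** blk B0 0 l"
  proof (rule Mext[OF J(3)])
    show "B *v u = P *v vector [(0::complex^2) $ 1, (0::complex^2) $ 2, l]"
      unfolding u(2) by (simp add: vec_eq_iff forall_3 P_def ext_def matrix_vector_mult_def sum_3)
  qed
  ultimately have "simconj (blk A0 (vector [w$1, w$2]) (w$3)) (blk B0 0 l) A B"
    unfolding simconj_def using P by metis
  then show ?thesis using simconj_sym by blast
qed

lemma ext_repsE:
  assumes "\<rho> \<in> ext_reps Q"
  obtains \<rho>0 where "is_rep \<rho>" "is_rep \<rho>0" "Q \<rho>0" "modular_pair (\<rho> elt_S) (\<rho> elt_T)"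
    "sub_pair (\<rho> elt_S) (\<rho> elt_T) (\<rho>0 elt_S) (\<rho>0 elt_T)"
    "\<not> decomposable_pair (\<rho> elt_S) (\<rho> elt_T)" "diagonalizable (\<rho> elt_T)"
proof -
  obtain \<rho>0 where "is_rep \<rho>" "is_rep \<rho>0" "Q \<rho>0" "indecomposable \<rho>" "subrep \<rho>0 \<rho>"
    "diagonalizable (\<rho> elt_T)"
    using assms unfolding ext_reps_def by blast
  then show ?thesis using that[of \<rho>0]
    by (simp add: subrep_iff_sub_pair decomposable_iff_pair rep_modular_pair)
qed

lemma reducible_pair_blk: "reducible_pair (blk A v s) (blk B w l)"
proof -
  let ?W = "{x :: complex^3. x$3 = 0}"
  have "invariant_pair (blk A v s) (blk B w l) ?W"
    unfolding invariant_pair_def vec.subspace_def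
    by (simp add: blk_def matrix_vector_mult_def sum_3)
  moreover have "axis 1 1 \<in> ?W" "axis 1 (1::complex) \<noteq> 0" "axis 3 1 \<notin> ?W"
    by (simp_all add: axis_def vec_eq_iff)
  then have "?W \<noteq> {0}" "?W \<noteq> UNIV" by blast+
  ultimately show ?thesis unfolding reducible_pair_def by blast
qed

lemma sub_pair_blk: "sub_pair (blk A v s) (blk B w l) A B"
proof -
  define J :: "complex^2^3" where "J = vector [vector [1, 0], vector [0, 1], vector [0, 0]]"
  have "x = y" if "J *v x = J *v y" for x y :: "complex^2"
    using that by (simp add: J_def vec_eq_iff forall_3 forall_2 matrix_vector_mult_def sum_2)
  then have "inj ((*v) J)" by (simp add: inj_def)
  moreover have "blk M u r ** J = J ** M" for M u r
    by (simp add: J_def blk_def vec_eq_iff forall_3 forall_2 matrix_matrix_mult_def sum_2 sum_3)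
  ultimately show ?thesis unfolding sub_pair_def by blast
qed

text \<open>\<open>Q\<close> is asked of every \<open>\<rho>0\<close> with these two values, because
  the presentation supplies the subrepresentation only through its values at the generators.\<close>

lemma ext_repsI:
  assumes m: "modular_pair (blk A0 v s) (blk B0 w l)"
    and "\<not> decomposable_pair (blk A0 v s) (blk B0 w l)" "diagonalizable (blk B0 w l)"
    and Q: "\<And>\<rho>0. is_rep \<rho>0 \<Longrightarrow> \<rho>0 elt_S = A0 \<Longrightarrow> \<rho>0 elt_T = B0 \<Longrightarrow> Q \<rho>0"
  shows "\<exists>\<rho>\<in>ext_reps Q. \<rho> elt_S = blk A0 v s \<and> \<rho> elt_T = blk B0 w l"
proof -
  obtain \<rho> where \<rho>: "is_rep \<rho>" "\<rho> elt_S = blk A0 v s" "\<rho> elt_T = blk B0 w l"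
    using modular_pair_rep[OF m] by blast
  obtain \<rho>0 where \<rho>0: "is_rep \<rho>0" "\<rho>0 elt_S = A0" "\<rho>0 elt_T = B0"
    using modular_pair_rep[OF modular_pair_blk_sub[OF m]] by blast
  have "subrep \<rho>0 \<rho>" using \<rho> \<rho>0 by (simp add: subrep_iff_sub_pair sub_pair_blk)
  then have "\<rho> \<in> ext_reps Q"
    unfolding ext_reps_def using \<rho> \<rho>0 Q[OF \<rho>0] assms(2,3)
    by (auto simp: reducible_iff_pair decomposable_iff_pair reducible_pair_blk)
  then show ?thesis using \<rho> by blast
qed

lemma ext_reps_is_rep: "\<rho> \<in> ext_reps Q \<Longrightarrow> is_rep \<rho>"
  unfolding ext_reps_def by blast

section \<open>From lists of pairs to numbers of equivalence classes\<close>

lemma represented_byI: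
  assumes ex: "\<And>A B. (A, B) \<in> D \<Longrightarrow> \<exists>\<rho>\<in>ext_reps Q. \<rho> elt_S = A \<and> \<rho> elt_T = B"
    and cover: "\<And>\<rho>. \<rho> \<in> ext_reps Q \<Longrightarrow> \<exists>(A, B)\<in>D. simconj (\<rho> elt_S) (\<rho> elt_T) A B"
    and inj: "\<And>A B A' B'. (A, B) \<in> D \<Longrightarrow> (A', B') \<in> D \<Longrightarrow> simconj A B A' B' \<Longrightarrow> (A, B) = (A', B')"
  shows "represented_by (ext_reps Q) D"
  unfolding represented_by_def
proof (intro conjI ballI)
  show "case d of (A, B) \<Rightarrow> \<exists>\<rho>\<in>ext_reps Q. \<rho> elt_S = A \<and> \<rho> elt_T = B" if "d \<in> D" for d
    using that ex by auto
  fix \<rho> assume \<rho>: "\<rho> \<in> ext_reps Q"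
  obtain A B where AB: "(A, B) \<in> D" "simconj (\<rho> elt_S) (\<rho> elt_T) A B" using cover[OF \<rho>] by blast
  obtain \<rho>' where \<rho>': "\<rho>' \<in> ext_reps Q" "\<rho>' elt_S = A" "\<rho>' elt_T = B" using ex[OF AB(1)] by blast
  show "\<exists>!(A, B). (A, B) \<in> D \<and> (\<exists>\<rho>'\<in>ext_reps Q. \<rho>' elt_S = A \<and> \<rho>' elt_T = B \<and> equivalent \<rho> \<rho>')"
  proof (rule ex1I[of _ "(A, B)"])
    show "case (A, B) of (A, B) \<Rightarrow> (A, B) \<in> D \<and>
      (\<exists>\<rho>'\<in>ext_reps Q. \<rho>' elt_S = A \<and> \<rho>' elt_T = B \<and> equivalent \<rho> \<rho>')"
      using AB \<rho>' ext_reps_is_rep[OF \<rho>] ext_reps_is_rep[OF \<rho>'(1)]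
      by (auto simp: equivalent_iff_simconj)
    fix d assume d: "case d of (A, B) \<Rightarrow> (A, B) \<in> D \<and>
      (\<exists>\<rho>'\<in>ext_reps Q. \<rho>' elt_S = A \<and> \<rho>' elt_T = B \<and> equivalent \<rho> \<rho>')"
    obtain A' B' where [simp]: "d = (A', B')" by (cases d)
    from d have "(A', B') \<in> D" "simconj (\<rho> elt_S) (\<rho> elt_T) A' B'"
      using ext_reps_is_rep[OF \<rho>] ext_reps_is_rep by (auto simp: equivalent_iff_simconj)
    then have "simconj A B A' B'" using AB(2) simconj_sym simconj_trans by blast
    then show "d = (A, B)" using inj[OF AB(1) \<open>(A', B') \<in> D\<close>] by simp
  qed
qed

lemma equiv_rep_equiv: "equiv {\<rho>. is_rep \<rho>} rep_equiv"
proof (rule equivI)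
  show "rep_equiv \<subseteq> {\<rho>. is_rep \<rho>} \<times> {\<rho>. is_rep \<rho>}" unfolding rep_equiv_def by auto
  show "refl_on {\<rho>. is_rep \<rho>} rep_equiv"
    unfolding refl_on_def rep_equiv_def by (auto simp: equivalent_iff_simconj simconj_refl)
  show "sym rep_equiv"
    unfolding sym_def rep_equiv_def by (auto simp: equivalent_iff_simconj simconj_sym)
  show "trans rep_equiv"
    unfolding trans_def rep_equiv_def by (auto simp: equivalent_iff_simconj intro: simconj_trans)
qed

lemma rep_equiv_class_eq:
  assumes "is_rep \<rho>" "is_rep \<rho>'"
  shows "rep_equiv `` {\<rho>} = rep_equiv `` {\<rho>'} \<longleftrightarrow>
    simconj (\<rho> elt_S) (\<rho> elt_T) (\<rho>' elt_S) (\<rho>' elt_T)"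
  using eq_equiv_class_iff[OF equiv_rep_equiv, of \<rho> \<rho>'] assms equivalent_iff_simconj[OF assms]
  by (simp add: rep_equiv_def)

text \<open>Choosing one representation \<open>R d\<close> for each listed pair gives a bijection
  onto the classes: the existence of a listed pair makes it surjective, its uniqueness makes it
  injective.\<close>

lemma card_represented_by:
  assumes "represented_by (ext_reps Q) D"
  shows "card (ext_reps Q // rep_equiv) = card D"
proof -
  have 1: "\<exists>\<rho>\<in>ext_reps Q. \<rho> elt_S = fst d \<and> \<rho> elt_T = snd d" if "d \<in> D" for d
    using assms that unfolding represented_by_def by (cases d) auto
  have 2: "\<exists>!d. d \<in> D \<and> (\<exists>\<rho>'\<in>ext_reps Q. \<rho>' elt_S = fst d \<and> \<rho>' elt_T = snd d \<and> equivalent \<rho> \<rho>')"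
    if "\<rho> \<in> ext_reps Q" for \<rho>
    using assms that unfolding represented_by_def by (simp add: case_prod_unfold)
  obtain R where R: "\<And>d. d \<in> D \<Longrightarrow> R d \<in> ext_reps Q \<and> R d elt_S = fst d \<and> R d elt_T = snd d"
    using 1 by metis
  note rep = ext_reps_is_rep
  have "bij_betw (\<lambda>d. rep_equiv `` {R d}) D (ext_reps Q // rep_equiv)"
  proof (rule bij_betw_imageI)
    show "inj_on (\<lambda>d. rep_equiv `` {R d}) D"
    proof (rule inj_onI)
      fix d d' assume d: "d \<in> D" "d' \<in> D" and e: "rep_equiv `` {R d} = rep_equiv `` {R d'}"
      have r: "is_rep (R d)" "is_rep (R d')" using R d rep by blast+
      then have "equivalent (R d) (R d')" "equivalent (R d) (R d)"
        using e by (simp_all add: rep_equiv_class_eq equivalent_iff_simconj simconj_refl)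
      then show "d = d'" using 2[of "R d"] R d by metis
    qed
    show "(\<lambda>d. rep_equiv `` {R d}) ` D = ext_reps Q // rep_equiv"
    proof (intro equalityI subsetI)
      fix X assume "X \<in> (\<lambda>d. rep_equiv `` {R d}) ` D"
      then show "X \<in> ext_reps Q // rep_equiv" using R by (auto simp: quotient_def)
    next
      fix X assume "X \<in> ext_reps Q // rep_equiv"
      then obtain \<rho> where \<rho>: "\<rho> \<in> ext_reps Q" "X = rep_equiv `` {\<rho>}" by (auto simp: quotient_def)
      then obtain d \<rho>' where d: "d \<in> D" "\<rho>' \<in> ext_reps Q" "\<rho>' elt_S = fst d" "\<rho>' elt_T = snd d"
        "equivalent \<rho> \<rho>'" using 2 by metis
      moreover have "is_rep (R d)" using R[OF d(1)] rep by blast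
      ultimately have "X = rep_equiv `` {R d}"
        using \<rho> R[OF d(1)] rep[OF \<rho>(1)] rep[OF d(2)]
        by (simp add: rep_equiv_class_eq equivalent_iff_simconj)
      then show "X \<in> (\<lambda>d. rep_equiv `` {R d}) ` D" using d by blast
    qed
  qed
  then show ?thesis by (metis bij_betw_same_card)
qed

section \<open>Sixth roots of unity\<close>

definition \<omega>6 :: complex where "\<omega>6 = ev 1"

lemma \<omega>6_Complex: "\<omega>6 = Complex (1/2) (sqrt 3 / 2)"
proof -
  have "\<omega>6 = cis (pi / 3)" unfolding \<omega>6_def ev_def e2pi_def cis_conv_exp by (simp add: field_simps)
  then show ?thesis by (simp add: complex_eq_iff cos_60 sin_60)
qed

text \<open>The minimal polynomial \<open>x^2 - x + 1\<close> as a rewrite rule: polynomials in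
  \<open>\<omega>6\<close> reduce to linear ones. The next lemma is the same rule for products
  nested to the right.\<close>

lemma \<omega>6_mult_self [simp]: "\<omega>6 * \<omega>6 = \<omega>6 - 1"
  unfolding \<omega>6_Complex by (simp add: complex_eq_iff field_simps)

lemma \<omega>6_mult_self' [simp]: "\<omega>6 * (\<omega>6 * z) = \<omega>6 * z - z"
  by (simp flip: mult.assoc add: left_diff_distrib)

lemma ev_power: "ev n = \<omega>6 ^ n"
  unfolding \<omega>6_def ev_def e2pi_def exp_of_nat_mult[symmetric] by (simp add: field_simps)

lemma ev_simps: "ev 0 = 1" "ev 1 = \<omega>6" "ev (Suc 0) = \<omega>6" "ev 2 = \<omega>6 - 1" "ev 3 = -1" "ev 4 = - \<omega>6"
  "ev 5 = 1 - \<omega>6"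
  by (simp_all add: ev_power eval_nat_numeral algebra_simps)

lemma ev_inj: "x < 6 \<Longrightarrow> y < 6 \<Longrightarrow> ev x = ev y \<Longrightarrow> x = y"
proof -
  have e: "x \<in> {0, 1, 2, 3, 4, 5}" if "x < 6" for x :: nat using that by auto
  assume "x < 6" "y < 6" "ev x = ev y"
  then show ?thesis
    using e[of x] e[of y] by (auto simp: ev_simps \<omega>6_Complex complex_eq_iff)
qed

lemma sixth_root_ev:
  assumes "l ^ 6 = 1"
  obtains x where "x < 6" "l = ev x"
proof -
  have "(l - 1) * (l - \<omega>6) * (l - (\<omega>6 - 1)) * (l + 1) * (l + \<omega>6) * (l - (1 - \<omega>6)) = l ^ 6 - 1"
    by (simp add: eval_nat_numeral algebra_simps)
  then have "l = ev 0 \<or> l = ev 1 \<or> l = ev 2 \<or> l = ev 3 \<or> l = ev 4 \<or> l = ev 5"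
    using assms unfolding ev_simps by (simp add: eq_neg_iff_add_eq_0)
  then show ?thesis using that[of 0] that[of 1] that[of 2] that[of 3] that[of 4] that[of 5]
    by (elim disjE) simp_all
qed

text \<open>\<open>1 - \<omega>6\<close> is the complex conjugate of \<open>\<omega>6\<close>; the
  two are the primitive sixth roots of unity, the zeros of \<open>x^2 - x + 1\<close>.\<close>

lemma sixth_root_neighbour:
  assumes "a\<^sup>2 - a * b + b\<^sup>2 = 0"
  shows "a = \<omega>6 * b \<or> a = (1 - \<omega>6) * b"
proof -
  have "(a - \<omega>6 * b) * (a - (1 - \<omega>6) * b) = a\<^sup>2 - a * b + b\<^sup>2"
    by (simp add: power2_eq_square algebra_simps)
  then show ?thesis using assms by simp
qed

section \<open>Diagonal matrices with distinct entries\<close>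

definition distinct_diagonal :: "complex^'n^'n \<Rightarrow> bool" where
  "distinct_diagonal B \<longleftrightarrow> (\<forall>i j. i \<noteq> j \<longrightarrow> B$i$j = 0 \<and> B$i$i \<noteq> B$j$j)"

lemma diagonal_mult_vec:
  fixes B :: "complex^'n::finite^'n"
  assumes "distinct_diagonal B"
  shows "(B *v w) $ k = B$k$k * w$k"
proof -
  have "(\<Sum>j\<in>UNIV. B$k$j * w$j) = (\<Sum>j\<in>UNIV. if j = k then B$k$k * w$k else 0)"
    by (intro sum.cong) (use assms in \<open>auto simp: distinct_diagonal_def\<close>)
  then show ?thesis by (simp add: matrix_vector_mult_def)
qed

text \<open>Shrinking the support: \<open>B - B$j$j\<close> preserves \<open>W\<close>, kills the
  coordinate \<open>j\<close> and, the diagonal entries being distinct, keeps the coordinate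
  \<open>i\<close>, until only a multiple of the axis remains.\<close>

lemma invariant_pair_axis:
  assumes B: "distinct_diagonal B" and W: "invariant_pair A B W"
  shows "w \<in> W \<Longrightarrow> w$i \<noteq> 0 \<Longrightarrow> axis i 1 \<in> W"
proof (induction "card {j. w$j \<noteq> 0}" arbitrary: w rule: less_induct)
  case less
  have sub: "vec.subspace W" using W unfolding invariant_pair_def by blast
  show ?case
  proof (cases "\<exists>j. j \<noteq> i \<and> w$j \<noteq> 0")
    case True
    then obtain j where j: "j \<noteq> i" "w$j \<noteq> 0" by blast
    define w' where "w' = B *v w - B$j$j *s w"
    have w': "w'$k = (B$k$k - B$j$j) * w$k" for k
      by (simp add: w'_def diagonal_mult_vec[OF B] left_diff_distrib)
    have "{k. w'$k \<noteq> 0} \<subset> {k. w$k \<noteq> 0}" using j by (auto simp: w')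
    then have "card {k. w'$k \<noteq> 0} < card {k. w$k \<noteq> 0}" by (intro psubset_card_mono) auto
    moreover have "w' \<in> W"
      unfolding w'_def using W less.prems(1) sub
      by (intro vec.subspace_diff vec.subspace_scale) (auto simp: invariant_pair_def)
    moreover have "w'$i \<noteq> 0"
      using j less.prems(2) B unfolding w' distinct_diagonal_def by auto
    ultimately show ?thesis using less.hyps by blast
  next
    case False
    then have "axis i 1 = (1 / w$i) *s w" using less.prems(2) by (auto simp: vec_eq_iff axis_def)
    then show ?thesis using less.prems(1) sub by (simp add: vec.subspace_scale)
  qed
qed

text \<open>Both summands are spanned by axes, so a decomposition is a partition of the indices
  across which \<open>A\<close> has no nonzero entry.\<close>

lemma decomposable_pair_distinct_diagonal:
  fixes A B :: "complex^'n::finite^'n"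
  assumes B: "distinct_diagonal B" and "decomposable_pair A B"
  obtains I where "I \<noteq> {}" "I \<noteq> UNIV" "\<And>i j. i \<in> I \<Longrightarrow> j \<notin> I \<Longrightarrow> A$i$j = 0 \<and> A$j$i = 0"
proof -
  obtain U V where U: "invariant_pair A B U" and V: "invariant_pair A B V"
    and UV: "U \<noteq> {0}" "V \<noteq> {0}" "U \<inter> V = {0}" "{u + v |u v. u \<in> U \<and> v \<in> V} = UNIV"
    using assms(2) unfolding decomposable_pair_def by blast
  have ne: "axis i (1::complex) \<noteq> 0" for i :: 'n by (simp add: axis_eq_0_iff)
  have notboth: "\<not> (axis i 1 \<in> U \<and> axis i 1 \<in> V)" for i
    using UV(3) ne[of i] by blast
  have one: "axis i 1 \<in> U \<or> axis i 1 \<in> V" for i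
  proof -
    have "axis i 1 \<in> {u + v |u v. u \<in> U \<and> v \<in> V}" unfolding UV(4) by simp
    then obtain u v where uv: "axis i 1 = u + v" "u \<in> U" "v \<in> V" by blast
    have "u$i + v$i = 1" using arg_cong[OF uv(1), of "\<lambda>x. x$i"] by simp
    then have "u$i \<noteq> 0 \<or> v$i \<noteq> 0" by auto
    then show ?thesis using invariant_pair_axis[OF B U uv(2)] invariant_pair_axis[OF B V uv(3)] by blast
  qed
  have ex: "\<exists>i. axis i 1 \<in> W" if W: "invariant_pair A B W" "W \<noteq> {0}" for W
  proof -
    have "0 \<in> W" using W vec.subspace_0 unfolding invariant_pair_def by blast
    then obtain w where "w \<in> W" "w \<noteq> 0" using W by blast
    then show ?thesis using invariant_pair_axis[OF B W(1), of w] by (auto simp: vec_eq_iff)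
  qed
  have step: "axis j 1 \<in> W" if "invariant_pair A B W" "axis i 1 \<in> W" "A$j$i \<noteq> 0" for i j W
  proof -
    have "A *v axis i 1 \<in> W" using that unfolding invariant_pair_def by blast
    moreover have "(A *v axis i 1) $ j = A$j$i"
      by (simp add: matrix_vector_mult_def axis_def if_distrib cong: if_cong)
    ultimately show ?thesis using invariant_pair_axis[OF B that(1)] that(3) by metis
  qed
  show ?thesis
  proof (rule that[of "{i. axis i 1 \<in> U}"])
    show "{i. axis i 1 \<in> U} \<noteq> {}" using ex[OF U UV(1)] by blast
    show "{i. axis i 1 \<in> U} \<noteq> UNIV" using ex[OF V UV(2)] notboth by blast
    show "A$i$j = 0 \<and> A$j$i = 0" if "i \<in> {i. axis i 1 \<in> U}" "j \<notin> {i. axis i 1 \<in> U}" for i j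
      using that one[of j] step[OF U, of i j] step[OF V, of j i] notboth[of i] notboth[of j] by blast
  qed
qed

lemma distinct_diagonal_mat2: "l1 \<noteq> l2 \<Longrightarrow> distinct_diagonal (mat2 l1 0 0 l2)"
  unfolding distinct_diagonal_def by (auto simp: forall_2)

lemma distinct_diagonal_mat3:
  "l1 \<noteq> l2 \<Longrightarrow> l1 \<noteq> l3 \<Longrightarrow> l2 \<noteq> l3 \<Longrightarrow> distinct_diagonal (mat3 l1 0 0 0 l2 0 0 0 l3)"
  unfolding distinct_diagonal_def by (auto simp: forall_3)

lemma indecomposable_mat2:
  assumes "b \<noteq> 0" "l1 \<noteq> l2"
  shows "\<not> decomposable_pair (mat2 a b c d) (mat2 l1 0 0 l2)"
proof
  assume "decomposable_pair (mat2 a b c d) (mat2 l1 0 0 l2)"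
  then obtain I where I: "I \<noteq> {}" "I \<noteq> UNIV"
    "\<And>i j. i \<in> I \<Longrightarrow> j \<notin> I \<Longrightarrow> mat2 a b c d $i$j = 0 \<and> mat2 a b c d $j$i = 0"
    using decomposable_pair_distinct_diagonal[OF distinct_diagonal_mat2[OF assms(2)]] by blast
  have "(1::2) \<in> I \<longleftrightarrow> 2 \<in> I" using I(3)[of 1 2] I(3)[of 2 1] assms(1) by auto
  then have "(\<forall>i. i \<in> I) \<or> (\<forall>i. i \<notin> I)" unfolding forall_2 by blast
  then show False using I(1,2) by blast
qed

text \<open>Connectedness: the entry \<open>(1,3)\<close> ties the indices 1 and 3 together, and
  either of the other two entries ties 2 to one of them.\<close>

lemma indecomposable_mat3:
  assumes "A$1$3 \<noteq> 0" "A$1$2 \<noteq> 0 \<or> A$2$3 \<noteq> 0" "l1 \<noteq> l2" "l1 \<noteq> l3" "l2 \<noteq> l3"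
  shows "\<not> decomposable_pair A (mat3 l1 0 0 0 l2 0 0 0 l3)"
proof
  assume "decomposable_pair A (mat3 l1 0 0 0 l2 0 0 0 l3)"
  then obtain I where I: "I \<noteq> {}" "I \<noteq> UNIV" "\<And>i j. i \<in> I \<Longrightarrow> j \<notin> I \<Longrightarrow> A$i$j = 0 \<and> A$j$i = 0"
    using decomposable_pair_distinct_diagonal[OF distinct_diagonal_mat3[OF assms(3-5)]] by blast
  have "1 \<in> I \<longleftrightarrow> 3 \<in> I" "(1 \<in> I \<longleftrightarrow> 2 \<in> I) \<or> (2 \<in> I \<longleftrightarrow> 3 \<in> I)"
    using I(3) assms(1,2) by blast+
  then have "(\<forall>i. i \<in> I) \<or> (\<forall>i. i \<notin> I)" unfolding forall_3 by blast
  then show False using I(1,2) by blast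
qed

lemma diagonalizable_mat3: "diagonalizable (mat3 l1 0 0 0 l2 0 0 0 l3)"
proof -
  let ?D = "mat3 l1 0 0 0 l2 0 0 0 l3"
  have i: "invertible (mat 1 :: complex^3^3)" unfolding invertible_def by auto
  have "?D = mat 1 ** ?D ** matrix_inv (mat 1)" using conj_matrix_iff[OF i, of ?D ?D] by simp
  moreover have "\<forall>i j. i \<noteq> j \<longrightarrow> ?D$i$j = 0" by (auto simp: forall_3)
  ultimately show ?thesis unfolding diagonalizable_def using i by blast
qed

text \<open>This set and its analogue for the transposed matrices, an invariant of the pair, separate the
  classes in the lists.\<close>

definition common_eigenvalues :: "complex^'n::finite^'n \<Rightarrow> complex^'n^'n \<Rightarrow> complex set" where
  "common_eigenvalues A B = {l. \<exists>v m. v \<noteq> 0 \<and> A *v v = m *s v \<and> B *v v = l *s v}"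

lemma common_eigenvalues_simconj_subset:
  "simconj A B A' B' \<Longrightarrow> common_eigenvalues A B \<subseteq> common_eigenvalues A' B'"
proof
  fix l assume s: "simconj A B A' B'" and "l \<in> common_eigenvalues A B"
  then obtain v m where v: "v \<noteq> 0" "A *v v = m *s v" "B *v v = l *s v"
    unfolding common_eigenvalues_def by blast
  obtain P where P: "invertible P" "P ** A = A' ** P" "P ** B = B' ** P"
    using s unfolding simconj_def by blast
  have "P *v v \<noteq> 0"
  proof
    assume "P *v v = 0"
    then have "matrix_inv P *v (P *v v) = 0" by simp
    then show False using v(1) invertible_matrix_inv(2)[OF P(1)] by (simp add: matrix_vector_mul_assoc)
  qed
  moreover have "A' *v (P *v v) = P *v (A *v v)" "B' *v (P *v v) = P *v (B *v v)"
    by (simp_all add: matrix_vector_mul_assoc P)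
  then have "A' *v (P *v v) = m *s (P *v v)" "B' *v (P *v v) = l *s (P *v v)"
    by (simp_all add: v vec.scale)
  ultimately show "l \<in> common_eigenvalues A' B'" unfolding common_eigenvalues_def by blast
qed

lemma common_eigenvalues_simconj:
  "simconj A B A' B' \<Longrightarrow> common_eigenvalues A B = common_eigenvalues A' B'"
  using common_eigenvalues_simconj_subset simconj_sym by blast

lemma simconj_transpose:
  assumes "simconj A B A' B'"
  shows "simconj (transpose A') (transpose B') (transpose A) (transpose B)"
proof -
  obtain P where P: "invertible P" "P ** A = A' ** P" "P ** B = B' ** P"
    using assms unfolding simconj_def by blast
  have "transpose P ** transpose (matrix_inv P) = mat 1" "transpose (matrix_inv P) ** transpose P = mat 1"
    using invertible_matrix_inv[OF P(1)] by (simp_all flip: matrix_transpose_mul)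
  then have "invertible (transpose P)" unfolding invertible_def by blast
  moreover have "transpose (A' ** P) = transpose (P ** A)" "transpose (B' ** P) = transpose (P ** B)"
    by (simp_all add: P)
  ultimately show ?thesis unfolding simconj_def matrix_transpose_mul by blast
qed

text \<open>The eigenvectors of the diagonal matrix are the multiples of the axes, and an axis is an
  eigenvector of \<open>A\<close> exactly when its column vanishes off the diagonal.\<close>

lemma common_eigenvalues_mat3:
  assumes "l1 \<noteq> l2" "l1 \<noteq> l3" "l2 \<noteq> l3"
  shows "common_eigenvalues A (mat3 l1 0 0 0 l2 0 0 0 l3) =
    {l. l = l1 \<and> A$2$1 = 0 \<and> A$3$1 = 0 \<or> l = l2 \<and> A$1$2 = 0 \<and> A$3$2 = 0 \<or>
        l = l3 \<and> A$1$3 = 0 \<and> A$2$3 = 0}"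
    (is "?E = ?R")
proof
  show "?E \<subseteq> ?R"
  proof
    fix l assume "l \<in> ?E"
    then obtain v m where "v \<noteq> 0" and v: "A *v v = m *s v" "mat3 l1 0 0 0 l2 0 0 0 l3 *v v = l *s v"
      unfolding common_eigenvalues_def by blast
    from v(1) have a: "A$1$1 * v$1 + A$1$2 * v$2 + A$1$3 * v$3 = m * v$1"
      "A$2$1 * v$1 + A$2$2 * v$2 + A$2$3 * v$3 = m * v$2"
      "A$3$1 * v$1 + A$3$2 * v$2 + A$3$3 * v$3 = m * v$3"
      by (simp_all add: vec_eq_iff forall_3 matrix_vector_mult_def sum_3)
    from v(2) have b: "l1 * v$1 = l * v$1" "l2 * v$2 = l * v$2" "l3 * v$3 = l * v$3"
      by (simp_all add: vec_eq_iff forall_3 matrix_vector_mult_def sum_3)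
    consider "v$1 \<noteq> 0" | "v$2 \<noteq> 0" | "v$3 \<noteq> 0" using \<open>v \<noteq> 0\<close> by (auto simp: vec_eq_iff forall_3)
    then show "l \<in> ?R"
    proof cases
      case 1
      then have "l = l1" "v$2 = 0" "v$3 = 0" using b assms by auto
      then show ?thesis using a 1 by simp
    next
      case 2
      then have "l = l2" "v$1 = 0" "v$3 = 0" using b assms by auto
      then show ?thesis using a 2 by simp
    next
      case 3
      then have "l = l3" "v$1 = 0" "v$2 = 0" using b assms by auto
      then show ?thesis using a 3 by simp
    qed
  qed
  have ax: "l \<in> ?E" if "A *v axis i 1 = m *s axis i 1" "mat3 l1 0 0 0 l2 0 0 0 l3 *v axis i 1 = l *s axis i 1"
    for l m i
    unfolding common_eigenvalues_def
    by (intro CollectI exI[of _ "axis i 1"] exI[of _ m] conjI that) (simp add: axis_eq_0_iff)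
  have "l1 \<in> ?E" if "A$2$1 = 0" "A$3$1 = 0"
    by (rule ax[of 1 "A$1$1"]) (simp_all add: that vec_eq_iff forall_3 matrix_vector_mult_def sum_3 axis_def)
  moreover have "l2 \<in> ?E" if "A$1$2 = 0" "A$3$2 = 0"
    by (rule ax[of 2 "A$2$2"]) (simp_all add: that vec_eq_iff forall_3 matrix_vector_mult_def sum_3 axis_def)
  moreover have "l3 \<in> ?E" if "A$1$3 = 0" "A$2$3 = 0"
    by (rule ax[of 3 "A$3$3"]) (simp_all add: that vec_eq_iff forall_3 matrix_vector_mult_def sum_3 axis_def)
  ultimately show "?R \<subseteq> ?E" by (intro subsetI) (elim CollectE disjE conjE; simp)
qed

section \<open>Triangular pairs\<close>

text \<open>The columns of \<open>R\<close> are the new basis in old coordinates; this is the form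
  in which all explicit base changes are given.\<close>

lemma simconjI:
  assumes "det R \<noteq> 0" "A ** R = R ** A'" "B ** R = R ** B'"
  shows "simconj A B A' B'"
proof -
  have "simconj A' B' A B" unfolding simconj_def using assms by (metis invertible_det_nz)
  then show ?thesis by (rule simconj_sym)
qed

text \<open>For an upper triangular matrix the off-diagonal entries of the cube involve the divided
  differences of \<open>x^3\<close> at the diagonal entries \<open>x\<close>, \<open>y\<close>,
  \<open>z\<close>: \<open>x^2 + x y + y^2\<close> for two of them, \<open>x + y + z\<close> for all
  three.\<close>

lemma modular_pair_triangular:
  "modular_pair (mat3 a1 c v1 0 a2 v2 0 0 a3) (mat3 l1 0 0 0 l2 0 0 0 l3) \<longleftrightarrow>
     a1\<^sup>2 = 1 \<and> c * (a1 + a2) = 0 \<and> v1 * (a1 + a3) + c * v2 = 0 \<and> a2\<^sup>2 = 1 \<and> v2 * (a2 + a3) = 0 \<and>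
     a3\<^sup>2 = 1 \<and> (a1*l1)^3 = 1 \<and> c * l2 * ((a1*l1)\<^sup>2 + (a1*l1)*(a2*l2) + (a2*l2)\<^sup>2) = 0 \<and>
     v1 * l3 * ((a1*l1)\<^sup>2 + (a1*l1)*(a3*l3) + (a3*l3)\<^sup>2) + c*l2 * (v2*l3) * (a1*l1 + a2*l2 + a3*l3) = 0 \<and>
     (a2*l2)^3 = 1 \<and> v2 * l3 * ((a2*l2)\<^sup>2 + (a2*l2)*(a3*l3) + (a3*l3)\<^sup>2) = 0 \<and> (a3*l3)^3 = 1"
  by (simp add: modular_pair_def mat3_one mat3_eq_iff power2_eq_square power3_eq_cube algebra_simps)

lemma modular_pair_triangular2:
  "modular_pair (mat2 a1 c 0 a2) (mat2 l1 b 0 l2) \<Longrightarrow>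
     a1\<^sup>2 = 1 \<and> a2\<^sup>2 = 1 \<and> c * (a1 + a2) = 0 \<and> l1 \<noteq> 0 \<and> l2 \<noteq> 0"
  by (auto simp add: modular_pair_def mat2_one mat2_eq_iff power2_eq_square algebra_simps)

text \<open>Here \<open>s^3 = s\<close>. A character is therefore fixed by its value
  \<open>l\<close> at \<open>T\<close>, a sixth root of unity, whose cube is the value
  \<open>s\<close> at \<open>S\<close>.\<close>

lemma involution_cube:
  fixes s l :: complex
  assumes "s\<^sup>2 = 1" "(s * l)^3 = 1"
  shows "l^3 = s" "l^6 = 1" "l \<noteq> 0" "s \<noteq> 0"
proof -
  have s3: "s^3 = s" using assms(1) by (simp add: power3_eq_cube power2_eq_square)
  have "s * l^3 = 1" using assms(2) s3 by (simp add: power_mult_distrib)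
  then have "s\<^sup>2 * l^3 = s" by (simp add: power2_eq_square mult.assoc)
  then show l3: "l^3 = s" using assms(1) by simp
  have "l^6 = (l^3)\<^sup>2" by (simp flip: power_mult)
  then show "l^6 = 1" using l3 assms(1) by simp
  then show "l \<noteq> 0" by auto
  show "s \<noteq> 0" using assms(1) by auto
qed

text \<open>Primitive sixth roots have cube \<open>-1\<close>, so moving to an adjacent sixth root
  of unity flips the sign of the character at \<open>S\<close>.\<close>

lemma sixth_root_cube:
  fixes l :: complex
  assumes "l ^ 6 = 1"
  shows "(l^3)\<^sup>2 = 1" "(l^3 * l)^3 = 1" "l \<noteq> 0"
    "(\<omega>6 * l)^3 = - (l^3)" "((1 - \<omega>6) * l)^3 = - (l^3)"
proof -
  show 1: "(l^3)\<^sup>2 = 1" using assms by (simp flip: power_mult)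
  have "(l^3 * l)^3 = l^6 * l^6" by (simp add: power_mult_distrib flip: power_mult power_add)
  then show "(l^3 * l)^3 = 1" using assms by simp
  show "l \<noteq> 0" using assms by auto
  show "(\<omega>6 * l)^3 = - (l^3)" "((1 - \<omega>6) * l)^3 = - (l^3)"
    by (simp_all add: power3_eq_cube algebra_simps)
qed

text \<open>The zeros of \<open>x^2 - l x + l^2\<close>, in either order: \<open>l\<close> turned by
  an angle of \<open>pi / 3\<close> to the two sides.\<close>

definition neighbours :: "complex \<Rightarrow> complex \<Rightarrow> complex \<Rightarrow> bool" where
  "neighbours l a b \<longleftrightarrow> a = \<omega>6 * l \<and> b = (1 - \<omega>6) * l \<or> a = (1 - \<omega>6) * l \<and> b = \<omega>6 * l"

lemma neighboursI:
  "a\<^sup>2 - a * l + l\<^sup>2 = 0 \<Longrightarrow> b\<^sup>2 - b * l + l\<^sup>2 = 0 \<Longrightarrow> a \<noteq> b \<Longrightarrow> neighbours l a b"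
  using sixth_root_neighbour[of a l] sixth_root_neighbour[of b l] unfolding neighbours_def by auto

lemma neighbours_distinct:
  assumes "neighbours l a b" "l \<noteq> 0"
  shows "a \<noteq> b" "a \<noteq> l" "b \<noteq> l" "l \<noteq> a" "l \<noteq> b"
proof -
  have "\<omega>6 \<noteq> 1 - \<omega>6" "\<omega>6 \<noteq> 1" "1 - \<omega>6 \<noteq> 1" by (simp_all add: \<omega>6_Complex complex_eq_iff)
  then show "a \<noteq> b" "a \<noteq> l" "b \<noteq> l" using assms unfolding neighbours_def by auto
  then show "l \<noteq> a" "l \<noteq> b" by blast+
qed

lemma neighbours_relations:
  assumes "neighbours l a b" "l ^ 6 = 1"
  shows "a + b = l" "a * b = l\<^sup>2" "a^3 = - (l^3)" "b^3 = - (l^3)" "a\<^sup>2 - a * l + l\<^sup>2 = 0" "b\<^sup>2 - b * l + l\<^sup>2 = 0"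
    "a ^ 6 = 1" "b ^ 6 = 1"
proof -
  show "a + b = l" "a * b = l\<^sup>2" "a\<^sup>2 - a * l + l\<^sup>2 = 0" "b\<^sup>2 - b * l + l\<^sup>2 = 0"
    using assms(1) unfolding neighbours_def
    by (elim disjE conjE; hypsubst; simp add: power2_eq_square algebra_simps)+
  show 3: "a^3 = - (l^3)" "b^3 = - (l^3)"
    using assms(1) sixth_root_cube[OF assms(2)] unfolding neighbours_def by auto
  have "a^6 = (a^3)\<^sup>2" "b^6 = (b^3)\<^sup>2" by (simp_all flip: power_mult)
  then show "a ^ 6 = 1" "b ^ 6 = 1" using 3 sixth_root_cube[OF assms(2)] by simp_all
qed

section \<open>Normal forms of nonsplit triangular pairs\<close>

lemma decomposable_mat3_1: "decomposable_pair (mat3 a 0 0 0 b c 0 d e) (mat3 l1 0 0 0 l2 0 0 0 l3)"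
proof (rule decomposable_pair_index[of 1])
  show "\<exists>j. j \<noteq> (1::3)" by (rule exI[of _ 2]) simp
qed (use exhaust_3 in force)

lemma decomposable_mat3_2: "decomposable_pair (mat3 a 0 c 0 b 0 d 0 e) (mat3 l1 0 0 0 l2 0 0 0 l3)"
proof (rule decomposable_pair_index[of 2])
  show "\<exists>j. j \<noteq> (2::3)" by (rule exI[of _ 1]) simp
qed (use exhaust_3 in force)

lemma decomposable_mat3_3: "decomposable_pair (mat3 a b 0 c d 0 0 0 e) (mat3 l1 0 0 0 l2 0 0 0 l3)"
proof (rule decomposable_pair_index[of 3])
  show "\<exists>j. j \<noteq> (3::3)" by (rule exI[of _ 2]) simp
qed (use exhaust_3 in force)

text \<open>A vanishing \<open>v1\<close> or \<open>v2\<close> would split off an axis. Hence both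
  characters of the plane have the sign \<open>- s\<close>, their eigenvalues are neighbours of
  \<open>l3\<close>, and rescaling the two axes turns \<open>v1\<close> and \<open>v2\<close> into
  1.\<close>

lemma triangular_normal_form_i:
  assumes m: "modular_pair (mat3 a1 0 v1 0 a2 v2 0 0 s) (mat3 l1 0 0 0 l2 0 0 0 l3)"
    and nd: "\<not> decomposable_pair (mat3 a1 0 v1 0 a2 v2 0 0 s) (mat3 l1 0 0 0 l2 0 0 0 l3)"
  shows "l3^6 = 1 \<and> simconj (mat3 a1 0 v1 0 a2 v2 0 0 s) (mat3 l1 0 0 0 l2 0 0 0 l3)
    (mat3 (- (l3^3)) 0 1 0 (- (l3^3)) 1 0 0 (l3^3)) (mat3 (\<omega>6 * l3) 0 0 0 ((1 - \<omega>6) * l3) 0 0 0 l3)"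
proof -
  note r = m[unfolded modular_pair_triangular]
  have v: "v1 \<noteq> 0" "v2 \<noteq> 0" using nd decomposable_mat3_1 decomposable_mat3_2 by auto
  then have a: "a1 = - s" "a2 = - s" using r by (auto simp: add_eq_0_iff2)
  note s = involution_cube[of s l3]
  have "l1 \<noteq> l2"
  proof
    assume e: "l1 = l2"
    \<comment> \<open>With equal eigenvalues both matrices are scalar on the plane, so
      \<open>(v1, v2)\<close> may serve as its second basis vector; the first axis then splits
      off.\<close>
    have "simconj (mat3 a1 0 v1 0 a2 v2 0 0 s) (mat3 l1 0 0 0 l2 0 0 0 l3)
       (mat3 (- s) 0 0 0 (- s) 1 0 0 s) (mat3 l1 0 0 0 l2 0 0 0 l3)"
      by (rule simconjI[of "mat3 1 v1 0 0 v2 0 0 0 1"]) (simp_all add: a e v det_mat3 mult.commute)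
    then show False
      using nd decomposable_mat3_1 decomposable_pair_simconj simconj_sym by blast
  qed
  have sq: "s * s = 1" using r by (simp add: power2_eq_square)
  have "l1\<^sup>2 - l1 * l3 + l3\<^sup>2 = 0" "l2\<^sup>2 - l2 * l3 + l3\<^sup>2 = 0"
  proof -
    have "l3 \<noteq> 0" using s r by auto
    moreover have "(- s * l)\<^sup>2 + (- s * l) * (s * l3) + (s * l3)\<^sup>2 = s * s * (l\<^sup>2 - l * l3 + l3\<^sup>2)" for l
      by (simp add: power2_eq_square algebra_simps)
    ultimately show "l1\<^sup>2 - l1 * l3 + l3\<^sup>2 = 0" "l2\<^sup>2 - l2 * l3 + l3\<^sup>2 = 0"
      using r v unfolding a sq by auto
  qed
  then consider "l1 = \<omega>6 * l3" "l2 = (1 - \<omega>6) * l3" | "l2 = \<omega>6 * l3" "l1 = (1 - \<omega>6) * l3"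
    using neighboursI[of l1 l3 l2] \<open>l1 \<noteq> l2\<close> unfolding neighbours_def by auto
  then have "simconj (mat3 a1 0 v1 0 a2 v2 0 0 s) (mat3 l1 0 0 0 l2 0 0 0 l3)
    (mat3 (- s) 0 1 0 (- s) 1 0 0 s) (mat3 (\<omega>6 * l3) 0 0 0 ((1 - \<omega>6) * l3) 0 0 0 l3)"
  proof cases
    case 1
    show ?thesis
      by (rule simconjI[of "mat3 v1 0 0 0 v2 0 0 0 1"]) (simp_all add: 1 a v det_mat3 ac_simps)
  next
    case 2
    show ?thesis
      \<comment> \<open>The base change also exchanges the first two axes.\<close>
      by (rule simconjI[of "mat3 0 v1 0 v2 0 0 0 0 1"]) (simp_all add: 2 a v det_mat3 ac_simps)
  qed
  then show ?thesis using s r by simp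
qed

text \<open>As \<open>c\<close> is nonzero, the plane carries both signs, and \<open>s\<close>
  agrees with one of them. If \<open>s = a2\<close>, then \<open>v2 = 0\<close> and the first form
  results. If \<open>s = a1\<close>, the relation \<open>2 * s * v1 + c * v2 = 0\<close> makes both
  \<open>v1\<close> and \<open>v2\<close> nonzero; scaling them to 1 leaves
  \<open>c = -2 * s\<close>, the origin of that entry.\<close>

lemma triangular_normal_form_ii:
  assumes m: "modular_pair (mat3 a1 c v1 0 a2 v2 0 0 s) (mat3 l1 0 0 0 l2 0 0 0 l3)"
    and nd: "\<not> decomposable_pair (mat3 a1 c v1 0 a2 v2 0 0 s) (mat3 l1 0 0 0 l2 0 0 0 l3)"
    and c: "c \<noteq> 0" "l1 \<noteq> l2"
  shows "l1^6 = 1 \<and> neighbours l1 l2 l3 \<and>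
      simconj (mat3 a1 c v1 0 a2 v2 0 0 s) (mat3 l1 0 0 0 l2 0 0 0 l3)
       (mat3 (- (l2^3)) 1 1 0 (l2^3) 0 0 0 (l2^3)) (mat3 l1 0 0 0 l2 0 0 0 l3) \<or>
    l2^6 = 1 \<and> neighbours l2 l1 l3 \<and>
      simconj (mat3 a1 c v1 0 a2 v2 0 0 s) (mat3 l1 0 0 0 l2 0 0 0 l3)
       (mat3 (l1^3) (-2 * l1^3) 1 0 (- (l1^3)) 1 0 0 (l1^3)) (mat3 l1 0 0 0 l2 0 0 0 l3)"
proof -
  note r = m[unfolded modular_pair_triangular]
  have a1: "a1 = - a2" using r c by (auto simp: add_eq_0_iff2)
  note s1 = involution_cube[of a1 l1] and s2 = involution_cube[of a2 l2] and s3 = involution_cube[of s l3]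
  have l: "l1 \<noteq> 0" "l2 \<noteq> 0" "l3 \<noteq> 0" "a2 \<noteq> 0" using s1 s2 s3 r by auto
  have v: "v1 \<noteq> 0 \<or> v2 \<noteq> 0" using nd decomposable_mat3_3 by auto
  have sq: "s * s = 1" "a2 * a2 = 1" using r by (auto simp: power2_eq_square)
  then have "(s - a2) * (s + a2) = 0" by (simp add: algebra_simps)
  then consider "a2 = s" | "a2 = - s" by (auto simp: add_eq_0_iff2)
  then show ?thesis
  proof cases
    case 1
    have v2: "v2 = 0" using r l 1 by auto
    then have v1: "v1 \<noteq> 0" using v by auto
    have "l2 \<noteq> l3"
    proof
      assume e: "l2 = l3"
      \<comment> \<open>The vector \<open>(0, v1, - c)\<close> is an eigenvector of both matrices
        when \<open>l2 = l3\<close>, and it splits off.\<close>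
      have "simconj (mat3 a1 c v1 0 a2 v2 0 0 s) (mat3 l1 0 0 0 l2 0 0 0 l3)
         (mat3 (- s) c 0 0 s 0 0 0 s) (mat3 l1 0 0 0 l2 0 0 0 l3)"
        by (rule simconjI[of "mat3 1 0 0 0 1 v1 0 0 (- c)"]) (simp_all add: a1 1 v2 e c det_mat3 mult.commute)
      then show False
        using nd decomposable_mat3_3 decomposable_pair_simconj simconj_sym by blast
    qed
    have "(- s * l1)\<^sup>2 + (- s * l1) * (s * l) + (s * l)\<^sup>2 = s * s * (l\<^sup>2 - l * l1 + l1\<^sup>2)" for l
      by (simp add: power2_eq_square algebra_simps)
    then have "l2\<^sup>2 - l2 * l1 + l1\<^sup>2 = 0" "l3\<^sup>2 - l3 * l1 + l1\<^sup>2 = 0"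
      using r c v1 l unfolding a1 1 v2 sq by auto
    then have "neighbours l1 l2 l3" using neighboursI \<open>l2 \<noteq> l3\<close> by blast
    moreover have "simconj (mat3 a1 c v1 0 a2 v2 0 0 s) (mat3 l1 0 0 0 l2 0 0 0 l3)
       (mat3 (- s) 1 1 0 s 0 0 0 s) (mat3 l1 0 0 0 l2 0 0 0 l3)"
      by (rule simconjI[of "mat3 1 0 0 0 (1/c) 0 0 0 (1/v1)"]) (simp_all add: a1 1 v2 v1 c det_mat3)
    ultimately show ?thesis using s1 s2 r 1 by simp
  next
    case 2
    have e1: "2 * s * v1 + c * v2 = 0" using r unfolding a1 2 by (simp add: algebra_simps)
    then have v: "v1 \<noteq> 0" "v2 \<noteq> 0" using v c l 2 by auto
    have "(s * l)\<^sup>2 + (s * l) * (- s * l2) + (- s * l2)\<^sup>2 = s * s * (l\<^sup>2 - l * l2 + l2\<^sup>2)"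
      "(- s * l2)\<^sup>2 + (- s * l2) * (s * l) + (s * l)\<^sup>2 = s * s * (l\<^sup>2 - l * l2 + l2\<^sup>2)" for l
      by (simp_all add: power2_eq_square algebra_simps)
    then have q: "l1\<^sup>2 - l1 * l2 + l2\<^sup>2 = 0" "l3\<^sup>2 - l3 * l2 + l2\<^sup>2 = 0"
      using r c v l unfolding a1 2 sq by auto
    have "l1 \<noteq> l3"
    proof
      assume e: "l1 = l3"
      \<comment> \<open>The \<open>(1,3)\<close> entry of the cube. With \<open>l1 = l3\<close> and
        \<open>c * v2 = - 2 * s * v1\<close> it becomes a quadratic relation between
        \<open>l1\<close> and \<open>l2\<close>; subtracting twice the neighbour relation leaves
        \<open>l1 = 2 * l2\<close>, which the latter excludes.\<close>
      have "v1 * l3 * ((s*l1)\<^sup>2 + (s*l1)*(s*l3) + (s*l3)\<^sup>2) + c*l2 * (v2*l3) * (s*l1 - s*l2 + s*l3) = 0"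
        using r unfolding a1 2 by simp
      then have "v1 * l1 * (3 * l1\<^sup>2) * (s * s) + (c * v2) * (l2 * l1 * s) * (2 * l1 - l2) = 0"
        unfolding e by (simp add: power2_eq_square algebra_simps)
      moreover have "c * v2 = - 2 * s * v1" using e1 by (simp add: add_eq_0_iff2)
      ultimately have "v1 * l1 * (s * s) * (3 * l1\<^sup>2 - 4 * l1 * l2 + 2 * l2\<^sup>2) = 0"
        by (simp add: power2_eq_square algebra_simps)
      then have "3 * l1\<^sup>2 - 4 * l1 * l2 + 2 * l2\<^sup>2 = 0" using v l sq by simp
      then have "l1\<^sup>2 - 2 * l1 * l2 = 0" using q(1) by algebra
      then have "l1 = 2 * l2" using l by (simp add: power2_eq_square algebra_simps)
      then show False using q(1) l by (simp add: power2_eq_square algebra_simps)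
    qed
    then have "neighbours l2 l1 l3" using neighboursI q by blast
    moreover have "c * v2 = - 2 * s * v1" using e1 by (simp add: add_eq_0_iff2)
    then have "simconj (mat3 a1 c v1 0 a2 v2 0 0 s) (mat3 l1 0 0 0 l2 0 0 0 l3)
       (mat3 s (-2 * s) 1 0 (- s) 1 0 0 s) (mat3 l1 0 0 0 l2 0 0 0 l3)"
      by (intro simconjI[of "mat3 v1 0 0 0 v2 0 0 0 1"])
         (simp_all add: a1 2 v det_mat3 mat3_eq_iff algebra_simps)
    moreover have "l1 ^ 3 = s" "l2^6 = 1" using s1 s2 r a1 2 by auto
    ultimately show ?thesis by simp
  qed
qed

text \<open>\<open>W\<close> is a line: a vector independent of \<open>w\<close> would make it
  everything. Completing \<open>w\<close> to a basis makes both matrices triangular.\<close>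

lemma reducible_pair_triangular:
  fixes A B :: "complex^2^2"
  assumes "reducible_pair A B"
  shows "\<exists>a1 c a2 l1 b l2. simconj A B (mat2 a1 c 0 a2) (mat2 l1 b 0 l2)"
proof -
  obtain W where W: "invariant_pair A B W" "W \<noteq> {0}" "W \<noteq> UNIV"
    using assms unfolding reducible_pair_def by blast
  have sub: "vec.subspace W" using W unfolding invariant_pair_def by blast
  then have "0 \<in> W" by (rule vec.subspace_0)
  then obtain w where w: "w \<in> W" "w \<noteq> 0" using W(2) by blast
  have det0: "w$1 * u$2 - w$2 * u$1 = 0" if u: "u \<in> W" for u
  proof (rule ccontr)
    assume d: "\<not> ?thesis"
    have "x \<in> W" for x
    proof -
      let ?d = "w$1 * u$2 - w$2 * u$1"
      have "x = ((x$1 * u$2 - x$2 * u$1) / ?d) *s w + ((w$1 * x$2 - w$2 * x$1) / ?d) *s u"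
        using d by (simp add: vec_eq_iff forall_2 divide_simps) (simp add: algebra_simps)
      then show ?thesis using sub u w(1) by (metis vec.subspace_add vec.subspace_scale)
    qed
    then show False using W(3) by blast
  qed
  obtain z :: "complex^2" where z: "w$1 * z$2 - w$2 * z$1 \<noteq> 0"
  proof (cases "w$1 = 0")
    case True
    then have "w$2 \<noteq> 0" using w(2) by (simp add: vec_eq_iff forall_2)
    then show ?thesis using True that[of "vector [1, 0]"] by simp
  next
    case False
    then show ?thesis using that[of "vector [0, 1]"] by simp
  qed
  define R where "R = mat2 (w$1) (z$1) (w$2) (z$2)"
  have R: "invertible R" using z by (simp add: R_def invertible_det_nz mult.commute)
  \<comment> \<open>The adjugate of \<open>R\<close>; the lower left entry of
    \<open>R' ** M ** R\<close> is the determinant of \<open>w\<close> and \<open>M *v w\<close>,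
    which vanishes on the line.\<close>
  define R' where "R' = mat2 (z$2) (- z$1) (- w$2) (w$1)"
  have "(matrix_inv R ** M ** R) $ 2 $ 1 = 0" if M: "M *v w \<in> W" for M
  proof -
    let ?d = "w$1 * z$2 - w$2 * z$1"
    have "R' ** R = mat2 ?d 0 0 ?d" by (simp add: R_def R'_def mat2_eq_iff algebra_simps)
    then have "R' ** R ** (matrix_inv R ** M ** R) = mat2 ?d 0 0 ?d ** (matrix_inv R ** M ** R)"
      by simp
    moreover have "R' ** R ** (matrix_inv R ** M ** R) = R' ** (R ** matrix_inv R) ** M ** R"
      by (simp only: matrix_mul_assoc)
    ultimately have "R' ** M ** R = mat2 ?d 0 0 ?d ** (matrix_inv R ** M ** R)"
      using invertible_matrix_inv[OF R] by simp
    then have "(R' ** M ** R) $ 2 $ 1 = ?d * (matrix_inv R ** M ** R) $ 2 $ 1"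
      by (simp add: matrix_matrix_mult_def sum_2)
    moreover have "(R' ** M ** R) $ 2 $ 1 = w$1 * (M *v w)$2 - w$2 * (M *v w)$1"
      by (simp add: R_def R'_def matrix_matrix_mult_def matrix_vector_mult_def sum_2 algebra_simps)
    ultimately show ?thesis using det0[OF M] z by simp
  qed
  then have "(matrix_inv R ** A ** R) $ 2 $ 1 = 0" "(matrix_inv R ** B ** R) $ 2 $ 1 = 0"
    using W(1) w(1) unfolding invariant_pair_def by blast+
  then obtain a1 c a2 l1 b l2 where
    "matrix_inv R ** A ** R = mat2 a1 c 0 a2" "matrix_inv R ** B ** R = mat2 l1 b 0 l2"
    by (metis mat2_cases mat2_nth(3))
  moreover have "R ** (matrix_inv R ** M ** R) = M ** R" for M
    using invertible_matrix_inv[OF R] by (simp add: matrix_mul_assoc)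
  ultimately have "A ** R = R ** mat2 a1 c 0 a2" "B ** R = R ** mat2 l1 b 0 l2" by metis+
  then show ?thesis using simconjI R invertible_det_nz by blast
qed

text \<open>A diagonalizable matrix has no Jordan blocks: the kernels of \<open>(B - l)^2\<close>
  and \<open>B - l\<close> coincide.\<close>

lemma diagonalizable_ker:
  assumes B: "diagonalizable B" and x: "B *v (B *v x - l *s x) = l *s (B *v x - l *s x)"
  shows "B *v x = l *s x"
proof -
  obtain P D :: "complex^'a^'a" where P: "invertible P" "\<forall>i j. i \<noteq> j \<longrightarrow> D$i$j = 0" "B = P ** D ** matrix_inv P"
    using B unfolding diagonalizable_def by blast
  note i = invertible_matrix_inv[OF P(1)]
  define y where "y = matrix_inv P *v x"
  have xy: "x = P *v y" unfolding y_def by (simp add: matrix_vector_mul_assoc i)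
  have BP: "B *v (P *v z) = P *v (D *v z)" for z
    unfolding P(3) using i by (simp add: matrix_vector_mul_assoc flip: matrix_mul_assoc)
  have D: "(D *v z) $ k = D$k$k * z$k" for z k
  proof -
    have "(\<Sum>j\<in>UNIV. D$k$j * z$j) = (\<Sum>j\<in>UNIV. if j = k then D$k$k * z$k else 0)"
      by (intro sum.cong) (use P(2) in auto)
    then show ?thesis by (simp add: matrix_vector_mult_def)
  qed
  have sc: "P *v u - P *v z = P *v (u - z)" for u z
    by (simp add: matrix_vector_mult_diff_distrib)
  have sc': "l *s (P *v z) = P *v (l *s z)" for z by (simp add: vec.scale)
  have "P *v (D *v (D *v y - l *s y)) = P *v (l *s (D *v y - l *s y))"
    using x unfolding xy BP sc sc' .
  then have "matrix_inv P *v (P *v (D *v (D *v y - l *s y))) = matrix_inv P *v (P *v (l *s (D *v y - l *s y)))"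
    by simp
  moreover have "matrix_inv P *v (P *v z) = z" for z by (simp add: matrix_vector_mul_assoc i)
  ultimately have "D *v (D *v y - l *s y) = l *s (D *v y - l *s y)" by (simp only:)
  then have "D$k$k * (D$k$k * y$k - l * y$k) = l * (D$k$k * y$k - l * y$k)" for k
    unfolding vec_eq_iff by (simp add: D right_diff_distrib)
  then have "(D$k$k - l) * ((D$k$k - l) * y$k) = 0" for k by (simp add: algebra_simps)
  then have "D *v y = l *s y" by (auto simp: vec_eq_iff D)
  then show ?thesis unfolding xy BP by (simp add: vec.scale)
qed

text \<open>The plane inherits diagonalizability from \<open>B\<close>: for \<open>l1 = l2\<close> a
  nonzero \<open>b\<close> would give a Jordan block inside \<open>B\<close>, and for
  \<open>l1 \<noteq> l2\<close> a shear removes \<open>b\<close>. Indecomposability of the plane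
  then rules out \<open>c = 0\<close> and \<open>l1 = l2\<close>.\<close>

lemma sub_pair_triangular_diagonal:
  fixes A B :: "complex^3^3" and A0 B0 :: "complex^2^2"
  assumes sub: "sub_pair A B A0 B0" and d: "diagonalizable B" and m: "modular_pair A0 B0"
    and red: "reducible_pair A0 B0" and nd: "\<not> decomposable_pair A0 B0"
  obtains a1 c a2 l1 l2 where "sub_pair A B (mat2 a1 c 0 a2) (mat2 l1 0 0 l2)" "c \<noteq> 0" "l1 \<noteq> l2"
proof -
  obtain a1 c a2 l1 b l2 where s1: "simconj A0 B0 (mat2 a1 c 0 a2) (mat2 l1 b 0 l2)"
    using reducible_pair_triangular[OF red] by blast
  note r = modular_pair_triangular2[OF modular_pair_simconj[OF m s1]]
  obtain J where J: "inj ((*v) J)" "B ** J = J ** mat2 l1 b 0 l2"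
    using sub_pair_simconj[OF sub s1] unfolding sub_pair_def by blast
  have b: "b = 0" if "l1 = l2"
  proof -
    let ?e = "vector [0, 1] :: complex^2"
    let ?M = "mat2 l1 b 0 l2"
    have BJ: "B *v (J *v u) = J *v (?M *v u)" for u by (simp add: matrix_vector_mul_assoc J(2))
    have sc: "J *v u - J *v z = J *v (u - z)" for u z
      by (simp add: matrix_vector_mult_diff_distrib)
    have sc': "l1 *s (J *v z) = J *v (l1 *s z)" for z by (simp add: vec.scale)
    have M: "?M *v (?M *v ?e - l1 *s ?e) = l1 *s (?M *v ?e - l1 *s ?e)"
      by (simp add: vec_eq_iff forall_2 matrix_vector_mult_def sum_2 that)
    have "B *v (B *v (J *v ?e) - l1 *s (J *v ?e)) = l1 *s (B *v (J *v ?e) - l1 *s (J *v ?e))"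
      unfolding BJ sc' sc M ..
    from diagonalizable_ker[OF d this] have "J *v (?M *v ?e) = J *v (l1 *s ?e)"
      unfolding BJ by (simp add: vec.scale)
    then have "?M *v ?e = l1 *s ?e" using J(1) unfolding inj_def by blast
    then show "b = 0" by (simp add: vec_eq_iff forall_2 matrix_vector_mult_def sum_2)
  qed
  obtain t where t: "(l2 - l1) * t = b"
  proof (cases "l1 = l2")
    case True
    then show ?thesis using b that[of 0] by simp
  next
    case False
    then show ?thesis using that[of "b / (l2 - l1)"] by simp
  qed
  define c' where "c' = c + a1 * t - a2 * t"
  have s2: "simconj (mat2 a1 c 0 a2) (mat2 l1 b 0 l2) (mat2 a1 c' 0 a2) (mat2 l1 0 0 l2)"
    using t by (intro simconjI[of "mat2 1 t 0 1"]) (auto simp: c'_def mat2_eq_iff algebra_simps)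
  have s3: "simconj A0 B0 (mat2 a1 c' 0 a2) (mat2 l1 0 0 l2)" using s1 s2 simconj_trans by blast
  have dec: "decomposable_pair (mat2 a 0 0 b) (mat2 l 0 0 l')" for a b l l' :: complex
  proof (rule decomposable_pair_index[of 1])
    show "\<exists>j. j \<noteq> (1::2)" by (rule exI[of _ 2]) simp
  qed (use exhaust_2 in force)
  have "c' \<noteq> 0" using dec nd s3 decomposable_pair_simconj simconj_sym by metis
  moreover have "l1 \<noteq> l2"
  proof
    assume e: "l1 = l2"
    have "c' * (a1 + a2) = 0" using modular_pair_triangular2[OF modular_pair_simconj[OF m s3]] by blast
    then have a2: "a2 = - a1" using \<open>c' \<noteq> 0\<close> by (simp add: add_eq_0_iff)
    have a1: "a1 \<noteq> 0" using r by auto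
    \<comment> \<open>\<open>B\<close> is scalar here, so any base change preserves it; the
      involution has the distinct eigenvalues \<open>a1\<close> and \<open>- a1\<close>, and a shear
      diagonalizes it.\<close>
    have "simconj (mat2 a1 c' 0 a2) (mat2 l1 0 0 l2) (mat2 a1 0 0 a2) (mat2 l1 0 0 l2)"
      using a1 by (intro simconjI[of "mat2 1 (- c' / (2 * a1)) 0 1"]) (auto simp: e a2 mat2_eq_iff)
    then show False using dec nd s3 decomposable_pair_simconj simconj_sym by metis
  qed
  ultimately show ?thesis using that[of a1 c' a2 l1 l2] sub_pair_simconj[OF sub s3] by blast
qed

section \<open>Extensions of reducible planes\<close>

definition ind_i :: "(nat \<times> nat \<times> nat) set" where
  "ind_i = {(1,5,0), (2,0,1), (3,1,2), (4,2,3), (5,3,4), (0,4,5)}"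

definition ind_iia :: "(nat \<times> nat \<times> nat) set" where
  "ind_iia = {(1,2,0), (5,4,0), (2,3,1), (0,5,1), (3,4,2), (4,5,3)}"

definition ind_iib :: "(nat \<times> nat \<times> nat) set" where
  "ind_iib = {(5,0,1), (1,0,5), (0,1,2), (2,1,0), (1,2,3), (3,2,1),
     (2,3,4), (4,3,2), (3,4,5), (5,4,3), (4,5,0), (0,5,4)}"

lemmas ind_defs = ind_i_def ind_iia_def ind_iib_def

lemma pair_i_mat3: "pair_i (x1, x2, x3) =
    (mat3 (- (ev x3 ^ 3)) 0 1 0 (- (ev x3 ^ 3)) 1 0 0 (ev x3 ^ 3), mat3 (ev x1) 0 0 0 (ev x2) 0 0 0 (ev x3))"
  by (simp add: Let_def mat3_def diag3_def)

lemma pair_iia_mat3: "pair_iia (x1, x2, x3) =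
    (mat3 (- (ev x2 ^ 3)) 1 1 0 (ev x2 ^ 3) 0 0 0 (ev x2 ^ 3), mat3 (ev x1) 0 0 0 (ev x2) 0 0 0 (ev x3))"
  by (simp add: Let_def mat3_def diag3_def)

lemma pair_iib_mat3: "pair_iib (x1, x2, x3) =
    (mat3 (ev x1 ^ 3) (- 2 * ev x1 ^ 3) 1 0 (- (ev x1 ^ 3)) 1 0 0 (ev x1 ^ 3),
     mat3 (ev x1) 0 0 0 (ev x2) 0 0 0 (ev x3))"
  by (simp add: Let_def mat3_def diag3_def)

declare pair_i.simps [simp del] pair_iia.simps [simp del] pair_iib.simps [simp del]

lemma ev_sixth: "ev x ^ 6 = 1"
proof -
  have "\<omega>6 ^ 6 = 1" by (simp add: eval_nat_numeral algebra_simps)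
  moreover have "(\<omega>6 ^ x) ^ 6 = (\<omega>6 ^ 6) ^ x" by (simp only: power_mult[symmetric] mult.commute)
  ultimately show ?thesis unfolding ev_power by simp
qed

lemma ind_lt: "(x1, x2, x3) \<in> ind_i \<union> ind_iia \<union> ind_iib \<Longrightarrow> x1 < 6 \<and> x2 < 6 \<and> x3 < 6"
  unfolding ind_defs by auto

lemma ind_i_neighbours: "(x1, x2, x3) \<in> ind_i \<Longrightarrow> neighbours (ev x3) (ev x1) (ev x2)"
  unfolding ind_i_def neighbours_def by (auto simp: ev_simps algebra_simps)

lemma ind_iia_neighbours: "(x1, x2, x3) \<in> ind_iia \<Longrightarrow> neighbours (ev x1) (ev x2) (ev x3)"
  unfolding ind_iia_def neighbours_def by (auto simp: ev_simps algebra_simps)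

lemma ind_iib_neighbours: "(x1, x2, x3) \<in> ind_iib \<Longrightarrow> neighbours (ev x2) (ev x1) (ev x3)"
  unfolding ind_iib_def neighbours_def by (auto simp: ev_simps algebra_simps)

lemma ev_mod: "ev (n mod 6) = ev n"
proof -
  have "ev n = (\<omega>6 ^ 6) ^ (n div 6) * \<omega>6 ^ (n mod 6)"
    unfolding ev_power by (simp flip: power_mult power_add)
  then show ?thesis using ev_sixth[of 1] by (simp add: ev_power)
qed

lemma \<omega>6_ev: "\<omega>6 * ev x = ev ((x + 1) mod 6)" "(1 - \<omega>6) * ev x = ev ((x + 5) mod 6)"
proof -
  have "\<omega>6 ^ 5 = 1 - \<omega>6" using ev_simps(7) by (simp add: ev_power)
  then show "\<omega>6 * ev x = ev ((x + 1) mod 6)" "(1 - \<omega>6) * ev x = ev ((x + 5) mod 6)"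
    unfolding ev_mod by (simp_all add: ev_power power_add)
qed

lemma less_6_cases:
  fixes x :: nat
  assumes "x < 6"
  obtains "x = 0" | "x = 1" | "x = 2" | "x = 3" | "x = 4" | "x = 5"
  using assms by linarith

text \<open>\<open>ind_iia\<close> contains only one order of the two neighbours, because exchanging
  the last two axes is an equivalence there; \<open>ind_iib\<close> contains both orders.\<close>

lemma ind_mem:
  assumes "x < 6"
  shows "((x + 1) mod 6, (x + 5) mod 6, x) \<in> ind_i"
    "(x, (x + 1) mod 6, (x + 5) mod 6) \<in> ind_iia \<or> (x, (x + 5) mod 6, (x + 1) mod 6) \<in> ind_iia"
    "((x + 1) mod 6, x, (x + 5) mod 6) \<in> ind_iib" "((x + 5) mod 6, x, (x + 1) mod 6) \<in> ind_iib"
  unfolding ind_defs by (rule less_6_cases[OF assms]; simp)+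

lemma ind_i_cover:
  assumes "l ^ 6 = 1"
  obtains x1 x2 x3 where "(x1, x2, x3) \<in> ind_i" "l = ev x3" "\<omega>6 * l = ev x1" "(1 - \<omega>6) * l = ev x2"
  by (rule sixth_root_ev[OF assms]) (use that ind_mem(1) \<omega>6_ev in blast)

lemma ind_iia_cover:
  assumes "l ^ 6 = 1" "neighbours l a b"
  obtains x1 x2 x3 where "(x1, x2, x3) \<in> ind_iia" "l = ev x1" "a = ev x2 \<and> b = ev x3 \<or> a = ev x3 \<and> b = ev x2"
proof (rule sixth_root_ev[OF assms(1)])
  fix x assume x: "x < 6" "l = ev x"
  have "a = ev ((x + 1) mod 6) \<and> b = ev ((x + 5) mod 6) \<or> b = ev ((x + 1) mod 6) \<and> a = ev ((x + 5) mod 6)"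
    using assms(2) unfolding neighbours_def x(2) \<omega>6_ev by blast
  then show ?thesis using that x(2) ind_mem(2)[OF x(1)] by blast
qed

lemma ind_iib_cover:
  assumes "l ^ 6 = 1" "neighbours l a b"
  obtains x1 x2 x3 where "(x1, x2, x3) \<in> ind_iib" "l = ev x2" "a = ev x1" "b = ev x3"
proof (rule sixth_root_ev[OF assms(1)])
  fix x assume x: "x < 6" "l = ev x"
  have "a = ev ((x + 1) mod 6) \<and> b = ev ((x + 5) mod 6) \<or> b = ev ((x + 1) mod 6) \<and> a = ev ((x + 5) mod 6)"
    using assms(2) unfolding neighbours_def x(2) \<omega>6_ev by blast
  then show ?thesis using that x(2) ind_mem(3,4)[OF x(1)] by blast
qed

text \<open>Diagonal form spreads from the generators to the whole group, so the diagonal entries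
  are the two characters.\<close>

lemma sum_of_two_charactersI:
  assumes \<rho>: "is_rep \<rho>0" "\<rho>0 elt_S = mat2 a 0 0 b" "\<rho>0 elt_T = mat2 c 0 0 d"
  shows "sum_of_two_characters \<rho>0"
proof -
  have diag: "\<rho>0 g $1$2 = 0 \<and> \<rho>0 g $2$1 = 0" if "g \<in> carrier PSL2Z" for g
    using that
  proof (induction rule: PSL2Z_induct)
    case one
    then show ?case by (simp add: rep_one[OF \<rho>(1)] mat2_one)
  next
    case (S g)
    then show ?case using elt_ST_carrier
      by (simp add: rep_mult[OF \<rho>(1)] \<rho>(2) matrix_matrix_mult_def sum_2)
  next
    case (T g)
    then show ?case using elt_ST_carrier
      by (simp add: rep_mult[OF \<rho>(1)] \<rho>(3) matrix_matrix_mult_def sum_2)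
  qed
  have "\<rho>0 g $1$1 \<noteq> 0 \<and> \<rho>0 g $2$2 \<noteq> 0" if "g \<in> carrier PSL2Z" for g
    using rep_invertible[OF \<rho>(1) that] diag[OF that] by (auto simp: invertible_det_nz det_2)
  then have "is_character (\<lambda>g. \<rho>0 g $1$1)" "is_character (\<lambda>g. \<rho>0 g $2$2)"
    unfolding is_character_def hom_def
    by (auto simp: rep_mult[OF \<rho>(1)] matrix_matrix_mult_def sum_2 diag)
  moreover have "equivalent \<rho>0 (\<lambda>g. diag2 (\<rho>0 g $1$1) (\<rho>0 g $2$2))"
    unfolding equivalent_def
  proof (intro exI[of _ "mat 1"] conjI ballI)
    show i: "invertible (mat 1 :: complex^2^2)" unfolding invertible_def by auto
    show "diag2 (\<rho>0 g $1$1) (\<rho>0 g $2$2) = mat 1 ** \<rho>0 g ** matrix_inv (mat 1)"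
      if "g \<in> carrier PSL2Z" for g
      unfolding conj_matrix_iff[OF i] using diag[OF that] by (simp add: diag2_mat2 mat2_eq_iff)
  qed
  ultimately show ?thesis unfolding sum_of_two_characters_def by blast
qed

lemma reducible_pair_mat2: "reducible_pair (mat2 a c 0 b) (mat2 l1 m 0 l2)"
proof -
  let ?W = "{x :: complex^2. x$2 = 0}"
  have "invariant_pair (mat2 a c 0 b) (mat2 l1 m 0 l2) ?W"
    unfolding invariant_pair_def vec.subspace_def by (simp add: matrix_vector_mult_def sum_2)
  moreover have "axis 1 1 \<in> ?W" "axis 1 (1::complex) \<noteq> 0" "axis 2 1 \<notin> ?W"
    by (simp_all add: axis_def vec_eq_iff)
  then have "?W \<noteq> {0}" "?W \<noteq> UNIV" by blast+
  ultimately show ?thesis unfolding reducible_pair_def by blast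
qed

lemma mat3_blk: "mat3 a b c d e f 0 0 g = blk (mat2 a b d e) (vector [c, f]) g"
  by (simp add: blk_mat2)

lemma ext_reps_mat3I:
  assumes "modular_pair (mat3 a b c d e f 0 0 g) (mat3 l1 0 0 0 l2 0 0 0 l3)"
    and "c \<noteq> 0" "b \<noteq> 0 \<or> f \<noteq> 0" "l1 \<noteq> l2" "l1 \<noteq> l3" "l2 \<noteq> l3"
    and "\<And>\<rho>0. is_rep \<rho>0 \<Longrightarrow> \<rho>0 elt_S = mat2 a b d e \<Longrightarrow> \<rho>0 elt_T = mat2 l1 0 0 l2 \<Longrightarrow> Q \<rho>0"
  shows "\<exists>\<rho>\<in>ext_reps Q. \<rho> elt_S = mat3 a b c d e f 0 0 g \<and> \<rho> elt_T = mat3 l1 0 0 0 l2 0 0 0 l3"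
proof -
  have "\<not> decomposable_pair (mat3 a b c d e f 0 0 g) (mat3 l1 0 0 0 l2 0 0 0 l3)"
    using indecomposable_mat3[of "mat3 a b c d e f 0 0 g", OF _ _ assms(4-6)] assms(2,3) by simp
  from assms(1) this diagonalizable_mat3[of l1 l2 l3] assms(7) show ?thesis
    unfolding mat3_blk by (rule ext_repsI)
qed

lemma represented_by_i:
  "represented_by (ext_reps sum_of_two_characters) (pair_i ` ind_i)"
proof (rule represented_byI)
  fix A B assume "(A, B) \<in> pair_i ` ind_i"
  then obtain x1 x2 x3 where x: "(x1, x2, x3) \<in> ind_i" "(A, B) = pair_i (x1, x2, x3)" by auto
  define l s where "l = ev x3" and "s = l^3"
  note l = ev_sixth[of x3, folded l_def]
  note nb = ind_i_neighbours[OF x(1), folded l_def]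
  note r = neighbours_relations[OF nb l] and sl = sixth_root_cube[OF l, folded s_def]
  note nd = neighbours_distinct[OF nb sl(3)]
  have "(- s * ev x1)^3 = 1" "(- s * ev x2)^3 = 1"
    using sixth_root_cube(2)[OF r(7)] sixth_root_cube(2)[OF r(8)] r(3,4) by (simp_all add: s_def)
  \<comment> \<open>For opposite signs the divided difference of \<open>x^3\<close> becomes the
    neighbour relation.\<close>
  moreover have "(- s * a)\<^sup>2 + (- s * a) * (s * l) + (s * l)\<^sup>2 = s\<^sup>2 * (a\<^sup>2 - a * l + l\<^sup>2)" for a
    by (simp add: power2_eq_square algebra_simps)
  ultimately have mp: "modular_pair (mat3 (- s) 0 1 0 (- s) 1 0 0 s) (mat3 (ev x1) 0 0 0 (ev x2) 0 0 0 l)"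
    unfolding modular_pair_triangular using r sl by simp
  have "\<exists>\<rho>\<in>ext_reps sum_of_two_characters. \<rho> elt_S = mat3 (- s) 0 1 0 (- s) 1 0 0 s \<and>
      \<rho> elt_T = mat3 (ev x1) 0 0 0 (ev x2) 0 0 0 l"
    by (rule ext_reps_mat3I[OF mp]; (erule (2) sum_of_two_charactersI)?) (use nd in auto)
  then show "\<exists>\<rho>\<in>ext_reps sum_of_two_characters. \<rho> elt_S = A \<and> \<rho> elt_T = B"
    using x(2) unfolding pair_i_mat3 l_def s_def by simp
next
  fix \<rho> assume "\<rho> \<in> ext_reps sum_of_two_characters"
  then obtain \<rho>0 where \<rho>: "is_rep \<rho>" "is_rep \<rho>0" "sum_of_two_characters \<rho>0"
    "modular_pair (\<rho> elt_S) (\<rho> elt_T)" "sub_pair (\<rho> elt_S) (\<rho> elt_T) (\<rho>0 elt_S) (\<rho>0 elt_T)"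
    "\<not> decomposable_pair (\<rho> elt_S) (\<rho> elt_T)" "diagonalizable (\<rho> elt_T)"
    by (rule ext_repsE)
  obtain \<eta> \<theta> where "equivalent \<rho>0 (\<lambda>g. diag2 (\<eta> g) (\<theta> g))"
    using \<rho>(3) unfolding sum_of_two_characters_def by blast
  then have "simconj (\<rho>0 elt_S) (\<rho>0 elt_T)
      (diag2 (\<eta> elt_S) (\<theta> elt_S)) (diag2 (\<eta> elt_T) (\<theta> elt_T))"
    unfolding equivalent_def simconj_def using elt_ST_carrier conj_matrix_iff by metis
  then obtain a1 a2 l1 l2 where "simconj (\<rho>0 elt_S) (\<rho>0 elt_T) (mat2 a1 0 0 a2) (mat2 l1 0 0 l2)"
    unfolding diag2_mat2 by blast
  from sub_pair_block[OF sub_pair_simconj[OF \<rho>(5) this] \<rho>(7)] obtain v :: "complex^2" and s l3 where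
    c: "simconj (\<rho> elt_S) (\<rho> elt_T) (mat3 a1 0 (v$1) 0 a2 (v$2) 0 0 s) (mat3 l1 0 0 0 l2 0 0 0 l3)"
    unfolding blk_mat2 by auto
  have "\<not> decomposable_pair (mat3 a1 0 (v$1) 0 a2 (v$2) 0 0 s) (mat3 l1 0 0 0 l2 0 0 0 l3)"
    using \<rho>(6) c decomposable_pair_simconj simconj_sym by blast
  from triangular_normal_form_i[OF modular_pair_simconj[OF \<rho>(4) c] this]
  have l: "l3^6 = 1" and "simconj (\<rho> elt_S) (\<rho> elt_T)
    (mat3 (- (l3^3)) 0 1 0 (- (l3^3)) 1 0 0 (l3^3)) (mat3 (\<omega>6 * l3) 0 0 0 ((1 - \<omega>6) * l3) 0 0 0 l3)"
    using simconj_trans[OF c] by blast+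
  moreover obtain x1 x2 x3 where x: "(x1, x2, x3) \<in> ind_i" "l3 = ev x3" "\<omega>6 * l3 = ev x1" "(1 - \<omega>6) * l3 = ev x2"
    by (rule ind_i_cover[OF l])
  ultimately show "\<exists>(A, B)\<in>pair_i ` ind_i. simconj (\<rho> elt_S) (\<rho> elt_T) A B"
    by (intro bexI[OF _ imageI[OF x(1)]]) (simp add: pair_i_mat3)
next
  fix A B A' B'
  assume "(A, B) \<in> pair_i ` ind_i" "(A', B') \<in> pair_i ` ind_i" and c: "simconj A B A' B'"
  then obtain x1 x2 x3 y1 y2 y3 where x: "(x1, x2, x3) \<in> ind_i" "(A, B) = pair_i (x1, x2, x3)"
    and y: "(y1, y2, y3) \<in> ind_i" "(A', B') = pair_i (y1, y2, y3)" by auto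
  \<comment> \<open>Common eigenvectors of the transposed pair are one-dimensional quotients. The
    only one here is \<open>\<rho>1\<close>; its value at \<open>T\<close> gives the third exponent,
    which determines the triple within \<open>ind_i\<close>.\<close>
  have E: "common_eigenvalues (transpose M) (transpose N) = {ev z3}"
    if "(z1, z2, z3) \<in> ind_i" "(M, N) = pair_i (z1, z2, z3)" for z1 z2 z3 M N
  proof -
    have "transpose N = mat3 (ev z1) 0 0 0 (ev z2) 0 0 0 (ev z3)"
      using that(2) by (simp add: pair_i_mat3 mat3_eq_iff transpose_def)
    moreover have "ev z3 \<noteq> 0" using ev_sixth[of z3] by auto
    moreover note neighbours_distinct[OF ind_i_neighbours[OF that(1)] this]
    ultimately show ?thesis
      using that(2) by (auto simp: common_eigenvalues_mat3 pair_i_mat3 transpose_def)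
  qed
  have "ev x3 = ev y3"
    using common_eigenvalues_simconj[OF simconj_transpose[OF c]] E[OF x] E[OF y] by simp
  then have "x3 = y3" using ev_inj ind_lt x(1) y(1) by blast
  then have "(x1, x2, x3) = (y1, y2, y3)" using x(1) y(1) unfolding ind_i_def by auto
  then show "(A, B) = (A', B')" using x y by simp
qed

lemma represented_by_ii:
  "represented_by (ext_reps (\<lambda>\<rho>0. reducible \<rho>0 \<and> indecomposable \<rho>0))
     (pair_iia ` ind_iia \<union> pair_iib ` ind_iib)"
  (is "represented_by (ext_reps ?Q) ?D")
proof (rule represented_byI)
  have Q: "?Q \<rho>0" if "is_rep \<rho>0" "\<rho>0 elt_S = mat2 a b 0 d" "\<rho>0 elt_T = mat2 l1 0 0 l2"
    "b \<noteq> 0" "l1 \<noteq> l2" for \<rho>0 a b d l1 l2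
    using that indecomposable_mat2 reducible_pair_mat2
    by (simp add: reducible_iff_pair decomposable_iff_pair)
  fix A B assume "(A, B) \<in> ?D"
  then consider x1 x2 x3 where "(x1, x2, x3) \<in> ind_iia" "(A, B) = pair_iia (x1, x2, x3)"
    | x1 x2 x3 where "(x1, x2, x3) \<in> ind_iib" "(A, B) = pair_iib (x1, x2, x3)" by auto
  then show "\<exists>\<rho>\<in>ext_reps ?Q. \<rho> elt_S = A \<and> \<rho> elt_T = B"
  proof cases
    case (1 x1 x2 x3)
    define l s where "l = ev x1" and "s = ev x2 ^ 3"
    note l = ev_sixth[of x1, folded l_def]
    note nb = ind_iia_neighbours[OF 1(1), folded l_def]
    note r = neighbours_relations[OF nb l] and sl = sixth_root_cube[OF l]
    have s: "s = - (l^3)" "s\<^sup>2 = 1" using r(3) sl(1) by (simp_all add: s_def)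
    have "(- s * l)^3 = 1" "(s * ev x2)^3 = 1" "(s * ev x3)^3 = 1"
      using sl(2) sixth_root_cube(2)[OF r(7)] sixth_root_cube(2)[OF r(8)] r(3,4) by (simp_all add: s_def)
    moreover have "(- s * l)\<^sup>2 + (- s * l) * (s * a) + (s * a)\<^sup>2 = s\<^sup>2 * (a\<^sup>2 - a * l + l\<^sup>2)" for a
      by (simp add: power2_eq_square algebra_simps)
    ultimately have mp: "modular_pair (mat3 (- s) 1 1 0 s 0 0 0 s) (mat3 l 0 0 0 (ev x2) 0 0 0 (ev x3))"
      unfolding modular_pair_triangular using r s(2) by simp
    note nd = neighbours_distinct[OF nb sl(3)]
    have "\<exists>\<rho>\<in>ext_reps ?Q. \<rho> elt_S = mat3 (- s) 1 1 0 s 0 0 0 s \<and>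
        \<rho> elt_T = mat3 l 0 0 0 (ev x2) 0 0 0 (ev x3)"
      by (rule ext_reps_mat3I[OF mp]; (erule (2) Q)?) (use nd in auto)
    then show ?thesis using 1(2) unfolding pair_iia_mat3 l_def s_def by simp
  next
    case (2 x1 x2 x3)
    define l s where "l = ev x2" and "s = ev x1 ^ 3"
    note l = ev_sixth[of x2, folded l_def]
    note nb = ind_iib_neighbours[OF 2(1), folded l_def]
    note r = neighbours_relations[OF nb l] and sl = sixth_root_cube[OF l]
    have s: "s = - (l^3)" "s\<^sup>2 = 1" "s \<noteq> 0" using r(3) sl(1,3) by (simp_all add: s_def)
    have "(- s * l)^3 = 1" "(s * ev x1)^3 = 1" "(s * ev x3)^3 = 1"
      using sl(2) sixth_root_cube(2)[OF r(7)] sixth_root_cube(2)[OF r(8)] r(3,4) by (simp_all add: s_def)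
    moreover have "(- s * l)\<^sup>2 + (- s * l) * (s * a) + (s * a)\<^sup>2 = s\<^sup>2 * (a\<^sup>2 - a * l + l\<^sup>2)"
      "(s * a)\<^sup>2 + (s * a) * (- s * l) + (- s * l)\<^sup>2 = s\<^sup>2 * (a\<^sup>2 - a * l + l\<^sup>2)" for a
      by (simp_all add: power2_eq_square algebra_simps)
    \<comment> \<open>Both terms of the \<open>(1,3)\<close> entry of the cube vanish separately,
      because the two neighbours of \<open>l\<close> have sum \<open>l\<close> and product the
      square of \<open>l\<close>.\<close>
    moreover have "(s * ev x1)\<^sup>2 + (s * ev x1) * (s * ev x3) + (s * ev x3)\<^sup>2 =
        s\<^sup>2 * ((ev x1 + ev x3)\<^sup>2 - ev x1 * ev x3)"
      "s * ev x1 + - s * l + s * ev x3 = s * (ev x1 + ev x3 - l)"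
      by (simp_all add: power2_eq_square algebra_simps)
    ultimately have mp: "modular_pair (mat3 s (- 2 * s) 1 0 (- s) 1 0 0 s) (mat3 (ev x1) 0 0 0 l 0 0 0 (ev x3))"
      unfolding modular_pair_triangular using r s(2) by simp
    note nd = neighbours_distinct[OF nb sl(3)]
    have "\<exists>\<rho>\<in>ext_reps ?Q. \<rho> elt_S = mat3 s (- 2 * s) 1 0 (- s) 1 0 0 s \<and>
        \<rho> elt_T = mat3 (ev x1) 0 0 0 l 0 0 0 (ev x3)"
      by (rule ext_reps_mat3I[OF mp]; (erule (2) Q)?) (use nd s(3) in auto)
    then show ?thesis using 2(2) unfolding pair_iib_mat3 l_def s_def by simp
  qed
next
  fix \<rho> assume "\<rho> \<in> ext_reps ?Q"
  then obtain \<rho>0 where \<rho>: "is_rep \<rho>" "is_rep \<rho>0" "?Q \<rho>0"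
    "modular_pair (\<rho> elt_S) (\<rho> elt_T)" "sub_pair (\<rho> elt_S) (\<rho> elt_T) (\<rho>0 elt_S) (\<rho>0 elt_T)"
    "\<not> decomposable_pair (\<rho> elt_S) (\<rho> elt_T)" "diagonalizable (\<rho> elt_T)"
    by (rule ext_repsE)
  have rd: "reducible_pair (\<rho>0 elt_S) (\<rho>0 elt_T)" "\<not> decomposable_pair (\<rho>0 elt_S) (\<rho>0 elt_T)"
    using \<rho>(2,3) by (simp_all add: reducible_iff_pair decomposable_iff_pair)
  obtain a1 c a2 l1 l2 where t: "sub_pair (\<rho> elt_S) (\<rho> elt_T) (mat2 a1 c 0 a2) (mat2 l1 0 0 l2)"
    "c \<noteq> 0" "l1 \<noteq> l2"
    by (rule sub_pair_triangular_diagonal[OF \<rho>(5,7) rep_modular_pair[OF \<rho>(2)] rd])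
  from sub_pair_block[OF t(1) \<rho>(7)] obtain v :: "complex^2" and s l3 where
    c: "simconj (\<rho> elt_S) (\<rho> elt_T) (mat3 a1 c (v$1) 0 a2 (v$2) 0 0 s) (mat3 l1 0 0 0 l2 0 0 0 l3)"
    unfolding blk_mat2 by auto
  have "\<not> decomposable_pair (mat3 a1 c (v$1) 0 a2 (v$2) 0 0 s) (mat3 l1 0 0 0 l2 0 0 0 l3)"
    using \<rho>(6) c decomposable_pair_simconj simconj_sym by blast
  from triangular_normal_form_ii[OF modular_pair_simconj[OF \<rho>(4) c] this t(2,3)]
  consider "l1^6 = 1" "neighbours l1 l2 l3" "simconj (\<rho> elt_S) (\<rho> elt_T)
       (mat3 (- (l2^3)) 1 1 0 (l2^3) 0 0 0 (l2^3)) (mat3 l1 0 0 0 l2 0 0 0 l3)"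
    | "l2^6 = 1" "neighbours l2 l1 l3" "simconj (\<rho> elt_S) (\<rho> elt_T)
       (mat3 (l1^3) (-2 * l1^3) 1 0 (- (l1^3)) 1 0 0 (l1^3)) (mat3 l1 0 0 0 l2 0 0 0 l3)"
    using simconj_trans[OF c] by blast
  then show "\<exists>(A, B)\<in>?D. simconj (\<rho> elt_S) (\<rho> elt_T) A B"
  proof cases
    case 1
    obtain x1 x2 x3 where x: "(x1, x2, x3) \<in> ind_iia" "l1 = ev x1"
      "l2 = ev x2 \<and> l3 = ev x3 \<or> l2 = ev x3 \<and> l3 = ev x2"
      by (rule ind_iia_cover[OF 1(1,2)])
    have cube: "l2^3 = l3^3" using neighbours_relations(3,4)[OF 1(2,1)] by simp
    \<comment> \<open>Exchanging the last two axes preserves this normal form, since both carry the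
      same sign; this brings the exponents into the listed order.\<close>
    have "simconj (mat3 (- (l2^3)) 1 1 0 (l2^3) 0 0 0 (l2^3)) (mat3 l1 0 0 0 l2 0 0 0 l3)
       (mat3 (- (l3^3)) 1 1 0 (l3^3) 0 0 0 (l3^3)) (mat3 l1 0 0 0 l3 0 0 0 l2)"
      by (rule simconjI[of "mat3 1 0 0 0 0 1 0 1 0"]) (simp_all add: det_mat3 cube)
    then have "simconj (\<rho> elt_S) (\<rho> elt_T)
       (mat3 (- (ev x2^3)) 1 1 0 (ev x2^3) 0 0 0 (ev x2^3)) (mat3 (ev x1) 0 0 0 (ev x2) 0 0 0 (ev x3))"
      using x(2,3) 1(3) simconj_trans by blast
    then show ?thesis
      by (intro bexI[OF _ UnI1[OF imageI[OF x(1)]]]) (simp add: pair_iia_mat3)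
  next
    case 2
    obtain x1 x2 x3 where x: "(x1, x2, x3) \<in> ind_iib" "l2 = ev x2" "l1 = ev x1" "l3 = ev x3"
      by (rule ind_iib_cover[OF 2(1,2)])
    then show ?thesis using 2(3)
      by (intro bexI[OF _ UnI2[OF imageI[OF x(1)]]]) (simp add: pair_iib_mat3)
  qed
next
  fix A B A' B'
  assume AB: "(A, B) \<in> ?D" "(A', B') \<in> ?D" and c: "simconj A B A' B'"
  \<comment> \<open>The first family has two one-dimensional quotients, the second only one, so no
    pair lies in both. Within the families \<open>x1\<close>, respectively \<open>x1\<close>
    together with \<open>x3\<close>, determines the triple.\<close>
  have E: "common_eigenvalues M N = {ev z1} \<and>
      common_eigenvalues (transpose M) (transpose N) = {ev z2, ev z3}"
    if "(z1, z2, z3) \<in> ind_iia" "(M, N) = pair_iia (z1, z2, z3)" for z1 z2 z3 M N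
  proof -
    have "transpose N = mat3 (ev z1) 0 0 0 (ev z2) 0 0 0 (ev z3)"
      using that(2) by (simp add: pair_iia_mat3 mat3_eq_iff transpose_def)
    moreover have "ev z1 \<noteq> 0" using ev_sixth[of z1] by auto
    moreover note neighbours_distinct[OF ind_iia_neighbours[OF that(1)] this]
    ultimately show ?thesis
      using that(2) by (auto simp: common_eigenvalues_mat3 pair_iia_mat3 transpose_def)
  qed
  have F: "common_eigenvalues M N = {ev z1} \<and> common_eigenvalues (transpose M) (transpose N) = {ev z3}"
    if "(z1, z2, z3) \<in> ind_iib" "(M, N) = pair_iib (z1, z2, z3)" for z1 z2 z3 M N
  proof -
    have "transpose N = mat3 (ev z1) 0 0 0 (ev z2) 0 0 0 (ev z3)"
      using that(2) by (simp add: pair_iib_mat3 mat3_eq_iff transpose_def)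
    moreover have "ev z2 \<noteq> 0" "ev z1 \<noteq> 0" using ev_sixth[of z2] ev_sixth[of z1] by auto
    moreover note neighbours_distinct[OF ind_iib_neighbours[OF that(1)] this(1)]
    ultimately show ?thesis
      using that(2) by (auto simp: common_eigenvalues_mat3 pair_iib_mat3 transpose_def)
  qed
  note same = common_eigenvalues_simconj[OF c] common_eigenvalues_simconj[OF simconj_transpose[OF c]]
  have inj: "x = y" if "x < 6" "y < 6" "ev x = ev y" for x y using that by (rule ev_inj)
  have mixed: False if x: "(x1, x2, x3) \<in> ind_iia" "(M, N) = pair_iia (x1, x2, x3)"
    and y: "(y1, y2, y3) \<in> ind_iib" "(M', N') = pair_iib (y1, y2, y3)"
    and e: "common_eigenvalues M N = common_eigenvalues M' N'"
     "common_eigenvalues (transpose M) (transpose N) = common_eigenvalues (transpose M') (transpose N')"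
    for x1 x2 x3 y1 y2 y3 M N M' N'
  proof -
    have "ev x2 = ev x3" using e(2) E[OF x] F[OF y] by auto
    then show False using inj[of x2 x3] x(1) unfolding ind_iia_def by auto
  qed
  from AB consider x1 x2 x3 y1 y2 y3 where "(x1, x2, x3) \<in> ind_iia" "(A, B) = pair_iia (x1, x2, x3)"
      "(y1, y2, y3) \<in> ind_iia" "(A', B') = pair_iia (y1, y2, y3)"
    | x1 x2 x3 y1 y2 y3 where "(x1, x2, x3) \<in> ind_iib" "(A, B) = pair_iib (x1, x2, x3)"
      "(y1, y2, y3) \<in> ind_iib" "(A', B') = pair_iib (y1, y2, y3)"
    | x1 x2 x3 y1 y2 y3 where "(x1, x2, x3) \<in> ind_iia" "(A, B) = pair_iia (x1, x2, x3)"
      "(y1, y2, y3) \<in> ind_iib" "(A', B') = pair_iib (y1, y2, y3)"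
    | x1 x2 x3 y1 y2 y3 where "(x1, x2, x3) \<in> ind_iib" "(A, B) = pair_iib (x1, x2, x3)"
      "(y1, y2, y3) \<in> ind_iia" "(A', B') = pair_iia (y1, y2, y3)"
    by (elim UnE imageE) auto
  then show "(A, B) = (A', B')"
  proof cases
    case 1
    then have "ev x1 = ev y1" using same E by (metis singleton_inject)
    then have "x1 = y1" using 1 inj ind_lt by blast
    then have "(x1, x2, x3) = (y1, y2, y3)" using 1(1,3) unfolding ind_iia_def by auto
    then show ?thesis using 1 by simp
  next
    case 2
    then have "ev x1 = ev y1" "ev x3 = ev y3" using same F by (metis singleton_inject)+
    then have "x1 = y1" "x3 = y3" using 2 inj ind_lt by blast+
    then have "(x1, x2, x3) = (y1, y2, y3)" using 2(1,3) unfolding ind_iib_def by auto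
    then show ?thesis using 2 by simp
  next
    case 3
    then show ?thesis using mixed same by blast
  next
    case 4
    then show ?thesis using mixed same[symmetric] by blast
  qed
qed

section \<open>Sizes of the lists\<close>

lemma card_i: "card (pair_i ` ind_i) = 6"
proof -
  have "inj_on pair_i ind_i"
  proof (rule inj_onI)
    fix x y assume a: "x \<in> ind_i" "y \<in> ind_i" "pair_i x = pair_i y"
    obtain x1 x2 x3 y1 y2 y3 where [simp]: "x = (x1, x2, x3)" "y = (y1, y2, y3)"
      by (cases x, cases y) auto
    have "ev x1 = ev y1" "ev x2 = ev y2" "ev x3 = ev y3"
      using a(3) by (simp_all add: pair_i_mat3 mat3_eq_iff)
    then show "x = y" using ev_inj ind_lt[of x1 x2 x3] ind_lt[of y1 y2 y3] a(1,2) by simp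
  qed
  then show ?thesis by (simp add: card_image ind_i_def)
qed

text \<open>The exponent triples of both families are pairwise distinct, so the diagonal matrices
  alone already give 18 values; the list sizes 6 and 12 bound the union from above.\<close>

lemma card_ii: "card (pair_iia ` ind_iia \<union> pair_iib ` ind_iib) = 18"
proof -
  have "snd ` (pair_iia ` ind_iia \<union> pair_iib ` ind_iib) =
      (\<lambda>(x1, x2, x3). mat3 (ev x1) 0 0 0 (ev x2) 0 0 0 (ev x3)) ` (ind_iia \<union> ind_iib)" (is "_ = ?f ` _")
    unfolding image_Un image_image
    by (intro arg_cong2[of _ _ _ _ "(\<union>)"] image_cong) (auto simp: pair_iia_mat3 pair_iib_mat3)
  moreover have "inj_on ?f (ind_iia \<union> ind_iib)"
  proof (rule inj_onI)
    fix x y assume a: "x \<in> ind_iia \<union> ind_iib" "y \<in> ind_iia \<union> ind_iib" "?f x = ?f y"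
    obtain x1 x2 x3 y1 y2 y3 where [simp]: "x = (x1, x2, x3)" "y = (y1, y2, y3)"
      by (cases x, cases y) auto
    have "ev x1 = ev y1" "ev x2 = ev y2" "ev x3 = ev y3"
      using a(3) by (simp_all add: mat3_eq_iff)
    then show "x = y" using ev_inj ind_lt[of x1 x2 x3] ind_lt[of y1 y2 y3] a(1,2) by simp
  qed
  moreover have "card (ind_iia \<union> ind_iib) = 18" unfolding ind_defs by simp
  ultimately have "card (snd ` (pair_iia ` ind_iia \<union> pair_iib ` ind_iib)) = 18"
    by (simp add: card_image)
  moreover have "card (snd ` (pair_iia ` ind_iia \<union> pair_iib ` ind_iib)) \<le>
      card (pair_iia ` ind_iia \<union> pair_iib ` ind_iib)"
    by (rule card_image_le) (simp add: ind_defs)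
  moreover have "card (pair_iia ` ind_iia \<union> pair_iib ` ind_iib) \<le> card ind_iia + card ind_iib"
    using card_Un_le[of "pair_iia ` ind_iia" "pair_iib ` ind_iib"] card_image_le[of ind_iia pair_iia]
      card_image_le[of ind_iib pair_iib] by (simp add: ind_defs)
  moreover have "card ind_iia + card ind_iib = 18" unfolding ind_defs by simp
  ultimately show ?thesis by linarith
qed

section \<open>Extensions of irreducible planes\<close>

text \<open>Every vector is an eigenvector of the identity, so plain eigenvalues inherit the
  invariance proved for common ones.\<close>

lemma eigenvalues_eq_common: "eigenvalues B = common_eigenvalues (mat 1) B"
  unfolding eigenvalues_def common_eigenvalues_def by (metis matrix_vector_mul_lid scaleR_one vec.scale_one)

lemma eigenvalues_simconj: "simconj A B A' B' \<Longrightarrow> eigenvalues B = eigenvalues B'"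
  unfolding eigenvalues_eq_common
  by (rule common_eigenvalues_simconj) (auto simp: simconj_def)

lemma eigenvalues_mat2: "eigenvalues (mat2 l1 0 0 l2) = {l1, l2}"
proof
  show "eigenvalues (mat2 l1 0 0 l2) \<subseteq> {l1, l2}"
    unfolding eigenvalues_def by (auto simp: vec_eq_iff forall_2 matrix_vector_mult_def sum_2)
  have "mat2 l1 0 0 l2 *v axis 1 1 = l1 *s axis 1 1" "mat2 l1 0 0 l2 *v axis 2 1 = l2 *s axis 2 1"
    by (simp_all add: vec_eq_iff forall_2 matrix_vector_mult_def sum_2 axis_def)
  moreover have "axis i (1::complex) \<noteq> 0" for i :: 2 by (simp add: axis_eq_0_iff)
  ultimately show "{l1, l2} \<subseteq> eigenvalues (mat2 l1 0 0 l2)"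
    unfolding eigenvalues_def by blast
qed

text \<open>A nonzero invariant subspace contains an axis, and the nonzero entries \<open>b\<close>
  and \<open>c\<close> carry each axis to the other.\<close>

lemma irreducible_pair_mat2:
  assumes "b \<noteq> 0" "c \<noteq> 0" "l1 \<noteq> l2"
  shows "\<not> reducible_pair (mat2 a b c d) (mat2 l1 0 0 l2)"
proof
  assume "reducible_pair (mat2 a b c d) (mat2 l1 0 0 l2)"
  then obtain W where W: "invariant_pair (mat2 a b c d) (mat2 l1 0 0 l2) W" "W \<noteq> {0}" "W \<noteq> UNIV"
    unfolding reducible_pair_def by blast
  note ax = invariant_pair_axis[OF distinct_diagonal_mat2[OF assms(3)] W(1)]
  have sub: "vec.subspace W" and inv: "w \<in> W \<Longrightarrow> mat2 a b c d *v w \<in> W" for w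
    using W(1) unfolding invariant_pair_def by blast+
  have "0 \<in> W" using sub by (rule vec.subspace_0)
  then obtain w where "w \<in> W" "w \<noteq> 0" using W(2) by blast
  then have "axis 1 1 \<in> W \<or> axis 2 1 \<in> W"
    using ax[of w 1] ax[of w 2] by (auto simp: vec_eq_iff forall_2)
  moreover have "axis 2 1 \<in> W" if "axis 1 1 \<in> W"
    using ax[OF inv[OF that], of 2] assms by (simp add: matrix_vector_mult_def sum_2 axis_def)
  moreover have "axis 1 1 \<in> W" if "axis 2 1 \<in> W"
    using ax[OF inv[OF that], of 1] assms by (simp add: matrix_vector_mult_def sum_2 axis_def)
  ultimately have e: "axis 1 1 \<in> W" "axis 2 1 \<in> W" by blast+
  have "x \<in> W" for x
  proof -
    have "x = x$1 *s axis 1 1 + x$2 *s axis 2 1" by (simp add: vec_eq_iff forall_2 axis_def)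
    then show ?thesis using e sub by (metis vec.subspace_add vec.subspace_scale)
  qed
  then show False using W(3) by blast
qed

lemma reducible_pair_simconj:
  assumes "reducible_pair A B" "simconj A B A' B'"
  shows "reducible_pair A' B'"
proof -
  obtain W where W: "invariant_pair A B W" "W \<noteq> {0}" "W \<noteq> UNIV"
    using assms(1) unfolding reducible_pair_def by blast
  obtain P where P: "invertible P" "P ** A = A' ** P" "P ** B = B' ** P"
    using assms(2) unfolding simconj_def by blast
  have inv: "matrix_inv P *v (P *v z) = z" for z
    using invertible_matrix_inv[OF P(1)] by (simp add: matrix_vector_mul_assoc)
  have "0 \<in> W" using W vec.subspace_0 unfolding invariant_pair_def by blast
  then obtain w where w: "w \<in> W" "w \<noteq> 0" using W(2) by blast
  obtain u where u: "u \<notin> W" using W(3) by blast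
  have "P *v w \<noteq> 0" using inv[of w] w(2) by auto
  then have "(*v) P ` W \<noteq> {0}" using w(1) by blast
  moreover have "P *v u \<notin> (*v) P ` W"
  proof
    assume "P *v u \<in> (*v) P ` W"
    then obtain z where z: "z \<in> W" "P *v u = P *v z" by blast
    have "u = matrix_inv P *v (P *v z)" unfolding z(2)[symmetric] inv ..
    then show False using u z(1) unfolding inv by simp
  qed
  then have "(*v) P ` W \<noteq> UNIV" by blast
  ultimately show ?thesis
    unfolding reducible_pair_def using invariant_pair_image[OF P(2,3) W(1)] by blast
qed

lemma simconj_diagonal2:
  fixes A B :: "complex^2^2"
  assumes "eigenvalues B = {l1, l2}" "l1 \<noteq> l2"
  shows "\<exists>a b c d. simconj A B (mat2 a b c d) (mat2 l1 0 0 l2)"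
proof -
  have "l1 \<in> eigenvalues B" "l2 \<in> eigenvalues B" using assms(1) by auto
  then obtain v w where v: "v \<noteq> 0" "B *v v = l1 *s v" and w: "w \<noteq> 0" "B *v w = l2 *s w"
    unfolding eigenvalues_def by blast
  define R where "R = mat2 (v$1) (w$1) (v$2) (w$2)"
  have "det R \<noteq> 0"
  proof
    assume "det R = 0"
    then have d: "w$k * v$i = v$k * w$i" for i k
      using exhaust_2[of i] exhaust_2[of k] by (auto simp: R_def mult.commute)
    have "w$k = 0" for k
    proof -
      \<comment> \<open>Parallel eigenvectors: applying \<open>B\<close> to both sides gives
        \<open>l1\<close> on the left and \<open>l2\<close> on the right.\<close>
      have e: "w$k *s v = v$k *s w" using d by (simp add: vec_eq_iff)
      then have "B *v (w$k *s v) = B *v (v$k *s w)" by simp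
      then have "w$k *s (l1 *s v) = v$k *s (l2 *s w)" by (simp add: vec.scale v w)
      then have "l1 *s (w$k *s v) = l2 *s (v$k *s w)" by (simp add: mult.commute)
      then have "l1 *s (w$k *s v) = l2 *s (w$k *s v)" by (simp only: e)
      then have "(l1 *s (w$k *s v)) $ i = (l2 *s (w$k *s v)) $ i" for i by (simp only:)
      then have "(l1 - l2) * (w$k * v$i) = 0" for i
        by (simp only: vector_smult_component left_diff_distrib diff_self)
      then have "w$k * v$i = 0" for i using assms(2) by simp
      moreover obtain i where "v$i \<noteq> 0" using v(1) by (auto simp: vec_eq_iff)
      ultimately show ?thesis by (metis mult_eq_0_iff)
    qed
    then show False using w(1) by (simp add: vec_eq_iff)
  qed
  then have R: "invertible R" by (simp add: invertible_det_nz)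
  have "B ** R = R ** mat2 l1 0 0 l2"
    using v(2) w(2)
    by (simp add: R_def vec_eq_iff forall_2 matrix_matrix_mult_def matrix_vector_mult_def sum_2 mult.commute)
  moreover have "A ** R = R ** (matrix_inv R ** A ** R)"
    using invertible_matrix_inv[OF R] by (simp add: matrix_mul_assoc)
  ultimately have "simconj A B (matrix_inv R ** A ** R) (mat2 l1 0 0 l2)"
    using simconjI \<open>det R \<noteq> 0\<close> by blast
  then show ?thesis by (metis mat2_cases)
qed

text \<open>By Cayley--Hamilton, \<open>\<rho>\<^sub>0(ST)\<close> satisfies \<open>x\<^sup>2 + \<tau> x + \<tau>\<^sup>2 = 0\<close>: its eigenvalues are the
  cube roots of unity other than \<open>\<tau>\<close>.\<close>

definition irreducible_form ::
  "complex \<Rightarrow> complex \<Rightarrow> complex \<Rightarrow> complex \<Rightarrow> complex \<Rightarrow> complex \<Rightarrow> bool" where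
  "irreducible_form a b c l1 l2 \<tau> \<longleftrightarrow> b \<noteq> 0 \<and> c \<noteq> 0 \<and> a\<^sup>2 + b * c = 1 \<and> l1 \<noteq> l2 \<and> l1 + l2 \<noteq> 0 \<and>
     a * (l1 - l2) = - \<tau> \<and> \<tau>^3 = 1 \<and> l1 * l2 = - (\<tau>\<^sup>2)"

text \<open>\<open>C^2 = - \<tau> C - \<tau>^2\<close> entry by entry, for \<open>C\<close> the
  product of the two matrices: its trace is \<open>- \<tau>\<close> and its determinant
  \<open>\<tau>^2\<close>.\<close>

lemma irreducible_form_square:
  assumes "irreducible_form a b c l1 l2 \<tau>"
  shows "a*l1*(a*l1) + b*l2*(c*l1) = - \<tau> * (a*l1) - \<tau>\<^sup>2" "a*l1*(b*l2) - b*l2*(a*l2) = - \<tau> * (b*l2)"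
    "c*l1*(a*l1) - a*l2*(c*l1) = - \<tau> * (c*l1)" "c*l1*(b*l2) + a*l2*(a*l2) = \<tau> * (a*l2) - \<tau>\<^sup>2"
  using assms unfolding irreducible_form_def by algebra+

text \<open>Multiplying \<open>x^2 + \<tau> x + \<tau>^2\<close> by \<open>x - \<tau>\<close> gives
  \<open>x^3 - \<tau>^3\<close>, so the cube of the product is \<open>\<tau>^3 = 1\<close>.\<close>

lemma irreducible_form_cube:
  assumes f: "irreducible_form a b c l1 l2 \<tau>"
  shows "(- \<tau> * (a*l1) - \<tau>\<^sup>2) * (a*l1) + - \<tau> * (b*l2) * (c*l1) = 1"
    "(- \<tau> * (a*l1) - \<tau>\<^sup>2) * (b*l2) + - \<tau> * (b*l2) * - (a*l2) = 0"
    "- \<tau> * (c*l1) * (a*l1) + (\<tau> * (a*l2) - \<tau>\<^sup>2) * (c*l1) = 0"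
    "- \<tau> * (c*l1) * (b*l2) + (\<tau> * (a*l2) - \<tau>\<^sup>2) * - (a*l2) = 1"
proof -
  note q = irreducible_form_square[OF f]
  have t: "\<tau>^3 = 1" using f unfolding irreducible_form_def by blast
  show "(- \<tau> * (a*l1) - \<tau>\<^sup>2) * (a*l1) + - \<tau> * (b*l2) * (c*l1) = 1" using q(1) t by algebra
  show "(- \<tau> * (a*l1) - \<tau>\<^sup>2) * (b*l2) + - \<tau> * (b*l2) * - (a*l2) = 0" using q(2) by algebra
  show "- \<tau> * (c*l1) * (a*l1) + (\<tau> * (a*l2) - \<tau>\<^sup>2) * (c*l1) = 0" using q(3) by algebra
  show "- \<tau> * (c*l1) * (b*l2) + (\<tau> * (a*l2) - \<tau>\<^sup>2) * - (a*l2) = 1" using q(4) t by algebra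
qed

lemma modular_pair_irreducible_form:
  assumes f: "irreducible_form a b c l1 l2 \<tau>"
  shows "modular_pair (mat2 a b c (- a)) (mat2 l1 0 0 l2)"
proof -
  let ?C = "mat2 (a*l1) (b*l2) (c*l1) (- (a*l2))"
  have C2: "?C ** ?C = mat2 (- \<tau> * (a*l1) - \<tau>\<^sup>2) (- \<tau> * (b*l2)) (- \<tau> * (c*l1)) (\<tau> * (a*l2) - \<tau>\<^sup>2)"
    using irreducible_form_square[OF f] by (simp add: mat2_eq_iff)
  have "?C ** ?C ** ?C = mat 1"
    unfolding C2 unfolding mat2_mult irreducible_form_cube[OF f] mat2_one ..
  moreover have "mat2 a b c (- a) ** mat2 a b c (- a) = mat 1"
    using f unfolding irreducible_form_def
    by (simp add: mat2_one mat2_eq_iff power2_eq_square algebra_simps)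
  moreover have "mat2 a b c (- a) ** mat2 l1 0 0 l2 = ?C" by simp
  ultimately show ?thesis unfolding modular_pair_def by simp
qed

text \<open>An involution with a nonzero off-diagonal entry is not scalar, so its trace is zero;
  \<open>\<tau>\<close> is read off as minus the trace of the product.\<close>

lemma irreducible_formI:
  assumes m: "modular_pair (mat2 a b c d) (mat2 l1 0 0 l2)"
    and "b \<noteq> 0" "c \<noteq> 0" "l1 \<noteq> l2" "l1 / l2 \<noteq> -1"
  shows "d = - a \<and> irreducible_form a b c l1 l2 (- (a * (l1 - l2)))"
proof -
  have e: "a * a + b * c = 1" "a * b + b * d = 0"
    using m by (simp_all add: modular_pair_def mat2_one mat2_eq_iff)
  then have "b * (a + d) = 0" by (simp add: algebra_simps)
  then have d: "d = - a" using assms(2) by (simp add: add_eq_0_iff)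
  let ?t = "a * (l1 - l2)"
  have cube: "(a*l1*(a*l1) + b*l2*(c*l1)) * (a*l1) + (a*l1*(b*l2) + b*l2*(d*l2)) * (c*l1) = 1"
    "(a*l1*(a*l1) + b*l2*(c*l1)) * (b*l2) + (a*l1*(b*l2) + b*l2*(d*l2)) * (d*l2) = 0"
    using m by (simp_all add: modular_pair_def mat2_one mat2_eq_iff)
  have cube22: "(c*l1*(a*l1) + d*l2*(c*l1)) * (b*l2) + (c*l1*(b*l2) + d*l2*(d*l2)) * (d*l2) = 1"
    using m by (simp add: modular_pair_def mat2_one mat2_eq_iff)
  \<comment> \<open>With trace \<open>t\<close> and determinant \<open>D = - l1 l2\<close> of the
    product \<open>C\<close>, its cube is \<open>(t^2 - D) C - t D\<close>. The off-diagonal entry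
    gives \<open>t^2 = D\<close>, and then a diagonal entry gives \<open>- t D = 1\<close>.\<close>
  have "b * l2 * (?t\<^sup>2 + l1 * l2) = 0"
    using cube(2) e(1) unfolding d by algebra
  moreover have "l2 \<noteq> 0" "l1 \<noteq> 0"
    using cube(1) cube22 by auto
  ultimately have t2: "?t\<^sup>2 = - (l1 * l2)" using assms(2) by (simp add: add_eq_0_iff)
  have "?t * (l1 * l2) = 1"
    using cube(1) e(1) t2 unfolding d by algebra
  then have "(- ?t)^3 = 1" using t2 by algebra
  moreover have "l1 + l2 \<noteq> 0" using assms(5) \<open>l2 \<noteq> 0\<close> by (auto simp: add_eq_0_iff)
  moreover have "l1 * l2 = - ((- ?t)\<^sup>2)" using t2 by simp
  ultimately show ?thesis
    unfolding irreducible_form_def using assms d e(1) by (simp add: power2_eq_square)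
qed

text \<open>In an eigenbasis of \<open>\<rho>0 elt_T\<close> a vanishing off-diagonal entry of the
  other matrix would leave an axis invariant.\<close>

lemma admissible_irrepsE:
  assumes "\<rho>0 \<in> admissible_irreps"
  obtains a b c l1 l2 \<tau> where "irreducible_form a b c l1 l2 \<tau>"
    "simconj (\<rho>0 elt_S) (\<rho>0 elt_T) (mat2 a b c (- a)) (mat2 l1 0 0 l2)"
proof -
  obtain l1 l2 where r: "is_rep \<rho>0" "\<not> reducible_pair (\<rho>0 elt_S) (\<rho>0 elt_T)"
    and l: "eigenvalues (\<rho>0 elt_T) = {l1, l2}" "l1 \<noteq> l2" "l1 / l2 \<noteq> -1"
    using assms unfolding admissible_irreps_def by (auto simp: reducible_iff_pair)
  obtain a b c d where s: "simconj (\<rho>0 elt_S) (\<rho>0 elt_T) (mat2 a b c d) (mat2 l1 0 0 l2)"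
    using simconj_diagonal2[OF l(1,2)] by blast
  have nr: "\<not> reducible_pair (mat2 a b c d) (mat2 l1 0 0 l2)"
    using r(2) s reducible_pair_simconj simconj_sym by blast
  have "c \<noteq> 0" using nr reducible_pair_mat2 by blast
  moreover have "b \<noteq> 0"
  proof
    assume "b = 0"
    then have "simconj (mat2 a b c d) (mat2 l1 0 0 l2) (mat2 d c 0 a) (mat2 l2 0 0 l1)"
      by (intro simconjI[of "mat2 0 1 1 0"]) simp_all
    then show False using nr reducible_pair_mat2 reducible_pair_simconj simconj_sym by blast
  qed
  ultimately have "d = - a \<and> irreducible_form a b c l1 l2 (- (a * (l1 - l2)))"
    using irreducible_formI[OF modular_pair_simconj[OF rep_modular_pair[OF r(1)] s]] l by blast
  then show ?thesis using that s by blast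
qed

text \<open>For \<open>s^2 = 1\<close> the third column \<open>(b, - (a + s))\<close> spans the
  eigenline of the plane's involution for \<open>- s\<close>, as \<open>S^2 = 1\<close>
  requires.\<close>

definition ext_S :: "complex \<Rightarrow> complex \<Rightarrow> complex \<Rightarrow> complex \<Rightarrow> complex^3^3" where
  "ext_S a b c s = mat3 a b b c (- a) (- (a + s)) 0 0 s"

text \<open>The last entry makes the quotient value of \<open>ST\<close> equal to
  \<open>s * (s * \<tau>) = \<tau>\<close> when \<open>s^2 = 1\<close>.\<close>

definition ext_T :: "complex \<Rightarrow> complex \<Rightarrow> complex \<Rightarrow> complex \<Rightarrow> complex^3^3" where
  "ext_T l1 l2 \<tau> s = mat3 l1 0 0 0 l2 0 0 0 (s * \<tau>)"

text \<open>The hypothesis on the ratio of the eigenvalues enters here.\<close>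

lemma irreducible_form_third:
  assumes f: "irreducible_form a b c l1 l2 \<tau>" and s: "s * s = 1"
  shows "l1 \<noteq> s * \<tau>" "l2 \<noteq> s * \<tau>" "\<tau> \<noteq> 0"
proof -
  note r = f[unfolded irreducible_form_def]
  show t: "\<tau> \<noteq> 0" using r by auto
  have s0: "s \<noteq> 0" using s by auto
  have "x \<noteq> s * \<tau>" if "x * y = - (\<tau>\<^sup>2)" "x + y \<noteq> 0" for x y
  proof
    assume x: "x = s * \<tau>"
    \<comment> \<open>If \<open>x = s * \<tau>\<close>, then \<open>x * y = - x^2\<close>, so
      \<open>y = - x\<close>.\<close>
    have "s * \<tau> * (x + y) = 0" using that(1) s unfolding x by algebra
    then show False using that(2) s0 t by simp
  qed
  then show "l1 \<noteq> s * \<tau>" "l2 \<noteq> s * \<tau>" using r by (metis add.commute mult.commute)+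
qed

lemma irreducible_form_square3:
  assumes "irreducible_form a b c l1 l2 \<tau>"
  shows "mat3 (a*l1) (b*l2) v (c*l1) (- (a*l2)) w 0 0 p ** mat3 (a*l1) (b*l2) v (c*l1) (- (a*l2)) w 0 0 p =
      mat3 (- \<tau> * (a*l1) - \<tau>\<^sup>2) (- \<tau> * (b*l2)) (a*l1 * v + b*l2 * w + v * p)
           (- \<tau> * (c*l1)) (\<tau> * (a*l2) - \<tau>\<^sup>2) (c*l1 * v - a*l2 * w + w * p) 0 0 (p * p)"
  using irreducible_form_square[OF assms] by (simp add: mat3_eq_iff)

lemma modular_pair_ext:
  assumes f: "irreducible_form a b c l1 l2 \<tau>" and s: "s * s = 1"
  shows "modular_pair (ext_S a b c s) (ext_T l1 l2 \<tau> s)"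
proof -
  note r = f[unfolded irreducible_form_def]
  have "b * c = 1 - a * a" using r by (simp add: power2_eq_square eq_diff_eq add.commute)
  then have A2: "ext_S a b c s ** ext_S a b c s = mat 1"
    unfolding ext_S_def using s by (simp add: mat3_one mat3_eq_iff algebra_simps)
  obtain v w where vw: "v = b * (s * \<tau>)" "w = - (a + s) * (s * \<tau>)" by blast
  have C: "ext_S a b c s ** ext_T l1 l2 \<tau> s =
      mat3 (a*l1) (b*l2) v (c*l1) (- (a*l2)) w 0 0 \<tau>"
    unfolding ext_S_def ext_T_def vw using s by (simp add: mat3_eq_iff flip: mult.assoc)
  have t: "\<tau> * \<tau> * \<tau> = 1" using r by (simp add: power3_eq_cube)
  have "ext_S a b c s ** ext_T l1 l2 \<tau> s ** (ext_S a b c s ** ext_T l1 l2 \<tau> s) **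
      (ext_S a b c s ** ext_T l1 l2 \<tau> s) = mat 1"
    unfolding C irreducible_form_square3[OF f]
    unfolding mat3_mult mat3_one mat3_eq_iff mat3_nth
    using irreducible_form_cube[OF f] t by (simp add: power2_eq_square algebra_simps)
  then show ?thesis unfolding modular_pair_def using A2 by simp
qed

text \<open>Let \<open>C\<close> be the plane block of the product and \<open>p = s * l3\<close>.
  The last column of the cube is \<open>(C^2 + p C + p^2) v\<close> up to a factor, and the
  quadratic equation of \<open>C\<close> turns this into
  \<open>(p - \<tau>) (C + p + \<tau>) v\<close>. For \<open>p \<noteq> \<tau>\<close> the column
  \<open>v\<close> would be an eigenvector too special to exist; for \<open>p = \<tau>\<close> only
  its length is free.\<close>

lemma ext_unique:
  assumes f: "irreducible_form a b c l1 l2 \<tau>"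
    and m: "modular_pair (mat3 a b v1 c (- a) v2 0 0 s) (mat3 l1 0 0 0 l2 0 0 0 l3)"
    and nd: "\<not> decomposable_pair (mat3 a b v1 c (- a) v2 0 0 s) (mat3 l1 0 0 0 l2 0 0 0 l3)"
  shows "s * s = 1 \<and> simconj (mat3 a b v1 c (- a) v2 0 0 s) (mat3 l1 0 0 0 l2 0 0 0 l3)
     (ext_S a b c s) (ext_T l1 l2 \<tau> s)"
proof -
  note r = f[unfolded irreducible_form_def]
  have A2: "s * s = 1" "a * v1 + b * v2 + v1 * s = 0" "c * v1 - a * v2 + v2 * s = 0"
    using m by (simp_all add: modular_pair_def mat3_one mat3_eq_iff)
  define p where "p = s * l3"
  have C: "mat3 a b v1 c (- a) v2 0 0 s ** mat3 l1 0 0 0 l2 0 0 0 l3 =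
      mat3 (a*l1) (b*l2) (v1*l3) (c*l1) (- (a*l2)) (v2*l3) 0 0 p"
    by (simp add: p_def)
  have "mat3 a b v1 c (- a) v2 0 0 s ** mat3 l1 0 0 0 l2 0 0 0 l3 **
      (mat3 a b v1 c (- a) v2 0 0 s ** mat3 l1 0 0 0 l2 0 0 0 l3) **
      (mat3 a b v1 c (- a) v2 0 0 s ** mat3 l1 0 0 0 l2 0 0 0 l3) = mat 1"
    using m unfolding modular_pair_def by blast
  then have c13: "(- \<tau> * (a*l1) - \<tau>\<^sup>2) * (v1*l3) + (- \<tau> * (b*l2)) * (v2*l3) +
        (a*l1 * (v1*l3) + b*l2 * (v2*l3) + v1*l3 * p) * p = 0"
    and c23: "(- \<tau> * (c*l1)) * (v1*l3) + (\<tau> * (a*l2) - \<tau>\<^sup>2) * (v2*l3) +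
        (c*l1 * (v1*l3) - a*l2 * (v2*l3) + v2*l3 * p) * p = 0"
    and p3: "p * p * p = 1"
    unfolding C irreducible_form_square3[OF f]
    unfolding mat3_mult mat3_one mat3_eq_iff mat3_nth by simp_all
  have l3: "l3 \<noteq> 0" using p3 unfolding p_def by auto
  have "v1 \<noteq> 0 \<or> v2 \<noteq> 0" using nd decomposable_mat3_3 by auto
  then have v: "v1 \<noteq> 0" "v2 \<noteq> 0" using A2(2,3) r by auto
  have "p = \<tau>"
  proof (rule ccontr)
    assume ne: "p \<noteq> \<tau>"
    \<comment> \<open>The eigenvalue that \<open>C\<close> would have at \<open>v\<close> after
      cancelling \<open>p - \<tau>\<close>.\<close>
    define k where "k = - (p + \<tau>)"
    have "l3 * (p - \<tau>) * (a*l1* v1 + b*l2* v2 - k * v1) = 0"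
      "l3 * (p - \<tau>) * (c*l1* v1 - a*l2* v2 - k * v2) = 0"
      using c13 c23 by (simp_all add: k_def algebra_simps power2_eq_square)
    then have "a*l1* v1 + b*l2* v2 = k * v1" "c*l1* v1 - a*l2* v2 = k * v2" using ne l3 by simp_all
    \<comment> \<open>As \<open>v\<close> is also an eigenvector of the involution, it is one of the
      diagonal matrix; both of its coordinates being nonzero, \<open>l1\<close> and
      \<open>l2\<close> agree.\<close>
    then have "v1 * (l1 + k * s) = 0" "v2 * (l2 + k * s) = 0"
      using A2(2,3) r by algebra+
    then have "l1 = l2" using v by (simp add: add_eq_0_iff2)
    then show False using r by blast
  qed
  then have "l3 = s * \<tau>" using A2(1) unfolding p_def by (metis mult.assoc mult_1)
  moreover have "b * v2 = - (a + s) * v1" using A2(2) by (simp add: algebra_simps eq_neg_iff_add_eq_0)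
  ultimately have "simconj (mat3 a b v1 c (- a) v2 0 0 s) (mat3 l1 0 0 0 l2 0 0 0 l3)
     (ext_S a b c s) (ext_T l1 l2 \<tau> s)"
    using v(1) r unfolding ext_S_def ext_T_def
    \<comment> \<open>The plane is rescaled as a whole, which leaves its block unchanged and turns
      \<open>v1\<close> into \<open>b\<close>.\<close>
    by (intro simconjI[of "mat3 (v1/b) 0 0 0 (v1/b) 0 0 0 1"])
       (simp_all add: det_mat3 mat3_eq_iff field_simps)
  then show ?thesis using A2(1) by blast
qed

lemma represented_by_iii:
  assumes \<rho>0: "is_rep \<rho>0" and f: "irreducible_form a b c l1 l2 \<tau>"
    and s: "simconj (\<rho>0 elt_S) (\<rho>0 elt_T) (mat2 a b c (- a)) (mat2 l1 0 0 l2)"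
  shows "represented_by (ext_reps (equivalent \<rho>0)) ((\<lambda>s. (ext_S a b c s, ext_T l1 l2 \<tau> s)) ` {1, -1})"
    (is "represented_by _ (?F ` _)")
proof (rule represented_byI)
  note r = f[unfolded irreducible_form_def]
  fix A B assume "(A, B) \<in> ?F ` {1, -1}"
  then obtain e where "e \<in> {1, -1}" and AB: "A = ext_S a b c e" "B = ext_T l1 l2 \<tau> e" by blast
  then have e: "e * e = 1" by auto
  note th = irreducible_form_third[OF f e]
  have "equivalent \<rho>0 \<rho>0'" if "is_rep \<rho>0'" "\<rho>0' elt_S = mat2 a b c (- a)" "\<rho>0' elt_T = mat2 l1 0 0 l2" for \<rho>0'
    using that s \<rho>0 by (simp add: equivalent_iff_simconj)
  then show "\<exists>\<rho>\<in>ext_reps (equivalent \<rho>0). \<rho> elt_S = A \<and> \<rho> elt_T = B"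
    unfolding AB ext_S_def ext_T_def
    using modular_pair_ext[OF f e, unfolded ext_S_def ext_T_def] r th
    by (intro ext_reps_mat3I) auto
next
  fix \<rho> assume "\<rho> \<in> ext_reps (equivalent \<rho>0)"
  then obtain \<rho>0' where \<rho>: "is_rep \<rho>" "is_rep \<rho>0'" "equivalent \<rho>0 \<rho>0'"
    "modular_pair (\<rho> elt_S) (\<rho> elt_T)" "sub_pair (\<rho> elt_S) (\<rho> elt_T) (\<rho>0' elt_S) (\<rho>0' elt_T)"
    "\<not> decomposable_pair (\<rho> elt_S) (\<rho> elt_T)" "diagonalizable (\<rho> elt_T)"
    by (rule ext_repsE)
  have "simconj (\<rho>0' elt_S) (\<rho>0' elt_T) (mat2 a b c (- a)) (mat2 l1 0 0 l2)"
    using \<rho>(3) s simconj_sym simconj_trans equivalent_iff_simconj[OF \<rho>0 \<rho>(2)] by blast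
  from sub_pair_block[OF sub_pair_simconj[OF \<rho>(5) this] \<rho>(7)] obtain v :: "complex^2" and e l3 where
    c: "simconj (\<rho> elt_S) (\<rho> elt_T) (mat3 a b (v$1) c (- a) (v$2) 0 0 e) (mat3 l1 0 0 0 l2 0 0 0 l3)"
    unfolding blk_mat2 by auto
  have "\<not> decomposable_pair (mat3 a b (v$1) c (- a) (v$2) 0 0 e) (mat3 l1 0 0 0 l2 0 0 0 l3)"
    using \<rho>(6) c decomposable_pair_simconj simconj_sym by blast
  from ext_unique[OF f modular_pair_simconj[OF \<rho>(4) c] this]
  have e: "e * e = 1" and "simconj (\<rho> elt_S) (\<rho> elt_T) (ext_S a b c e) (ext_T l1 l2 \<tau> e)"
    using simconj_trans[OF c] by blast+
  moreover have "(e - 1) * (e + 1) = 0" using e by (simp add: algebra_simps)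
  then have "e \<in> {1, -1}" by (simp add: eq_neg_iff_add_eq_0)
  ultimately show "\<exists>(A, B)\<in>?F ` {1, -1}. simconj (\<rho> elt_S) (\<rho> elt_T) A B" by blast
next
  note r = f[unfolded irreducible_form_def]
  fix A B A' B' assume AB: "(A, B) \<in> ?F ` {1, -1}" "(A', B') \<in> ?F ` {1, -1}" and c: "simconj A B A' B'"
  \<comment> \<open>The plane has no one-dimensional quotient that extends, so the quotient
    character is the only one; its value at \<open>T\<close> recovers the sign.\<close>
  have E: "common_eigenvalues (transpose (ext_S a b c e)) (transpose (ext_T l1 l2 \<tau> e)) = {e * \<tau>}"
    if "e * e = 1" for e
  proof -
    have "transpose (ext_T l1 l2 \<tau> e) = mat3 l1 0 0 0 l2 0 0 0 (e * \<tau>)"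
      by (simp add: ext_T_def mat3_eq_iff transpose_def)
    then show ?thesis using irreducible_form_third[OF f that] r
      by (auto simp: common_eigenvalues_mat3 ext_S_def transpose_def)
  qed
  have sq: "e * e = 1" if "e \<in> {1, -1}" for e :: complex using that by auto
  obtain e where e: "e * e = 1" "(A, B) = ?F e" using AB(1) sq by blast
  obtain e' where e': "e' * e' = 1" "(A', B') = ?F e'" using AB(2) sq by blast
  have "e * \<tau> = e' * \<tau>"
    using common_eigenvalues_simconj[OF simconj_transpose[OF c]] E[OF e(1)] E[OF e'(1)] e(2) e'(2) by auto
  then show "(A, B) = (A', B')" using irreducible_form_third[OF f e(1)] e(2) e'(2) by simp
qed

lemma card_iii:
  assumes "\<rho>0 \<in> admissible_irreps"
  shows "card (ext_reps (equivalent \<rho>0) // rep_equiv) = 2"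
proof -
  obtain a b c l1 l2 \<tau> where f: "irreducible_form a b c l1 l2 \<tau>"
    "simconj (\<rho>0 elt_S) (\<rho>0 elt_T) (mat2 a b c (- a)) (mat2 l1 0 0 l2)"
    by (rule admissible_irrepsE[OF assms])
  have "is_rep \<rho>0" using assms unfolding admissible_irreps_def by blast
  from card_represented_by[OF represented_by_iii[OF this f]]
  have "card (ext_reps (equivalent \<rho>0) // rep_equiv) =
    card ((\<lambda>s. (ext_S a b c s, ext_T l1 l2 \<tau> s)) ` {1, -1})" .
  also have "\<dots> = 2" by (simp add: ext_S_def mat3_eq_iff)
  finally show ?thesis .
qed

text \<open>The choice \<open>\<tau> = 1\<close>, \<open>b = 1\<close>: the product of the
  eigenvalues forces \<open>- 1 / l\<close>, the trace condition forces \<open>a\<close>, and the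
  involution forces \<open>c\<close>. For \<open>n \<ge> 2\<close> the number \<open>a\<close> lies
  strictly between \<open>-1\<close> and 0, so \<open>c\<close> is nonzero, and
  \<open>l^2 \<noteq> 1\<close> keeps \<open>l1 + l2\<close> nonzero.\<close>

lemma irreducible_form_nat:
  assumes "n \<ge> 2"
  defines "l \<equiv> complex_of_real (real n)"
  defines "a \<equiv> - l / (l\<^sup>2 + 1)"
  shows "irreducible_form a 1 (1 - a\<^sup>2) l (- 1 / l) 1"
proof -
  define x where "x = real n"
  have x: "x \<ge> 2" using assms(1) by (simp add: x_def)
  have l: "l = of_real x" by (simp add: l_def x_def)
  have a: "a = of_real (- x / (x\<^sup>2 + 1))" by (simp add: a_def l)
  have pos: "x\<^sup>2 + 1 > 0" by (simp add: add_nonneg_pos)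
  have "x * 1 \<le> x * x" using x by (intro mult_left_mono) auto
  then have "x < x\<^sup>2 + 1" by (simp add: power2_eq_square)
  then have "x / (x\<^sup>2 + 1) < 1" "x / (x\<^sup>2 + 1) > 0" using x pos by simp_all
  then have "(- x / (x\<^sup>2 + 1))\<^sup>2 \<noteq> 1" by (auto simp: power2_eq_1_iff)
  then have c: "1 - a\<^sup>2 \<noteq> 0" unfolding a by (metis eq_iff_diff_eq_0 of_real_1 of_real_eq_iff of_real_power)
  have l0: "l \<noteq> 0" "l\<^sup>2 + 1 \<noteq> 0" "l\<^sup>2 \<noteq> 1"
  proof -
    show "l \<noteq> 0" using x by (simp add: l)
    have "l\<^sup>2 + 1 = of_real (x\<^sup>2 + 1)" by (simp add: l)
    then show "l\<^sup>2 + 1 \<noteq> 0" using pos by (metis of_real_eq_0_iff less_irrefl)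
    have "x\<^sup>2 > 1" using x by (simp add: one_less_power)
    then have "of_real (x\<^sup>2) \<noteq> (1 :: complex)" by (metis of_real_1 of_real_eq_iff less_irrefl)
    then show "l\<^sup>2 \<noteq> 1" by (simp add: l)
  qed
  have d: "l - - 1 / l = (l\<^sup>2 + 1) / l" "l + - 1 / l = (l\<^sup>2 - 1) / l"
    using l0 by (simp_all add: field_simps power2_eq_square)
  have "l \<noteq> - 1 / l"
  proof
    assume "l = - 1 / l"
    then have "l - - 1 / l = 0" by (rule iffD2[OF right_minus_eq])
    then have "(l\<^sup>2 + 1) / l = 0" by (simp only: d)
    then show False using l0 by simp
  qed
  moreover have "l + - 1 / l \<noteq> 0" using d(2) l0 by auto
  moreover have "a * (l - - 1 / l) = - 1" unfolding d a_def using l0 by simp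
  ultimately show ?thesis unfolding irreducible_form_def using c l0 by simp
qed

text \<open>The spectrum at \<open>T\<close> is a class invariant, and the positive member of
  \<open>{n, - 1 / n}\<close> recovers \<open>n\<close>.\<close>

lemma infinite_admissible: "infinite (admissible_irreps // rep_equiv)"
proof -
  let ?l = "\<lambda>n::nat. complex_of_real (real n)"
  have "\<exists>\<rho>\<in>admissible_irreps. eigenvalues (\<rho> elt_T) = {?l n, - 1 / ?l n}" if n: "n \<ge> 2" for n
  proof -
    define l a where "l = ?l n" and "a = - l / (l\<^sup>2 + 1)"
    have f: "irreducible_form a 1 (1 - a\<^sup>2) l (- 1 / l) 1"
      using irreducible_form_nat[OF n] by (simp add: l_def a_def)
    note r = f[unfolded irreducible_form_def]
    obtain \<rho> where \<rho>: "is_rep \<rho>" "\<rho> elt_S = mat2 a 1 (1 - a\<^sup>2) (- a)" "\<rho> elt_T = mat2 l 0 0 (- 1 / l)"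
      using modular_pair_rep[OF modular_pair_irreducible_form[OF f]] by blast
    have l0: "- 1 / l \<noteq> 0" using r by auto
    have nr: "\<not> reducible_pair (\<rho> elt_S) (\<rho> elt_T)"
      unfolding \<rho> using r by (intro irreducible_pair_mat2) auto
    have q: "l / (- 1 / l) \<noteq> - 1"
    proof
      assume "l / (- 1 / l) = - 1"
      then have "l = - (- 1 / l)" using l0 by (metis nonzero_divide_eq_eq mult_minus1)
      then show False using r by (metis add.commute add.right_inverse)
    qed
    have eig: "eigenvalues (\<rho> elt_T) = {l, - 1 / l}" unfolding \<rho>(3) by (rule eigenvalues_mat2)
    from q r eig have "\<exists>l1 l2. eigenvalues (\<rho> elt_T) = {l1, l2} \<and> l1 \<noteq> l2 \<and> l1 / l2 \<noteq> - 1" by blast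
    with nr have "\<rho> \<in> admissible_irreps"
      unfolding admissible_irreps_def using \<rho>(1) by (simp add: reducible_iff_pair)
    then show ?thesis using eig unfolding l_def by blast
  qed
  then obtain R where R: "\<And>n. n \<ge> 2 \<Longrightarrow> R n \<in> admissible_irreps \<and> eigenvalues (R n elt_T) = {?l n, - 1 / ?l n}"
    by metis
  have rep: "is_rep (R n)" if "n \<ge> 2" for n using R[OF that] unfolding admissible_irreps_def by blast
  have "inj_on (\<lambda>n. rep_equiv `` {R n}) {2..}"
  proof (rule inj_onI)
    fix m n :: nat assume mn: "m \<in> {2..}" "n \<in> {2..}" and e: "rep_equiv `` {R m} = rep_equiv `` {R n}"
    then have "simconj (R m elt_S) (R m elt_T) (R n elt_S) (R n elt_T)"
      using rep by (simp add: rep_equiv_class_eq)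
    then have "{?l m, - 1 / ?l m} = {?l n, - 1 / ?l n}"
      using eigenvalues_simconj R mn by (metis atLeast_iff)
    then have "?l m = ?l n \<or> ?l m = - 1 / ?l n" by blast
    moreover have "?l m \<noteq> - 1 / ?l n"
    proof
      assume "?l m = - 1 / ?l n"
      then have "complex_of_real (real m) = complex_of_real (- 1 / real n)" by simp
      then have "real m = - 1 / real n" by (simp only: of_real_eq_iff)
      moreover have "- 1 / real n \<le> 0" by simp
      ultimately have "real m \<le> 0" by (simp only:)
      then show False using mn by simp
    qed
    ultimately show "m = n" by simp
  qed
  then have "infinite ((\<lambda>n. rep_equiv `` {R n}) ` {2..})"
    using finite_imageD infinite_Ici by blast
  moreover have "(\<lambda>n. rep_equiv `` {R n}) ` {2..} \<subseteq> admissible_irreps // rep_equiv"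
    using R by (auto simp: quotient_def)
  ultimately show ?thesis using infinite_super by blast
qed

theorem theorem1p1:
  shows
    "card (ext_reps sum_of_two_characters // rep_equiv) = 6 \<and>
     represented_by (ext_reps sum_of_two_characters)
       (pair_i ` {(1,5,0), (2,0,1), (3,1,2), (4,2,3), (5,3,4), (0,4,5)}) \<and>
     card (ext_reps (\<lambda>\<rho>0. reducible \<rho>0 \<and> indecomposable \<rho>0) // rep_equiv) = 18 \<and>
     represented_by (ext_reps (\<lambda>\<rho>0. reducible \<rho>0 \<and> indecomposable \<rho>0))
       (pair_iia ` {(1,2,0), (5,4,0), (2,3,1), (0,5,1), (3,4,2), (4,5,3)} \<union>
        pair_iib ` {(5,0,1), (1,0,5), (0,1,2), (2,1,0), (1,2,3), (3,2,1),
                    (2,3,4), (4,3,2), (3,4,5), (5,4,3), (4,5,0), (0,5,4)}) \<and>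
     (\<forall>\<rho>0\<in>admissible_irreps. card (ext_reps (equivalent \<rho>0) // rep_equiv) = 2) \<and>
     infinite (admissible_irreps // rep_equiv)"
  using card_represented_by[OF represented_by_i] card_represented_by[OF represented_by_ii]
    represented_by_i represented_by_ii card_i card_ii card_iii infinite_admissible
  unfolding ind_defs by simp

end
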